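(* Let $f:\mathbb{R}\times\mathbb{R}\to\mathbb{R}$. Let $\alpha \geq 0$, $0 < \beta \leq 1$ and $0 < \delta < 1/2$ be constants and let $0 < \epsilon \leq 1/2$. Let $\eta = \frac{2\alpha^2}{\beta^2}(1 + 1/\beta)$. Let $D$ be a distance measure over a space $\mathcal{X} \subseteq \mathbb{R}^d$ that satisfies: (1) the $\beta$-approximate symmetry property, (2) the $\alpha$-approximate triangle inequality, (3) the centroid property, and (4) the $(f,\epsilon,\delta)$-sampling property. Then there is an algorithm that runs in time $O\left(nd\cdot 2^{\tilde{O}(k\cdot f(\epsilon/\eta k,\, 0.2))}\right)$ and gives a $(1+\epsilon)$-approximation to the $k$-median objective with respect to $D$ for any point set $P \subseteq \mathcal{X}$ with $|P| = n$.
   Context: Given a set $P\subseteq\mathcal{X}$ and a dissimilarity measure $D:\mathcal{X}\times\mathcal{X}\to\mathbb{R}_{\ge 0}$, the $k$-median problem asks for a set $C$ of $k$ points (medians) minimizing $\Delta(P,C) = \sum_{p\in P}\min_{c\in C} D(p,c)$; $\Delta_j(P)$ denotes the optimum value with $j$ medians, and a $(1+\epsilon)$-approximation is a set $C$ of $k$ medians with $\Delta(P,C)\le(1+\epsilon)\Delta_k(P)$. For finite $S$, $m(S) = \frac{1}{|S|}\sum_{s\in S}s$. Properties: ($(f,\gamma,\delta)$-sampling) for any set $P\subseteq\mathcal{X}$, a uniformly random sample $S$ of $f(\gamma,\delta)$ points from $P$ satisfies $\Pr[\sum_{p\in P} D(p,m(S)) \le (1+\gamma)\Delta_1(P)] \ge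 1-\delta$. (Centroid) for any $P\subseteq\mathcal{X}$ and $c\in\mathcal{X}$, $\sum_{p\in P} D(p,c) = \Delta_1(P) + |P|\cdot D(m(P),c)$. ($\alpha$-approximate triangle inequality) for all $p,q,r\in\mathcal{X}$, $D(p,q)\le\alpha(D(p,r)+D(r,q))$. ($\beta$-approximate symmetry) for all $p,q\in\mathcal{X}$, $\beta D(q,p)\le D(p,q)\le \frac{1}{\beta}D(q,p)$. The $\tilde{O}$ notation hides logarithmic factors in the exponent. The algorithm is randomized and its approximation guarantee holds with high probability.
   Formalization: The sampling property is assumed for all parameters 0<γ≤1/2, 0<δ<1/2 (with f positive there), not only at the given ε and δ, since otherwise f(ε/ηk, 0.2) in the time bound would be unconstrained. *)

theory Defs
  imports "HOL-Probability.Probability_Mass_Function" "Jordan_Normal_Form.Matrix"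
begin

unbundle no vec_syntax

section \<open>Dissimilarity measures and the k-median objective\<close>

type_synonym point = "real Matrix.vec"
type_synonym dissim = "point \<Rightarrow> point \<Rightarrow> real"

text \<open>Random samples are drawn with replacement and may contain repeated points, so the centroid
  is taken of a multiset; a finite set \<open>P\<close> enters as \<open>mset_set P\<close>.\<close>

definition centroid :: "nat \<Rightarrow> point multiset \<Rightarrow> point" where
  "centroid d A = Matrix.vec d (\<lambda>j. (\<Sum>x\<in>#A. vec_index x j) / real (size A))"

definition med_cost :: "dissim \<Rightarrow> point set \<Rightarrow> point set \<Rightarrow> real" where
  "med_cost D P C = (\<Sum>p\<in>P. Min ((\<lambda>c. D p c) ` C))"

text \<open>A set of \<open>k\<close> medians is read as a \<open>k\<close>-tuple whose entries may coincide, i.e. as a nonempty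
  set of at most \<open>k\<close> points (the objective only decreases when points are added).\<close>

definition medians :: "point set \<Rightarrow> nat \<Rightarrow> point set set" where
  "medians X k = {C. C \<subseteq> X \<and> finite C \<and> C \<noteq> {} \<and> card C \<le> k}"

definition opt_cost :: "dissim \<Rightarrow> point set \<Rightarrow> nat \<Rightarrow> point set \<Rightarrow> real" where
  "opt_cost D X k P = (INF C\<in>medians X k. med_cost D P C)"

definition dissimilarity_on :: "point set \<Rightarrow> dissim \<Rightarrow> bool" where
  "dissimilarity_on X D \<longleftrightarrow> (\<forall>p\<in>X. \<forall>q\<in>X. 0 \<le> D p q)"

definition approx_symmetric :: "real \<Rightarrow> point set \<Rightarrow> dissim \<Rightarrow> bool" where
  "approx_symmetric \<beta> X D \<longleftrightarrow>
     (\<forall>p\<in>X. \<forall>q\<in>X. \<beta> * D q p \<le> D p q \<and> D p q \<le> 1 / \<beta> * D q p)"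

definition approx_triangle :: "real \<Rightarrow> point set \<Rightarrow> dissim \<Rightarrow> bool" where
  "approx_triangle \<alpha> X D \<longleftrightarrow>
     (\<forall>p\<in>X. \<forall>q\<in>X. \<forall>r\<in>X. D p q \<le> \<alpha> * (D p r + D r q))"

text \<open>\<open>D\<close> is only meaningful on \<open>X \<times> X\<close>, so the next two properties carry the (otherwise tacit)
  requirement that the centroids to which \<open>D\<close> is applied belong to \<open>X\<close>.\<close>

definition centroid_property :: "nat \<Rightarrow> point set \<Rightarrow> dissim \<Rightarrow> bool" where
  "centroid_property d X D \<longleftrightarrow>
     (\<forall>P. P \<subseteq> X \<and> finite P \<and> P \<noteq> {} \<longrightarrow>
        centroid d (mset_set P) \<in> X \<and>
        (\<forall>c\<in>X. (\<Sum>p\<in>P. D p c) =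
                 opt_cost D X 1 P + real (card P) * D (centroid d (mset_set P)) c))"

text \<open>A sample of \<open>f \<gamma> \<delta>\<close> points consists of that many (rounded up) independent uniform draws.
  It has to be nonempty for its centroid to make sense.\<close>

definition sampling_property ::
  "nat \<Rightarrow> point set \<Rightarrow> dissim \<Rightarrow> (real \<Rightarrow> real \<Rightarrow> real) \<Rightarrow> real \<Rightarrow> real \<Rightarrow> bool" where
  "sampling_property d X D f \<gamma> \<delta> \<longleftrightarrow>
     0 < f \<gamma> \<delta> \<and>
     (\<forall>P. P \<subseteq> X \<and> finite P \<and> P \<noteq> {} \<longrightarrow>
        (let Smp = replicate_pmf (nat \<lceil>f \<gamma> \<delta>\<rceil>) (pmf_of_set P) in
           (\<forall>S\<in>set_pmf Smp. centroid d (mset S) \<in> X) \<and>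
           measure_pmf.prob Smp
             {S. (\<Sum>p\<in>P. D p (centroid d (mset S))) \<le> (1 + \<gamma>) * opt_cost D X 1 P} \<ge> 1 - \<delta>))"


section \<open>Randomized real RAM with a dissimilarity oracle\<close>

text \<open>The machine has natural-number index registers and a memory of exact reals, addressed through
  index expressions. Real arithmetic, comparisons, index arithmetic (addition and truncated
  subtraction only) and memory accesses have unit cost; there is no rounding operation and there are
  no real constants other than those obtained from naturals. \<open>Flip\<close> tosses a coin whose bias is a
  computed real, i.e. it compares that real with a uniform random number from the unit interval; the
  bias is clamped to the unit interval by \<^const>\<open>bernoulli_pmf\<close>. Evaluating \<open>D\<close> on two
  \<open>d\<close>-dimensional points stored in memory is charged \<open>d\<close>.\<close>

datatype nexp = NConst nat | NReg nat | NAdd nexp nexp | NSub nexp nexp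

datatype rexp = OfIdx nexp | Load nexp
  | RAdd rexp rexp | RSub rexp rexp | RMul rexp rexp | RDiv rexp rexp

datatype cond = NLess nexp nexp | RLess rexp rexp

datatype com = Skip
  | SetIdx nat nexp
  | Store nexp rexp
  | Dissim nexp nexp nexp
  | Flip nat rexp
  | Seq com com
  | Cond cond com com
  | While cond com

record state =
  idx :: "nat \<Rightarrow> nat"
  mem :: "nat \<Rightarrow> real"

primrec nval :: "nexp \<Rightarrow> state \<Rightarrow> nat" where
  "nval (NConst c) s = c"
| "nval (NReg i) s = idx s i"
| "nval (NAdd a b) s = nval a s + nval b s"
| "nval (NSub a b) s = nval a s - nval b s"

primrec ncost :: "nexp \<Rightarrow> nat" where
  "ncost (NConst c) = 1"
| "ncost (NReg i) = 1"
| "ncost (NAdd a b) = ncost a + ncost b + 1"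
| "ncost (NSub a b) = ncost a + ncost b + 1"

primrec rval :: "rexp \<Rightarrow> state \<Rightarrow> real" where
  "rval (OfIdx a) s = real (nval a s)"
| "rval (Load a) s = mem s (nval a s)"
| "rval (RAdd x y) s = rval x s + rval y s"
| "rval (RSub x y) s = rval x s - rval y s"
| "rval (RMul x y) s = rval x s * rval y s"
| "rval (RDiv x y) s = rval x s / rval y s"

primrec rcost :: "rexp \<Rightarrow> nat" where
  "rcost (OfIdx a) = ncost a + 1"
| "rcost (Load a) = ncost a + 1"
| "rcost (RAdd x y) = rcost x + rcost y + 1"
| "rcost (RSub x y) = rcost x + rcost y + 1"
| "rcost (RMul x y) = rcost x + rcost y + 1"
| "rcost (RDiv x y) = rcost x + rcost y + 1"

primrec cval :: "cond \<Rightarrow> state \<Rightarrow> bool" where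
  "cval (NLess a b) s \<longleftrightarrow> nval a s < nval b s"
| "cval (RLess x y) s \<longleftrightarrow> rval x s < rval y s"

primrec ccost :: "cond \<Rightarrow> nat" where
  "ccost (NLess a b) = ncost a + ncost b + 1"
| "ccost (RLess x y) = rcost x + rcost y + 1"

definition point_at :: "nat \<Rightarrow> state \<Rightarrow> nat \<Rightarrow> point" where
  "point_at d s a = Matrix.vec d (\<lambda>j. mem s (a + j))"

definition set_idx :: "nat \<Rightarrow> nat \<Rightarrow> state \<Rightarrow> state" where
  "set_idx i v s = s\<lparr>idx := (idx s)(i := v)\<rparr>"

definition set_mem :: "nat \<Rightarrow> real \<Rightarrow> state \<Rightarrow> state" where
  "set_mem a x s = s\<lparr>mem := (mem s)(a := x)\<rparr>"

definition charge :: "nat \<Rightarrow> (state \<times> nat) pmf \<Rightarrow> (state \<times> nat) pmf" where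
  "charge c \<mu> = map_pmf (\<lambda>(s, t). (s, c + t)) \<mu>"

text \<open>Big-step semantics: \<open>exec d D c s \<mu>\<close> means that \<open>c\<close>, started in \<open>s\<close>, halts on every sequence of
  coin tosses, and that \<open>\<mu>\<close> is the joint distribution of final state and running time.\<close>

inductive exec :: "nat \<Rightarrow> dissim \<Rightarrow> com \<Rightarrow> state \<Rightarrow> (state \<times> nat) pmf \<Rightarrow> bool"
  for d :: nat and D :: dissim where
  Skip: "exec d D Skip s (return_pmf (s, 1))"
| SetIdx: "exec d D (SetIdx i a) s (return_pmf (set_idx i (nval a s) s, 1 + ncost a))"
| Store: "exec d D (Store a x) s
    (return_pmf (set_mem (nval a s) (rval x s) s, 1 + ncost a + rcost x))"
| Dissim: "exec d D (Dissim r a b) s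
    (return_pmf (set_mem (nval r s) (D (point_at d s (nval a s)) (point_at d s (nval b s))) s,
       1 + d + ncost r + ncost a + ncost b))"
| Flip: "exec d D (Flip i x) s
    (map_pmf (\<lambda>h. (set_idx i (of_bool h) s, 1 + rcost x)) (bernoulli_pmf (rval x s)))"
| Seq: "exec d D c s \<mu> \<Longrightarrow> (\<And>s' t. (s', t) \<in> set_pmf \<mu> \<Longrightarrow> exec d D c' s' (\<nu> s')) \<Longrightarrow>
    exec d D (Seq c c') s (bind_pmf \<mu> (\<lambda>(s', t). charge t (\<nu> s')))"
| CondTrue: "cval b s \<Longrightarrow> exec d D c s \<mu> \<Longrightarrow> exec d D (Cond b c c') s (charge (ccost b) \<mu>)"
| CondFalse: "\<not> cval b s \<Longrightarrow> exec d D c' s \<mu> \<Longrightarrow> exec d D (Cond b c c') s (charge (ccost b) \<mu>)"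
| WhileTrue: "cval b s \<Longrightarrow> exec d D (Seq c (While b c)) s \<mu> \<Longrightarrow>
    exec d D (While b c) s (charge (ccost b) \<mu>)"
| WhileFalse: "\<not> cval b s \<Longrightarrow> exec d D (While b c) s (return_pmf (s, ccost b))"

inductive_cases exec_SeqE: "exec d D (Seq c c') s \<mu>"

lemma exec_deterministic: "exec d D c s \<mu> \<Longrightarrow> exec d D c s \<mu>' \<Longrightarrow> \<mu>' = \<mu>"
proof (induction arbitrary: \<mu>' rule: exec.induct)
  case (Seq c s \<mu> c' \<nu>)
  from Seq.prems obtain \<mu>2 \<nu>2 where
    *: "\<mu>' = bind_pmf \<mu>2 (\<lambda>(s', t). charge t (\<nu>2 s'))" "exec d D c s \<mu>2"
       "\<And>s' t. (s', t) \<in> set_pmf \<mu>2 \<Longrightarrow> exec d D c' s' (\<nu>2 s')"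
    by (rule exec_SeqE) blast
  have "\<mu>2 = \<mu>" using Seq.IH(1) *(2) by blast
  moreover have "\<nu>2 s' = \<nu> s'" if "(s', t) \<in> set_pmf \<mu>" for s' t
    using that Seq.IH(2) *(3) \<open>\<mu>2 = \<mu>\<close> by blast
  ultimately show ?case
    unfolding *(1) by (auto intro!: bind_pmf_cong)
qed (erule exec.cases; force)+

text \<open>The number of points and the dimension are passed in index registers \<open>0\<close> and \<open>1\<close>, the
  coordinates row by row from address \<open>0\<close> on. On halting, register \<open>0\<close> holds the number of medians
  and register \<open>1\<close> the address of the first coordinate of the first one.\<close>

definition input_state :: "nat \<Rightarrow> point list \<Rightarrow> state" where
  "input_state d ps =
     \<lparr>idx = (\<lambda>_. 0)(0 := length ps, 1 := d),
      mem = (\<lambda>a. if a < length ps * d then vec_index (ps ! (a div d)) (a mod d) else 0)\<rparr>"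

definition output_set :: "nat \<Rightarrow> state \<Rightarrow> point set" where
  "output_set d s = (\<lambda>i. point_at d s (idx s 1 + i * d)) ` {..<idx s 0}"

text \<open>\<open>ps\<close> enumerates the input set \<open>P\<close>; \<open>T n\<close> bounds the running time on \<open>n\<close> points for every outcome
  of the coin tosses, and the approximation guarantee may fail with probability at most \<open>\<rho>\<close>.\<close>

definition approximates_k_median ::
  "nat \<Rightarrow> point set \<Rightarrow> dissim \<Rightarrow> nat \<Rightarrow> real \<Rightarrow> real \<Rightarrow> (nat \<Rightarrow> real) \<Rightarrow> com \<Rightarrow> bool" where
  "approximates_k_median d X D k \<epsilon> \<rho> T prog \<longleftrightarrow>
     (\<forall>ps. distinct ps \<and> ps \<noteq> [] \<and> set ps \<subseteq> X \<longrightarrow>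
        (\<exists>\<mu>. exec d D prog (input_state d ps) \<mu> \<and>
             (\<forall>(s, t)\<in>set_pmf \<mu>. real t \<le> T (length ps)) \<and>
             measure_pmf.prob \<mu>
               {(s, t). output_set d s \<in> medians X k \<and>
                        med_cost D (set ps) (output_set d s)
                          \<le> (1 + \<epsilon>) * opt_cost D X k (set ps)} \<ge> 1 - \<rho>))"

end

(* Centres are guessed one after the other: each is the centroid of M = ceil f(eps/(eta k), 0.2)
   points drawn independently with probability proportional to their dissimilarity to the centres
   chosen so far (uniformly for the first one). Fix an optimal solution and consider, among its
   clusters that are not yet served almost optimally, the one with the largest current cost. The
   points of that cluster which are not extremely close to a chosen centre form a set F that
   carries, up to factors polynomial in eps/k, the uniform distribution; hence with probability
   (poly(eps/k))^M the M draws behave like a uniform sample from F, and the sampling property yields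
   a good centre for F, while the remaining points are cheap already. After k rounds all clusters
   are served with probability 2^(-O~(k M)), and the best of 2^(O~(k M)) independent trials is
   returned.

   That F cannot be a tiny part of the cluster rests on a continuity property of D in its second
   argument, which follows from the centroid property and approximate symmetry. If f <= 1, a single
   sample point suffices for every set, which forces D = 0. *)

theory Submission
  imports Defs
begin

section \<open>Dissimilarities with the centroid property\<close>

text \<open>The triangle inequality alone loses a factor \<alpha> even for a centre that is
  arbitrarily close to an optimal one, so for \<alpha> > 1 it can never certify a factor 1 +
  \<epsilon>. Continuity supplies that factor, and it has to be quantitative: the closeness it
  demands is polynomial in \<epsilon> with a degree depending on \<beta> only. Otherwise the
  logarithm of the probability per draw would not fit into the logarithmic factor of the exponent. A
  cluster counts as served up to a relative slack \<epsilon>/2 and an additive slack of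
  \<epsilon>/(2k) times the optimum. Over at most k clusters both add up to \<epsilon>; the additive
  one ensures that the costliest unserved cluster carries a share of at least \<epsilon>/(4k) of the
  total weight. The program is fixed before its input, so the number of trials comes from a bound on
  the success probability that is uniform in the point set. Small f is treated apart because M is f
  rounded up: only for f > 1 are both M and k controlled by the product k * f in the
  exponent.\<close>

locale dissim_space =
  fixes d :: nat and X :: "point set" and D :: dissim and \<alpha> \<beta> :: real
  assumes X_carrier: "X \<subseteq> carrier_vec d"
    and D_nonneg': "dissimilarity_on X D"
    and D_sym': "approx_symmetric \<beta> X D"
    and D_tri': "approx_triangle \<alpha> X D"
    and D_centroid': "centroid_property d X D"
    and alpha_nonneg: "0 \<le> \<alpha>" and beta_pos: "0 < \<beta>" and beta_le: "\<beta> \<le> 1"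
begin

lemma D_nonneg: "p \<in> X \<Longrightarrow> q \<in> X \<Longrightarrow> 0 \<le> D p q"
  using D_nonneg' by (auto simp: dissimilarity_on_def)

lemma D_sym: "p \<in> X \<Longrightarrow> q \<in> X \<Longrightarrow> \<beta> * D q p \<le> D p q"
  using D_sym' by (auto simp: approx_symmetric_def)

lemma D_sym2: "p \<in> X \<Longrightarrow> q \<in> X \<Longrightarrow> D p q \<le> D q p / \<beta>"
  using D_sym' by (auto simp: approx_symmetric_def)

lemma D_tri: "p \<in> X \<Longrightarrow> q \<in> X \<Longrightarrow> r \<in> X \<Longrightarrow> D p q \<le> \<alpha> * (D p r + D r q)"
  using D_tri' by (auto simp: approx_triangle_def)

lemma centroid_in: "P \<subseteq> X \<Longrightarrow> finite P \<Longrightarrow> P \<noteq> {} \<Longrightarrow> centroid d (mset_set P) \<in> X"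
  using D_centroid' by (auto simp: centroid_property_def)

lemma medians_1: "medians X 1 = (\<lambda>c. {c}) ` X"
proof -
  have "C \<in> (\<lambda>c. {c}) ` X" if "C \<in> medians X 1" for C
  proof -
    have "card C = 1" using that by (auto simp: medians_def card_gt_0_iff le_Suc_eq)
    then obtain c where "C = {c}" by (auto simp: card_1_singleton_iff)
    then show ?thesis using that by (auto simp: medians_def)
  qed
  then show ?thesis by (auto simp: medians_def)
qed

lemma med_cost_nonneg: "P \<subseteq> X \<Longrightarrow> C \<in> medians X k \<Longrightarrow> 0 \<le> med_cost D P C"
  unfolding med_cost_def medians_def
  by (intro sum_nonneg) (auto intro!: D_nonneg)

lemma opt_cost_le: "P \<subseteq> X \<Longrightarrow> C \<in> medians X k \<Longrightarrow> opt_cost D X k P \<le> med_cost D P C"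
  unfolding opt_cost_def
  by (rule cINF_lower) (auto intro!: bdd_belowI[of _ 0] med_cost_nonneg)

lemma opt_cost_1_le:
  assumes "P \<subseteq> X" "c \<in> X" shows "opt_cost D X 1 P \<le> (\<Sum>p\<in>P. D p c)"
proof -
  have "{c} \<in> medians X 1" using assms unfolding medians_1 by auto
  from opt_cost_le[OF assms(1) this] show ?thesis by (simp add: med_cost_def)
qed

lemma centroid_identity:
  assumes "P \<subseteq> X" "finite P" "P \<noteq> {}" "c \<in> X"
  shows "(\<Sum>p\<in>P. D p c) = opt_cost D X 1 P + real (card P) * D (centroid d (mset_set P)) c"
  using D_centroid' assms by (auto simp: centroid_property_def)

lemma centroid_singleton: "q \<in> X \<Longrightarrow> centroid d (mset_set {q}) = q"
  using X_carrier by (auto simp: centroid_def intro!: eq_vecI)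

text \<open>The centroid identity for {q} at q itself cancels to optimum 0. If \<open>D q q\<close>
  were positive, going from q to c and back would bound every \<open>D q c\<close> below by a fixed
  positive multiple of \<open>D q q\<close>, and the optimum with it.\<close>

lemma D_self:
  assumes q: "q \<in> X" shows "D q q = 0"
proof (rule ccontr)
  assume "D q q \<noteq> 0"
  then have pos: "0 < D q q" using D_nonneg[OF q q] by simp
  have opt: "opt_cost D X 1 {q} = 0"
    using centroid_identity[of "{q}" q] q centroid_singleton[OF q] by simp
  define u where "u = \<alpha> * (1 + 1 / \<beta>)"
  have u0: "0 \<le> u" using alpha_nonneg beta_pos by (simp add: u_def)
  have *: "D q q \<le> u * D q c" if c: "c \<in> X" for c
  proof -
    have "D q q \<le> \<alpha> * (D q c + D c q)" by (rule D_tri[OF q q c])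
    also have "\<dots> \<le> \<alpha> * (D q c + D q c / \<beta>)"
      using D_sym2[OF c q] alpha_nonneg by (intro mult_left_mono) auto
    also have "\<dots> = u * D q c" by (simp add: u_def algebra_simps)
    finally show ?thesis .
  qed
  have up: "0 < u" using *[OF q] pos u0 by (cases "u = 0") auto
  have "D q q / u \<le> opt_cost D X 1 {q}"
    unfolding opt_cost_def medians_1
  proof (rule cINF_greatest)
    show "(\<lambda>c. {c}) ` X \<noteq> {}" using q by auto
    fix C assume "C \<in> (\<lambda>c. {c}) ` X"
    then show "D q q / u \<le> med_cost D {q} C"
      using * up by (auto simp: med_cost_def field_simps)
  qed
  then show False using opt pos up by (simp add: field_simps)
qed

lemma opt_cost_1_centroid:
  assumes "P \<subseteq> X" "finite P" "P \<noteq> {}"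
  shows "opt_cost D X 1 P = (\<Sum>p\<in>P. D p (centroid d (mset_set P)))"
  using centroid_identity[OF assms centroid_in[OF assms]] D_self[OF centroid_in[OF assms]] by simp

text \<open>The detour through q itself already contracts. This disposes of \<alpha> < 1, so that
  the analysis may assume 1 \<le> \<alpha>.\<close>

lemma D_zero_if_alpha_small:
  assumes "\<alpha> < 1" "p \<in> X" "q \<in> X" shows "D p q = 0"
proof -
  have "D p q \<le> \<alpha> * (D p q + D q q)" by (rule D_tri) fact+
  then have "(1 - \<alpha>) * D p q \<le> 0" using D_self[OF assms(3)] by (simp add: algebra_simps)
  then show ?thesis using D_nonneg[OF assms(2,3)] assms(1)
    by (smt (verit) mult_pos_pos)
qed

section \<open>Midpoints and continuity in the second argument\<close>

definition mid :: "point \<Rightarrow> point \<Rightarrow> point" where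
  "mid a b = centroid d (mset_set {a, b})"

lemma mid_in: "a \<in> X \<Longrightarrow> b \<in> X \<Longrightarrow> mid a b \<in> X"
  unfolding mid_def by (rule centroid_in) auto

lemma mid_same: "a \<in> X \<Longrightarrow> mid a a = a"
  unfolding mid_def using centroid_singleton by simp

text \<open>An analogue of the parallelogram law: the centroid identity of a two-point set, with its
  optimum written out. For a = b the set collapses to one point and \<open>D_self\<close> takes
  over.\<close>

lemma mid_identity:
  assumes "a \<in> X" "b \<in> X" "c \<in> X"
  shows "D a c + D b c = D a (mid a b) + D b (mid a b) + 2 * D (mid a b) c"
proof (cases "a = b")
  case True then show ?thesis using assms by (simp add: mid_same D_self)
next
  case False
  have P: "{a, b} \<subseteq> X" "finite {a, b}" "{a, b} \<noteq> {}" using assms by auto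
  show ?thesis
    using centroid_identity[OF P assms(3)] opt_cost_1_centroid[OF P] False
    by (simp add: mid_def)
qed

text \<open>Evaluate the identity at c = a: besides twice \<open>D (mid a b) a\<close>, the value
  \<open>D b a\<close> contains \<open>D a (mid a b)\<close>, which approximate symmetry bounds
  below. The surplus \<beta> over 2 is the source of continuity: distances shrink faster than the
  segment.\<close>

lemma mid_halves:
  assumes "a \<in> X" "b \<in> X" shows "D (mid a b) a \<le> D b a / (2 + \<beta>)"
proof -
  note m = mid_in[OF assms]
  have "D b a = D a (mid a b) + D b (mid a b) + 2 * D (mid a b) a"
    using mid_identity[OF assms assms(1)] D_self[OF assms(1)] by simp
  then have "(2 + \<beta>) * D (mid a b) a \<le> D b a"
    using D_sym[OF assms(1) m] D_nonneg[OF assms(2) m] by (simp add: algebra_simps)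
  then show ?thesis using beta_pos by (simp add: field_simps)
qed

text \<open>In the difference of two instances of \<open>mid_identity\<close> the terms independent
  of c cancel.\<close>

lemma mid_affine:
  assumes "a \<in> X" "b \<in> X" "c \<in> X" "c' \<in> X"
  shows "D (mid a b) c' - D (mid a b) c = ((D a c' - D a c) + (D b c' - D b c)) / 2"
  using mid_identity[OF assms(1,2,3)] mid_identity[OF assms(1,2,4)] by simp

text \<open>Near \<open>a\<close>, on the segment towards \<open>z\<close>, \<open>D _ a\<close> decays superlinearly (by approximate symmetry)
  while \<open>D _ a' - D _ a\<close> is affine; comparing the two bounds its value at \<open>z\<close>.\<close>

lemma second_argument_continuity:
  assumes a: "a \<in> X" and a': "a' \<in> X" and z: "z \<in> X"
  shows "D z a' - D z a \<le> \<alpha> * 2 ^ i * (D z a / (2 + \<beta>) ^ i + D a a')"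
proof -
  define x where "x = (\<lambda>i. (mid a ^^ i) z)"
  have xS: "x (Suc i) = mid a (x i)" for i by (simp add: x_def)
  have x0: "x 0 = z" by (simp add: x_def)
  have xX: "x i \<in> X" for i by (induction i) (auto simp: x0 xS z a mid_in)
  have dec: "D (x i) a \<le> D z a / (2 + \<beta>) ^ i" for i
  proof (induction i)
    case (Suc i)
    have "D (x (Suc i)) a \<le> D (x i) a / (2 + \<beta>)" unfolding xS by (rule mid_halves[OF a xX])
    also have "\<dots> \<le> (D z a / (2 + \<beta>) ^ i) / (2 + \<beta>)"
      using Suc beta_pos by (intro divide_right_mono) auto
    finally show ?case by (simp add: field_simps)
  qed (simp add: x0)
  \<comment> \<open>Each halving turns the difference into half of itself plus half of
    \<open>D a a'\<close>; the latter is nonnegative and may be dropped.\<close>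
  have aff: "(D z a' - D z a) \<le> 2 ^ i * (D (x i) a' - D (x i) a)" for i
  proof (induction i)
    case (Suc i)
    have "2 * (D (x (Suc i)) a' - D (x (Suc i)) a) = D a a' + (D (x i) a' - D (x i) a)"
      unfolding xS mid_affine[OF a xX a a'] using D_self[OF a] by simp
    then have "D (x i) a' - D (x i) a \<le> 2 * (D (x (Suc i)) a' - D (x (Suc i)) a)"
      using D_nonneg[OF a a'] by simp
    from mult_left_mono[OF this, of "2 ^ i"] Suc show ?case by (simp add: algebra_simps)
  qed (simp add: x0)
  have "D (x i) a' - D (x i) a \<le> \<alpha> * (D (x i) a + D a a')"
    using D_tri[OF xX a' a] D_nonneg[OF xX a] by (smt (verit))
  also have "\<dots> \<le> \<alpha> * (D z a / (2 + \<beta>) ^ i + D a a')"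
    using dec alpha_nonneg by (intro mult_left_mono) auto
  finally have "2 ^ i * (D (x i) a' - D (x i) a) \<le> 2 ^ i * (\<alpha> * (D z a / (2 + \<beta>) ^ i + D a a'))"
    by (intro mult_left_mono) auto
  with aff[of i] show ?thesis by (simp add: algebra_simps)
qed

text \<open>In \<open>second_argument_continuity\<close> one term falls with i like (2/(2 +
  \<beta>))^i while the other grows like 2^i. With i = b * r and 2^r just above
  16\<alpha>/\<epsilon>, the first drops to \<epsilon>/16, yet 2^i stays at most
  (32\<alpha>/\<epsilon>)^b. Hence b of the b + 1 factors in \<open>close\<close> cancel 2^i, and
  the remaining one makes the second term small.\<close>

lemma second_argument_perturbation:
  assumes a: "a \<in> X" and a': "a' \<in> X" and z: "z \<in> X"
    and \<alpha>1: "1 \<le> \<alpha>" and b: "(2 / (2 + \<beta>)) ^ b \<le> 1 / 2"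
    and \<epsilon>: "0 < \<epsilon>" "\<epsilon> \<le> 1"
    and close: "D a a' \<le> (\<epsilon> / (32 * \<alpha>)) ^ (b + 1) * D z a"
  shows "D z a' \<le> (1 + \<epsilon> / 8) * D z a"
proof -
  define v where "v = 16 * \<alpha> / \<epsilon>"
  have v1: "1 \<le> v" using \<alpha>1 \<epsilon> by (simp add: v_def field_simps)
  obtain r0 where "v < 2 ^ r0" using real_arch_pow[of 2 v] by auto
  \<comment> \<open>Minimality of r bounds 2^r from above by 2v, which keeps 2^i polynomial in
    1/\<epsilon>.\<close>
  define r where "r = (LEAST r. v < 2 ^ r)"
  have r: "v < 2 ^ r" unfolding r_def by (rule LeastI) fact
  have "r \<noteq> 0" using r v1 by (intro notI) simp
  then obtain r' where r': "r = Suc r'" by (cases r) auto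
  have "\<not> v < 2 ^ r'" using not_less_Least[of r' "\<lambda>r. v < 2 ^ r"] r' unfolding r_def by simp
  then have r2: "2 ^ r \<le> 2 * v" by (simp add: r')
  define i where "i = b * r"
  have Dn: "0 \<le> D z a" using D_nonneg z a .
  have "2 ^ i / (2 + \<beta>) ^ i = ((2 / (2 + \<beta>)) ^ b) ^ r"
    by (simp add: i_def power_mult power_divide)
  also have "\<dots> \<le> (1 / 2) ^ r" using b beta_pos by (intro power_mono) auto
  also have "\<dots> \<le> 1 / v" using r v1 by (simp add: field_simps power_divide)
  finally have 1: "\<alpha> * (2 ^ i / (2 + \<beta>) ^ i) \<le> \<epsilon> / 16"
    using \<alpha>1 \<epsilon> by (simp add: v_def field_simps)
  have e: "2 * v = 1 / (\<epsilon> / (32 * \<alpha>))" by (simp add: v_def)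
  have "(2::real) ^ i = (2 ^ r) ^ b" by (simp add: i_def mult.commute flip: power_mult)
  also have "\<dots> \<le> (2 * v) ^ b" using r2 by (intro power_mono) auto
  finally have "2 ^ i * (\<epsilon> / (32 * \<alpha>)) ^ b \<le> (2 * v) ^ b * (\<epsilon> / (32 * \<alpha>)) ^ b"
    using \<epsilon> \<alpha>1 by (intro mult_right_mono) auto
  also have "\<dots> = 1"
    using \<epsilon> \<alpha>1 unfolding e by (simp flip: power_mult_distrib)
  finally have "2 ^ i * (\<epsilon> / (32 * \<alpha>)) ^ b \<le> 1" .
  then have "(2 ^ i * (\<epsilon> / (32 * \<alpha>)) ^ b) * (\<epsilon> / (32 * \<alpha>)) \<le> \<epsilon> / (32 * \<alpha>)"
    using \<epsilon> \<alpha>1 by (intro mult_left_le_one_le) auto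
  then have "\<alpha> * ((2 ^ i * (\<epsilon> / (32 * \<alpha>)) ^ b) * (\<epsilon> / (32 * \<alpha>))) \<le> \<alpha> * (\<epsilon> / (32 * \<alpha>))"
    using \<alpha>1 by (intro mult_left_mono) auto
  then have "\<alpha> * 2 ^ i * (\<epsilon> / (32 * \<alpha>)) ^ (b + 1) \<le> \<alpha> * (\<epsilon> / (32 * \<alpha>))"
    by (simp add: mult_ac)
  also have "\<dots> \<le> \<epsilon> / 16" using \<alpha>1 \<epsilon> by simp
  finally have 2: "\<alpha> * 2 ^ i * (\<epsilon> / (32 * \<alpha>)) ^ (b + 1) \<le> \<epsilon> / 16" .
  have "D z a' - D z a \<le> \<alpha> * 2 ^ i * (D z a / (2 + \<beta>) ^ i + D a a')"
    by (rule second_argument_continuity[OF a a' z])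
  also have "\<dots> \<le> \<alpha> * 2 ^ i * (D z a / (2 + \<beta>) ^ i + (\<epsilon> / (32 * \<alpha>)) ^ (b + 1) * D z a)"
    using close \<alpha>1 by (intro mult_left_mono add_left_mono) auto
  also have "\<dots> = (\<alpha> * (2 ^ i / (2 + \<beta>) ^ i)) * D z a
      + (\<alpha> * 2 ^ i * (\<epsilon> / (32 * \<alpha>)) ^ (b + 1)) * D z a"
    by (simp add: algebra_simps)
  also have "\<dots> \<le> \<epsilon> / 16 * D z a + \<epsilon> / 16 * D z a"
    by (intro add_mono mult_right_mono 1 2 Dn)
  finally show ?thesis by (simp add: algebra_simps)
qed

end

section \<open>Badly served clusters\<close>

locale dissim_space_params = dissim_space +
  fixes b :: nat and \<epsilon> :: real
  assumes alpha_ge_1: "1 \<le> \<alpha>" and b_decay: "(2 / (2 + \<beta>)) ^ b \<le> 1 / 2"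
    and eps_pos: "0 < \<epsilon>" and eps_le: "\<epsilon> \<le> 1 / 2"
begin

text \<open>Let A be the cost of a cluster of N points with centre m. If p has \<open>D p m\<close>
  at most 2A/N and \<open>D p c\<close> at most A/N, then \<open>D m c\<close> is at most
  \<open>near_const\<close> times A/N. \<open>near_frac\<close> is a weight threshold relative to
  the mean weight. \<open>near_const * close_frac\<close> is the closeness demanded by
  \<open>second_argument_perturbation\<close>. \<open>far_frac\<close> is such that
  \<open>far_frac\<close> * N points, each costing at most \<alpha> (1 / \<open>close_frac\<close> +
  \<open>near_const\<close>) A/N, cost \<epsilon>/8 * A together.\<close>

definition near_const :: real where "near_const = \<alpha> * (2 / \<beta> + 1)"
definition near_frac :: real where "near_frac = \<epsilon> * \<beta> / (32 * \<alpha>\<^sup>2)"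
definition close_frac :: real where "close_frac = (\<epsilon> / (32 * \<alpha>)) ^ (b + 1) / near_const"
definition far_frac :: real where "far_frac = \<epsilon> / (8 * \<alpha> * (1 / close_frac + near_const))"

lemma near_const_ge_1: "1 \<le> near_const"
proof -
  have "1 * 1 \<le> \<alpha> * (2 / \<beta> + 1)" using alpha_ge_1 beta_pos by (intro mult_mono) auto
  then show ?thesis by (simp add: near_const_def)
qed

lemma near_frac_pos: "0 < near_frac" using eps_pos beta_pos alpha_ge_1 by (simp add: near_frac_def)

lemma close_frac_pos: "0 < close_frac"
  using near_const_ge_1 eps_pos alpha_ge_1 by (simp add: close_frac_def)

lemma far_frac_pos: "0 < far_frac"
  using close_frac_pos near_const_ge_1 eps_pos alpha_ge_1
  by (auto simp: far_frac_def intro!: divide_pos_pos mult_pos_pos add_pos_pos)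

lemma far_frac_le: "far_frac \<le> 1 / 2"
proof -
  have "1 * 1 \<le> \<alpha> * (1 / close_frac + near_const)"
    using alpha_ge_1 near_const_ge_1 close_frac_pos
    by (intro mult_mono) (auto simp: add_increasing)
  then have "\<epsilon> \<le> 8 * \<alpha> * (1 / close_frac + near_const) / 2"
    using eps_le by simp
  then show ?thesis
    using alpha_ge_1 near_const_ge_1 close_frac_pos
    by (simp add: far_frac_def divide_le_eq add_pos_pos)
qed

lemma near_frac_le: "near_frac \<le> 1 / (4 * \<alpha>\<^sup>2)" "near_frac \<le> 1"
proof -
  have "\<epsilon> * \<beta> \<le> 1 * 1" using eps_pos eps_le beta_pos beta_le by (intro mult_mono) auto
  then show *: "near_frac \<le> 1 / (4 * \<alpha>\<^sup>2)"
    using alpha_ge_1 by (simp add: near_frac_def field_simps)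
  have "1 \<le> \<alpha>\<^sup>2" using alpha_ge_1 by simp
  then have "1 / (4 * \<alpha>\<^sup>2) \<le> 1" using frac_le[of 1 1 1 "4 * \<alpha>\<^sup>2"] by simp
  with * show "near_frac \<le> 1" by linarith
qed

lemma center_dist_near:
  assumes "c \<in> X" "m \<in> X" "p \<in> X"
  shows "D m c \<le> \<alpha> * (D p m / \<beta> + D p c)"
proof -
  have "D m c \<le> \<alpha> * (D m p + D p c)" by (rule D_tri) fact+
  also have "\<dots> \<le> \<alpha> * (D p m / \<beta> + D p c)"
    using D_sym2[OF assms(2,3)] alpha_nonneg by (intro mult_left_mono) auto
  finally show ?thesis .
qed

text \<open>Conditioned on a badly served cluster \<open>Q\<close>, weighted sampling dominates a constant multiple of the
  uniform distribution on the set \<open>F\<close> of points that are not extremely close to \<open>C\<close>. If \<open>F\<close> were a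
  small part of \<open>Q\<close>, some \<open>c \<in> C\<close> would be so close to \<open>m\<close> that by continuity \<open>Q\<close> would be well served
  already.\<close>

lemma far_part_of_cluster:
  assumes Q: "finite Q" "Q \<subseteq> X" and m: "m \<in> X"
    and C: "finite C" "C \<noteq> {}" "C \<subseteq> X"
  defines "w \<equiv> \<lambda>p. Min ((\<lambda>c. D p c) ` C)"
  assumes bad: "(1 + \<epsilon> / 2) * (\<Sum>p\<in>Q. D p m) < (\<Sum>p\<in>Q. w p)"
  shows "\<exists>F\<subseteq>Q. F \<noteq> {} \<and> (\<Sum>p\<in>Q - F. w p) \<le> \<epsilon> / 4 * (\<Sum>p\<in>Q. D p m) \<and>
    (\<forall>p\<in>F. far_frac * near_frac * (\<Sum>p\<in>Q. w p) \<le> real (card F) * w p)"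
proof -
  define A where "A = (\<Sum>p\<in>Q. D p m)"
  define W where "W = (\<Sum>p\<in>Q. w p)"
  define N where "N = real (card Q)"
  define \<tau> where "\<tau> = near_frac * (W / N)"
  define F where "F = {p\<in>Q. \<tau> \<le> w p}"
  note \<alpha>1 = alpha_ge_1
  have A0: "0 \<le> A" unfolding A_def using Q m by (auto intro!: sum_nonneg D_nonneg)
  have WA: "(1 + \<epsilon> / 2) * A < W" using bad by (simp add: A_def W_def)
  have W0: "0 < W" using WA A0 eps_pos by (smt (verit) mult_nonneg_nonneg divide_nonneg_nonneg)
  have "Q \<noteq> {}" using W0 by (auto simp: W_def)
  then have N0: "0 < N" using Q by (simp add: N_def card_gt_0_iff)
  have \<tau>0: "0 < \<tau>" using near_frac_pos W0 N0 by (simp add: \<tau>_def)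
  have w_le: "w p \<le> D p c" if "c \<in> C" for p c using that C by (simp add: w_def)
  have w_ex: "\<exists>c\<in>C. w p = D p c" for p
  proof -
    have "Min ((\<lambda>c. D p c) ` C) \<in> (\<lambda>c. D p c) ` C" using C by (intro Min_in) auto
    then show ?thesis by (auto simp: w_def)
  qed
  have FQ: "F \<subseteq> Q" "finite F" "finite (Q - F)" using Q by (auto simp: F_def)
  have cards: "real (card F) + real (card (Q - F)) = N"
    using card_Diff_subset[OF FQ(2,1)] card_mono[OF Q(1) FQ(1)] by (simp add: N_def)
  have near: "(\<Sum>p\<in>Q - F. w p) \<le> real (card (Q - F)) * \<tau>"
  proof -
    have "(\<Sum>p\<in>Q - F. w p) \<le> (\<Sum>p\<in>Q - F. \<tau>)" by (rule sum_mono) (auto simp: F_def)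
    then show ?thesis by simp
  qed
  have near_A: "(\<Sum>p\<in>Q - F. D p m) \<le> A" and far_A: "(\<Sum>p\<in>F. D p m) \<le> A"
    unfolding A_def using Q m FQ by (auto intro!: sum_mono2 D_nonneg)
  \<comment> \<open>\<open>near_frac\<close> is tuned to both cases: it is \<epsilon>/8 times the
    \<beta>/(4\<alpha>^2) of the first, and times the 8\<alpha>^2/\<beta> of the second it gives
    \<epsilon>/4.\<close>
  have "(\<Sum>p\<in>Q - F. w p) \<le> \<epsilon> / 4 * A \<and> far_frac * N \<le> real (card F)"
  proof (cases "8 * \<alpha>\<^sup>2 / \<beta> * A < W")
    case True
    \<comment> \<open>Q costs far more than with centre m, so even the chosen centre nearest to m
      satisfies \<open>D m c0\<close> \<ge> W/(2\<alpha>N). A point near some chosen centre is then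
      far from m, and by Markov's inequality at most half of Q can be.\<close>
    obtain c0 where c0: "c0 \<in> C" "w m = D m c0" using w_ex by blast
    have "W \<le> (\<Sum>p\<in>Q. \<alpha> * (D p m + D m c0))"
      unfolding W_def
    proof (rule sum_mono)
      fix p assume "p \<in> Q"
      then have "D p c0 \<le> \<alpha> * (D p m + D m c0)" using Q m c0 C by (intro D_tri) auto
      with w_le[OF c0(1), of p] show "w p \<le> \<alpha> * (D p m + D m c0)" by linarith
    qed
    also have "\<dots> = \<alpha> * (A + N * D m c0)"
      by (simp add: A_def N_def sum.distrib flip: sum_distrib_left)
    finally have W_up: "W \<le> \<alpha> * (A + N * D m c0)" .
    have "2 * \<alpha> \<le> 8 * \<alpha>\<^sup>2 / \<beta>"
    proof -
      have "2 * \<alpha> * \<beta> \<le> 2 * \<alpha> * \<alpha>" using beta_le \<alpha>1 by (intro mult_left_mono) auto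
      also have "\<dots> \<le> 8 * \<alpha>\<^sup>2" by (simp add: power2_eq_square)
      finally show ?thesis using beta_pos by (simp add: field_simps)
    qed
    then have "2 * \<alpha> * A \<le> 8 * \<alpha>\<^sup>2 / \<beta> * A" using A0 by (rule mult_right_mono)
    with True have "2 * \<alpha> * A \<le> W" by linarith
    with W_up have "W \<le> 2 * \<alpha> * (N * D m c0)" by (simp add: algebra_simps)
    then have q_low: "W / N \<le> 2 * \<alpha> * D m c0" using N0 by (simp add: field_simps)
    have far_m: "\<beta> * (W / N) / (4 * \<alpha>\<^sup>2) \<le> D p m" if p: "p \<in> Q - F" for p
    proof -
      obtain c where c: "c \<in> C" "w p = D p c" using w_ex by blast
      have "D m c0 \<le> D m c" using w_le[OF c(1), of m] c0 by simp
      also have "\<dots> \<le> \<alpha> * (D p m / \<beta> + D p c)"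
        using p Q m c C by (intro center_dist_near) auto
      also have "\<dots> \<le> \<alpha> * (D p m / \<beta> + \<tau>)"
        using p c \<alpha>1 by (intro mult_left_mono add_left_mono) (auto simp: F_def)
      finally have "W / N \<le> 2 * \<alpha> * (\<alpha> * (D p m / \<beta> + \<tau>))"
        using q_low \<alpha>1 by (smt (verit) mult_left_mono)
      also have "\<dots> = 2 * \<alpha>\<^sup>2 * (D p m / \<beta>) + 2 * \<alpha>\<^sup>2 * \<tau>" by (simp add: algebra_simps power2_eq_square)
      also have "2 * \<alpha>\<^sup>2 * \<tau> \<le> 2 * \<alpha>\<^sup>2 * (1 / (4 * \<alpha>\<^sup>2) * (W / N))"
        unfolding \<tau>_def using near_frac_le(1) W0 N0
        by (intro mult_left_mono mult_right_mono) auto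
      also have "\<dots> = (W / N) / 2" using \<alpha>1 by simp
      finally have q_up: "W / N / 2 \<le> 2 * \<alpha>\<^sup>2 * (D p m / \<beta>)" by simp
      have aux: "\<beta> * x / (4 * y) \<le> z" if "x / 2 \<le> 2 * y * (z / \<beta>)" "0 < y" for x y z :: real
        using that beta_pos by (simp add: field_simps)
      show ?thesis by (rule aux[OF q_up]) (use \<alpha>1 in simp)
    qed
    have "(\<Sum>p\<in>Q - F. \<beta> * (W / N) / (4 * \<alpha>\<^sup>2)) \<le> (\<Sum>p\<in>Q - F. D p m)"
      by (rule sum_mono) (rule far_m)
    then have cnt: "real (card (Q - F)) * (\<beta> * (W / N) / (4 * \<alpha>\<^sup>2)) \<le> A" using near_A by simp
    have "real (card (Q - F)) * \<tau> = \<epsilon> / 8 * (real (card (Q - F)) * (\<beta> * (W / N) / (4 * \<alpha>\<^sup>2)))"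
      by (simp add: \<tau>_def near_frac_def mult_ac)
    also have "\<dots> \<le> \<epsilon> / 8 * A" using cnt eps_pos by (intro mult_left_mono) auto
    also have "\<dots> \<le> \<epsilon> / 4 * A" using A0 eps_pos by (intro mult_right_mono) auto
    finally have 1: "(\<Sum>p\<in>Q - F. w p) \<le> \<epsilon> / 4 * A" using near by linarith
    have "A \<le> \<beta> * W / (8 * \<alpha>\<^sup>2)" using True \<alpha>1 beta_pos by (simp add: field_simps)
    with cnt have "real (card (Q - F)) * (\<beta> * (W / N) / (4 * \<alpha>\<^sup>2)) \<le> \<beta> * W / (8 * \<alpha>\<^sup>2)" by linarith
    also have "\<dots> = N / 2 * (\<beta> * (W / N) / (4 * \<alpha>\<^sup>2))" using N0 by simp
    finally have "real (card (Q - F)) \<le> N / 2"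
      by (rule mult_right_le_imp_le) (use beta_pos W0 N0 \<alpha>1 in auto)
    then have "N / 2 \<le> real (card F)" using cards by linarith
    moreover have "far_frac * N \<le> 1 / 2 * N" using far_frac_le N0 by (intro mult_right_mono) auto
    ultimately show ?thesis using 1 by simp
  next
    case False
    \<comment> \<open>Here W is within a constant factor of A, so the points below the threshold
      cost at most \<open>near_frac\<close> * W \<le> \<epsilon>/4 * A altogether. What remains is
      to exclude a small F.\<close>
    then have low: "W \<le> 8 * \<alpha>\<^sup>2 / \<beta> * A" by simp
    have A_pos: "0 < A" using low W0 A0 by (cases "A = 0") auto
    have "near_frac * W \<le> near_frac * (8 * \<alpha>\<^sup>2 / \<beta> * A)"
      using low near_frac_pos by (intro mult_left_mono) auto
    also have "\<dots> = \<epsilon> / 4 * A" using \<alpha>1 beta_pos by (simp add: near_frac_def)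
    finally have \<zeta>W: "near_frac * W \<le> \<epsilon> / 4 * A" .
    have "real (card (Q - F)) * \<tau> \<le> N * \<tau>" using cards \<tau>0 by (intro mult_right_mono) auto
    also have "\<dots> = near_frac * W" using N0 by (simp add: \<tau>_def)
    finally have 1: "(\<Sum>p\<in>Q - F. w p) \<le> \<epsilon> / 4 * A" using \<zeta>W near by linarith
    have "far_frac * N \<le> real (card F)"
    proof (rule ccontr)
      assume "\<not> ?thesis"
      then have few: "real (card F) < far_frac * N" by simp
      also have "\<dots> \<le> 1 / 2 * N" using far_frac_le N0 by (intro mult_right_mono) auto
      finally have many: "N / 2 < real (card (Q - F))" using cards by linarith
      \<comment> \<open>More than half of Q lies below the threshold, so one such point is within
        twice the average A/N of m. Its nearest chosen centre c is then close to m, and c alone will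
        serve Q too well for \<open>bad\<close>.\<close>
      have "\<exists>p\<in>Q - F. D p m \<le> 2 * (A / N)"
      proof (rule ccontr)
        assume "\<not> ?thesis"
        then have "(\<Sum>p\<in>Q - F. 2 * (A / N)) \<le> (\<Sum>p\<in>Q - F. D p m)"
          by (intro sum_mono) (meson linear)
        then have "real (card (Q - F)) * (2 * (A / N)) \<le> A" using near_A by simp
        moreover have "N / 2 * (2 * (A / N)) < real (card (Q - F)) * (2 * (A / N))"
          using many A_pos N0 by (intro mult_strict_right_mono) auto
        ultimately show False using N0 by simp
      qed
      then obtain p where "p \<in> Q - F" and p_m: "D p m \<le> 2 * (A / N)" by blast
      then have p: "p \<in> Q" "w p < \<tau>" "D p m \<le> 2 * (A / N)" by (auto simp: F_def)
      obtain c where c: "c \<in> C" "w p = D p c" using w_ex by blast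
      have cX: "c \<in> X" using c C by auto
      have "\<tau> \<le> A / N"
      proof -
        have "\<epsilon> / 4 * A \<le> 1 * A" using eps_le A0 by (intro mult_right_mono) auto
        then have "near_frac * W \<le> A" using \<zeta>W by linarith
        then show ?thesis unfolding \<tau>_def using N0 by (simp add: field_simps)
      qed
      have "D m c \<le> \<alpha> * (D p m / \<beta> + D p c)" using p Q m cX by (intro center_dist_near) auto
      also have "\<dots> \<le> \<alpha> * (2 * (A / N) / \<beta> + A / N)"
        using p c \<open>\<tau> \<le> A / N\<close> \<alpha>1 beta_pos
        by (intro mult_left_mono add_mono divide_right_mono) auto
      also have "\<dots> = near_const * (A / N)" by (simp add: near_const_def algebra_simps)
      finally have mc: "D m c \<le> near_const * (A / N)" .
      \<comment> \<open>R bounds \<open>D x c\<close> for those x whose distance to m is below A/N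
        divided by \<open>close_frac\<close>. For all other x the value \<open>D m c\<close> is
        negligible against \<open>D x m\<close>, so continuity applies.\<close>
      define R where "R = \<alpha> * (1 / close_frac + near_const) * (A / N)"
      have R0: "0 \<le> R"
        unfolding R_def using \<alpha>1 close_frac_pos near_const_ge_1 A0 N0 by (auto intro!: mult_nonneg_nonneg)
      have F_le: "w x \<le> (1 + \<epsilon> / 8) * D x m + R" if x: "x \<in> F" for x
      proof (cases "A / N \<le> close_frac * D x m")
        case True
        have xX: "x \<in> X" using x FQ Q by auto
        have "D m c \<le> near_const * (close_frac * D x m)"
          using mc True near_const_ge_1 by (smt (verit) mult_left_mono)
        also have "\<dots> = (\<epsilon> / (32 * \<alpha>)) ^ (b + 1) * D x m"
          using near_const_ge_1 by (simp add: close_frac_def)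
        finally have "D x c \<le> (1 + \<epsilon> / 8) * D x m"
          using second_argument_perturbation[OF m cX xX \<alpha>1 b_decay eps_pos] eps_le by auto
        then show ?thesis using w_le[OF c(1), of x] R0 by linarith
      next
        case False
        have xX: "x \<in> X" using x FQ Q by auto
        have "D x c \<le> \<alpha> * (D x m + D m c)" by (rule D_tri) fact+
        also have "D x m \<le> 1 / close_frac * (A / N)"
          using False close_frac_pos mult_left_mono[of "close_frac * D x m" "A / N" "1 / close_frac"]
          by simp
        also note mc
        also have "\<alpha> * (1 / close_frac * (A / N) + near_const * (A / N)) = R"
          by (simp add: R_def algebra_simps)
        finally have "D x c \<le> R" using \<alpha>1 by simp
        moreover have "0 \<le> (1 + \<epsilon> / 8) * D x m" using D_nonneg[OF xX m] eps_pos by simp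
        ultimately show ?thesis using w_le[OF c(1), of x] by linarith
      qed
      have "(\<Sum>x\<in>F. w x) \<le> (\<Sum>x\<in>F. (1 + \<epsilon> / 8) * D x m + R)" by (rule sum_mono) (rule F_le)
      also have "\<dots> = (1 + \<epsilon> / 8) * (\<Sum>x\<in>F. D x m) + real (card F) * R"
        by (simp add: sum.distrib sum_distrib_left)
      also have "\<dots> \<le> (1 + \<epsilon> / 8) * A + far_frac * N * R"
        using far_A few R0 eps_pos by (intro add_mono mult_left_mono mult_right_mono) auto
      also have "far_frac * N * R = \<epsilon> / 8 * A"
      proof -
        define u where "u = \<alpha> * (1 / close_frac + near_const)"
        have "u \<noteq> 0"
          using \<alpha>1 close_frac_pos near_const_ge_1
          unfolding u_def by (smt (verit) divide_pos_pos mult_pos_pos)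
        moreover have "far_frac = \<epsilon> / (8 * u)" "R = u * (A / N)"
          by (simp_all add: far_frac_def R_def u_def mult.assoc)
        ultimately show ?thesis using N0 by simp
      qed
      finally have "(\<Sum>x\<in>F. w x) \<le> (1 + \<epsilon> / 8) * A + \<epsilon> / 8 * A" .
      moreover have "W = (\<Sum>x\<in>F. w x) + (\<Sum>x\<in>Q - F. w x)"
        unfolding W_def using sum.subset_diff[OF FQ(1) Q(1), of w] by simp
      ultimately have "W \<le> (1 + \<epsilon> / 2) * A" using 1 by (simp add: algebra_simps)
      then show False using WA by simp
    qed
    with 1 show ?thesis by simp
  qed
  then have 1: "(\<Sum>p\<in>Q - F. w p) \<le> \<epsilon> / 4 * A" and 2: "far_frac * N \<le> real (card F)" by auto
  have "F \<noteq> {}" using 2 far_frac_pos N0 by (auto simp: mult_le_0_iff)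
  moreover have "far_frac * near_frac * W \<le> real (card F) * w p" if "p \<in> F" for p
  proof -
    have "far_frac * near_frac * W = (far_frac * N) * \<tau>" using N0 by (simp add: \<tau>_def)
    also have "\<dots> \<le> real (card F) * w p"
      using 2 that \<tau>0 by (intro mult_mono) (auto simp: F_def)
    finally show ?thesis .
  qed
  ultimately show ?thesis using FQ(1) 1 unfolding A_def W_def by blast
qed

end

section \<open>Weighted sampling and amplification\<close>

lemma prob_bind_ge:
  assumes "a \<le> measure_pmf.prob \<mu> A"
    and "\<And>x. x \<in> set_pmf \<mu> \<Longrightarrow> x \<in> A \<Longrightarrow> b \<le> measure_pmf.prob (\<nu> x) B"
    and "0 \<le> b"
  shows "a * b \<le> measure_pmf.prob (bind_pmf \<mu> \<nu>) B"
proof -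
  have "ennreal (measure_pmf.prob \<mu> A * b) = (\<integral>\<^sup>+x. ennreal b * indicator A x \<partial>\<mu>)"
    using assms(3) by (simp add: nn_integral_cmult_indicator measure_pmf.emeasure_eq_measure
        ennreal_mult' mult.commute)
  also have "\<dots> \<le> (\<integral>\<^sup>+x. emeasure (\<nu> x) B \<partial>\<mu>)"
    using assms(2)
    by (intro nn_integral_mono_AE AE_pmfI)
      (auto simp: indicator_def measure_pmf.emeasure_eq_measure intro!: ennreal_leI)
  also have "\<dots> = ennreal (measure_pmf.prob (bind_pmf \<mu> \<nu>) B)"
    by (simp flip: measure_pmf.emeasure_eq_measure)
  finally have "measure_pmf.prob \<mu> A * b \<le> measure_pmf.prob (bind_pmf \<mu> \<nu>) B"
    by (subst (asm) ennreal_le_iff) auto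
  moreover have "a * b \<le> measure_pmf.prob \<mu> A * b" using assms by (intro mult_right_mono)
  ultimately show ?thesis by linarith
qed

lemma prob_mono_on_support:
  assumes "\<And>x. x \<in> set_pmf \<mu> \<Longrightarrow> x \<in> A \<Longrightarrow> x \<in> B"
  shows "measure_pmf.prob \<mu> A \<le> measure_pmf.prob \<mu> B"
  using assms by (intro measure_pmf.finite_measure_mono_AE AE_pmfI) auto

text \<open>Condition on the first draw: each draw costs one factor r. This transfers guarantees for
  uniform samples to weighted ones, and it is why M enters the exponent.\<close>

lemma replicate_pmf_dominated:
  assumes r: "0 \<le> r" and dom: "\<And>x. r * pmf \<mu> x \<le> pmf \<nu> x"
  shows "r ^ n * measure_pmf.prob (replicate_pmf n \<mu>) E \<le> measure_pmf.prob (replicate_pmf n \<nu>) E"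
proof (induction n arbitrary: E)
  case (Suc n)
  have step: "emeasure (replicate_pmf (Suc n) p) E
      = (\<integral>\<^sup>+x. ennreal (pmf p x) * ennreal (measure_pmf.prob (replicate_pmf n p) {xs. x # xs \<in> E})
          \<partial>count_space UNIV)" for p :: "'a pmf"
  proof -
    have *: "do {xs \<leftarrow> replicate_pmf n p; return_pmf (x # xs)} = map_pmf ((#) x) (replicate_pmf n p)" for x
      by (simp add: map_pmf_def)
    have "emeasure (replicate_pmf (Suc n) p) E
       = (\<integral>\<^sup>+x. emeasure (replicate_pmf n p) {xs. x # xs \<in> E} \<partial>p)"
      by (simp add: * vimage_def)
    then show ?thesis
      by (simp add: nn_integral_measure_pmf measure_pmf.emeasure_eq_measure)
  qed
  have "ennreal (r ^ Suc n * measure_pmf.prob (replicate_pmf (Suc n) \<mu>) E)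
      = ennreal (r ^ Suc n) * emeasure (replicate_pmf (Suc n) \<mu>) E"
    using r by (simp add: ennreal_mult' measure_pmf.emeasure_eq_measure del: replicate_pmf.simps power_Suc)
  also have "\<dots> = (\<integral>\<^sup>+x. ennreal (r ^ Suc n) * (ennreal (pmf \<mu> x) *
      ennreal (measure_pmf.prob (replicate_pmf n \<mu>) {xs. x # xs \<in> E})) \<partial>count_space UNIV)"
    unfolding step by (rule nn_integral_cmult[symmetric]) simp
  also have "\<dots> \<le> emeasure (replicate_pmf (Suc n) \<nu>) E"
    unfolding step
  proof (rule nn_integral_mono)
    fix x
    have "(r * pmf \<mu> x) * (r ^ n * measure_pmf.prob (replicate_pmf n \<mu>) {xs. x # xs \<in> E})
       \<le> pmf \<nu> x * measure_pmf.prob (replicate_pmf n \<nu>) {xs. x # xs \<in> E}"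
      using r by (intro mult_mono dom Suc.IH) auto
    then show "ennreal (r ^ Suc n) * (ennreal (pmf \<mu> x) *
        ennreal (measure_pmf.prob (replicate_pmf n \<mu>) {xs. x # xs \<in> E}))
      \<le> ennreal (pmf \<nu> x) * ennreal (measure_pmf.prob (replicate_pmf n \<nu>) {xs. x # xs \<in> E})"
      using r by (simp add: mult_ac flip: ennreal_mult')
  qed
  finally show ?case
    unfolding measure_pmf.emeasure_eq_measure by (subst (asm) ennreal_le_iff) auto
qed simp

text \<open>Independent draws may be exchanged. The machine puts every new draw in front of the
  earlier ones, so the head is the last draw.\<close>

lemma replicate_pmf_Suc_snoc:
  "replicate_pmf (Suc n) p = bind_pmf (replicate_pmf n p) (\<lambda>xs. map_pmf (\<lambda>x. x # xs) p)"
  by (simp add: map_pmf_def) (rule bind_commute_pmf)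

lemma replicate_map_pmf: "replicate_pmf n (map_pmf f p) = map_pmf (map f) (replicate_pmf n p)"
  by (induction n) (simp_all add: map_pmf_def bind_assoc_pmf bind_return_pmf)

text \<open>Weighted reservoir sampling: one pass with biased coins and a running sum, without
  knowing the total weight beforehand. While all weights seen are zero, the bias is 0/0 = 0 and the
  start value 0 is kept.\<close>

primrec reservoir :: "(nat \<Rightarrow> real) \<Rightarrow> nat \<Rightarrow> nat pmf" where
  "reservoir w 0 = return_pmf 0"
| "reservoir w (Suc i) = bind_pmf (reservoir w i)
     (\<lambda>x. map_pmf (\<lambda>h. if h then i else x) (bernoulli_pmf (w i / (\<Sum>j<Suc i. w j))))"

text \<open>The start value 0 is a valid index, so the claim covers vanishing weights too; centres
  must lie in X on every outcome.\<close>

lemma set_reservoir: "0 < n \<Longrightarrow> set_pmf (reservoir w n) \<subseteq> {..<n}"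
proof -
  have "set_pmf (reservoir w n) \<subseteq> {..n - 1}"
  proof (induction n)
    case (Suc i)
    show ?case
    proof
      fix y assume "y \<in> set_pmf (reservoir w (Suc i))"
      then have "y = i \<or> y \<in> set_pmf (reservoir w i)" by (auto split: if_splits)
      then show "y \<in> {..Suc i - 1}" using Suc by auto
    qed
  qed simp
  then show "0 < n \<Longrightarrow> ?thesis" by force
qed

lemma pmf_reservoir:
  assumes w: "\<And>i. i < n \<Longrightarrow> 0 \<le> w i" and p: "p < n" and pos: "0 < (\<Sum>j<n. w j)"
  shows "pmf (reservoir w n) p = w p / (\<Sum>j<n. w j)"
  using w p pos
proof (induction n)
  case (Suc n)
  define S where "S = (\<Sum>j<n. w j)"
  have S0: "0 \<le> S" unfolding S_def using Suc.prems(1) by (intro sum_nonneg) auto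
  have wn: "0 \<le> w n" using Suc.prems(1) by auto
  have SS: "(\<Sum>j<Suc n. w j) = S + w n" by (simp add: S_def)
  define q where "q = w n / (S + w n)"
  have q: "0 \<le> q" "q \<le> 1" using S0 wn by (auto simp: q_def divide_le_eq_1)
  have *: "pmf (map_pmf (\<lambda>h. if h then n else x) (bernoulli_pmf q)) p
      = q * indicator {p} n + (1 - q) * indicator {p} x" for x
    using q by (simp add: map_pmf_def pmf_bind indicator_def)
  have "pmf (reservoir w (Suc n)) p = (\<integral>x. q * indicator {p} n + (1 - q) * indicator {p} x \<partial>reservoir w n)"
    unfolding reservoir.simps SS q_def[symmetric] pmf_bind * ..
  also have "\<dots> = q * indicator {p} n + (1 - q) * pmf (reservoir w n) p"
  proof -
    have "integrable (reservoir w n) (indicat_real {p})"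
      by (rule measure_pmf.integrable_const_bound[where B = 1]) (auto simp: indicator_def)
    then show ?thesis
      by (subst Bochner_Integration.integral_add) (auto simp: measure_pmf_single)
  qed
  finally have rec: "pmf (reservoir w (Suc n)) p = q * indicator {p} n + (1 - q) * pmf (reservoir w n) p" .
  have pos': "0 < S + w n" using Suc.prems(3) unfolding SS .
  show ?case
  proof (cases "p = n")
    case True
    have "(1 - q) * pmf (reservoir w n) p = 0"
    \<comment> \<open>Only for n = 0 can the start value 0 coincide with the new index, and then the
      coin has bias 1.\<close>
    proof (cases "n = 0")
      case True then show ?thesis using pos' by (simp add: q_def S_def)
    next
      case False
      then have "p \<notin> set_pmf (reservoir w n)" using set_reservoir[of n w] \<open>p = n\<close> by auto
      then show ?thesis by (simp add: set_pmf_iff)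
    qed
    then show ?thesis unfolding rec SS using True by (simp add: q_def)
  next
    case False
    then have pn: "p < n" using Suc.prems(2) by simp
    show ?thesis
    proof (cases "S = 0")
      case True
      \<comment> \<open>The induction hypothesis says nothing if all earlier weights vanish, but
        then q = 1 and the earlier content is discarded.\<close>
      have "w p \<le> S" unfolding S_def using Suc.prems(1) pn by (intro member_le_sum) auto
      then have "w p = 0" using True Suc.prems(1)[of p] pn by simp
      then show ?thesis unfolding rec SS using True False pos' by (simp add: q_def)
    next
      case False
      then have "0 < S" using S0 by simp
      then have "pmf (reservoir w n) p = w p / S"
        using Suc.IH Suc.prems(1) pn unfolding S_def by auto
      moreover have "1 - q = S / (S + w n)" using pos' by (simp add: q_def field_simps)
      ultimately show ?thesis unfolding rec SS using \<open>p \<noteq> n\<close> \<open>0 < S\<close> by simp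
    qed
  qed
qed simp

section \<open>Best of independent trials\<close>

definition improve :: "('a \<Rightarrow> real) \<Rightarrow> 'a option \<Rightarrow> 'a \<Rightarrow> 'a option" where
  "improve cost b x = (case b of None \<Rightarrow> Some x | Some y \<Rightarrow> if cost x < cost y then Some x else b)"

primrec best_of :: "('a \<Rightarrow> real) \<Rightarrow> 'a pmf \<Rightarrow> nat \<Rightarrow> 'a option pmf" where
  "best_of cost p 0 = return_pmf None"
| "best_of cost p (Suc n) = bind_pmf (best_of cost p n) (\<lambda>b. map_pmf (improve cost b) p)"

lemma set_best_of: "b \<in> set_pmf (best_of cost p n) \<Longrightarrow> b = None \<or> (\<exists>x\<in>set_pmf p. b = Some x)"
  by (induction n arbitrary: b) (fastforce simp: improve_def split: option.splits if_splits)+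

text \<open>\<open>improve\<close> never loses an outcome that meets the threshold, so the best one
  fails only if all trials fail. Having no outcome yet counts as failure, which starts the induction
  at probability 1.\<close>

lemma prob_best_of_fails:
  fixes cost :: "'a \<Rightarrow> real"
  assumes "measure_pmf.prob p {x. \<not> cost x \<le> t} \<le> r"
  shows "measure_pmf.prob (best_of cost p n) {b. \<forall>x. b = Some x \<longrightarrow> \<not> cost x \<le> t} \<le> r ^ n"
    (is "measure_pmf.prob _ ?B \<le> _")
proof (induction n)
  case (Suc n)
  have r0: "0 \<le> r" using assms measure_nonneg order_trans by blast
  have *: "emeasure p (improve cost b -` ?B) \<le> ennreal r * indicator ?B b" for b
  proof (cases "b \<in> ?B")
    case True
    have "improve cost b -` ?B \<subseteq> {x. \<not> cost x \<le> t}"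
      by (auto simp: improve_def split: option.splits if_splits)
    then have "measure_pmf.prob p (improve cost b -` ?B) \<le> measure_pmf.prob p {x. \<not> cost x \<le> t}"
      by (intro measure_pmf.finite_measure_mono) auto
    then have "measure_pmf.prob p (improve cost b -` ?B) \<le> r" using assms by linarith
    then show ?thesis using True by (simp add: measure_pmf.emeasure_eq_measure ennreal_leI)
  next
    case False
    then have "improve cost b -` ?B = {}"
      by (fastforce simp: improve_def split: option.splits if_splits)
    then show ?thesis by (simp only: emeasure_empty) simp
  qed
  have "ennreal (measure_pmf.prob (best_of cost p (Suc n)) ?B)
      = (\<integral>\<^sup>+b. emeasure p (improve cost b -` ?B) \<partial>best_of cost p n)"
    by (simp flip: measure_pmf.emeasure_eq_measure)
  also have "\<dots> \<le> (\<integral>\<^sup>+b. ennreal r * indicator ?B b \<partial>best_of cost p n)"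
    by (intro nn_integral_mono *)
  also have "\<dots> = ennreal (r * measure_pmf.prob (best_of cost p n) ?B)"
    using r0 by (simp add: nn_integral_cmult_indicator measure_pmf.emeasure_eq_measure ennreal_mult')
  finally have "measure_pmf.prob (best_of cost p (Suc n)) ?B \<le> r * measure_pmf.prob (best_of cost p n) ?B"
    using r0 by (subst (asm) ennreal_le_iff) auto
  also have "\<dots> \<le> r * r ^ n" using Suc r0 by (intro mult_left_mono)
  finally show ?case by simp
qed simp

text \<open>The value 1 in the absence of centres makes the first round a uniform draw by the same
  code as the later rounds.\<close>

definition weight :: "dissim \<Rightarrow> point list \<Rightarrow> point \<Rightarrow> real" where
  "weight D cs p = (if cs = [] then 1 else Min ((\<lambda>c. D p c) ` set cs))"

definition extend :: "nat \<Rightarrow> point list \<Rightarrow> point list \<Rightarrow> nat list \<Rightarrow> point list" where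
  "extend d ps cs is = cs @ [centroid d (mset (map ((!) ps) is))]"

definition draw :: "dissim \<Rightarrow> point list \<Rightarrow> point list \<Rightarrow> nat pmf" where
  "draw D ps cs = reservoir (\<lambda>i. weight D cs (ps ! i)) (length ps)"

primrec trial :: "nat \<Rightarrow> dissim \<Rightarrow> point list \<Rightarrow> nat \<Rightarrow> nat \<Rightarrow> point list pmf" where
  "trial d D ps M 0 = return_pmf []"
| "trial d D ps M (Suc j) = bind_pmf (trial d D ps M j)
     (\<lambda>cs. map_pmf (extend d ps cs) (replicate_pmf M (draw D ps cs)))"

lemma weight_append:
  "weight D (cs @ [c]) p = (if cs = [] then D p c else min (weight D cs p) (D p c))"
  by (auto simp: weight_def min.commute)

lemma weight_le: "c \<in> set cs \<Longrightarrow> weight D cs p \<le> D p c"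
  by (auto simp: weight_def)

lemma sum_weight: "cs \<noteq> [] \<Longrightarrow> (\<Sum>p\<in>P. weight D cs p) = med_cost D P (set cs)"
  by (simp add: weight_def med_cost_def)

section \<open>Success probability of the sampling procedure\<close>

context dissim_space
begin

lemma Min_attained: "finite C \<Longrightarrow> C \<noteq> {} \<Longrightarrow> \<exists>c\<in>C. D p c = Min ((\<lambda>c. D p c) ` C)"
proof -
  assume "finite C" "C \<noteq> {}"
  then have "Min ((\<lambda>c. D p c) ` C) \<in> (\<lambda>c. D p c) ` C" by (intro Min_in) auto
  then obtain c where "Min ((\<lambda>c. D p c) ` C) = D p c" "c \<in> C" by (rule imageE)
  then show ?thesis by (intro bexI[of _ c]) simp
qed

text \<open>Moving every median to the centroid of its cluster does not increase the cost, so only the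
  finitely many centroids of subsets of \<open>P\<close> matter.\<close>

lemma opt_cost_attained:
  assumes P: "finite P" "P \<noteq> {}" "P \<subseteq> X" and k: "1 \<le> k"
  shows "\<exists>C\<in>medians X k. med_cost D P C = opt_cost D X k P"
proof -
  define cen where "cen F = centroid d (mset_set F)" for F
  define CC where "CC = {C \<in> medians X k. C \<subseteq> cen ` (Pow P - {{}})}"
  have fin: "finite CC" unfolding CC_def
    by (rule finite_subset[of _ "Pow (cen ` (Pow P - {{}}))"]) (use P in auto)
  have cen_X: "cen F \<in> X" if "F \<subseteq> P" "F \<noteq> {}" for F
    unfolding cen_def using that P by (intro centroid_in) (auto intro: finite_subset)
  have cen_le: "(\<Sum>p\<in>F. D p (cen F)) \<le> (\<Sum>p\<in>F. D p c)" if "F \<subseteq> P" "F \<noteq> {}" "c \<in> X" for F c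
  proof -
    have F: "F \<subseteq> X" "finite F" using that P by (auto intro: finite_subset)
    show ?thesis
      using opt_cost_1_centroid[OF F that(2)] opt_cost_1_le[OF F(1) that(3)] by (simp add: cen_def)
  qed
  have improve: "\<exists>C'\<in>CC. med_cost D P C' \<le> med_cost D P C" if C: "C \<in> medians X k" for C
  proof -
    have C': "finite C" "C \<noteq> {}" "C \<subseteq> X" "card C \<le> k" using C by (auto simp: medians_def)
    obtain a where a: "\<And>p. a p \<in> C" "\<And>p. D p (a p) = Min ((\<lambda>c. D p c) ` C)"
      using Min_attained[OF C'(1,2)] by metis
    have a_X: "a p \<in> X" for p using a(1) C'(3) by blast
    define Q where "Q c = {p\<in>P. a p = c}" for c
    define E where "E = (\<lambda>c. cen (Q c)) ` (a ` P)"
    have Q: "Q c \<subseteq> P" "Q c \<noteq> {}" if "c \<in> a ` P" for c using that by (auto simp: Q_def)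
    have "card E \<le> card (a ` P)" unfolding E_def using P by (intro card_image_le) auto
    also have "\<dots> \<le> card C" using a C' by (intro card_mono) auto
    finally have "card E \<le> k" using C' by simp
    moreover have "E \<subseteq> X"
      unfolding E_def by (rule image_subsetI) (intro cen_X Q)
    ultimately have "E \<in> CC" unfolding CC_def medians_def E_def using P Q by auto
    moreover have "med_cost D P E \<le> (\<Sum>p\<in>P. D p (cen (Q (a p))))"
      unfolding med_cost_def using P by (intro sum_mono Min_le) (auto simp: E_def)
    moreover have "\<dots> = (\<Sum>c\<in>a ` P. \<Sum>p\<in>Q c. D p (cen (Q c)))"
    proof -
      have "(\<Sum>c\<in>a ` P. \<Sum>p\<in>{p\<in>P. a p = c}. D p (cen (Q (a p)))) = (\<Sum>p\<in>P. D p (cen (Q (a p))))"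
        using P by (intro sum.group) auto
      moreover have "(\<Sum>p\<in>{p\<in>P. a p = c}. D p (cen (Q (a p)))) = (\<Sum>p\<in>Q c. D p (cen (Q c)))" for c
        by (rule sum.cong) (auto simp: Q_def)
      ultimately show ?thesis by simp
    qed
    moreover have "\<dots> \<le> (\<Sum>c\<in>a ` P. \<Sum>p\<in>Q c. D p c)"
      by (rule sum_mono, rule cen_le) (use Q in \<open>auto intro: a_X\<close>)
    moreover have "\<dots> = (\<Sum>p\<in>P. D p (a p))"
    proof -
      have "(\<Sum>c\<in>a ` P. \<Sum>p\<in>{p\<in>P. a p = c}. D p (a p)) = (\<Sum>p\<in>P. D p (a p))"
        using P by (intro sum.group) auto
      moreover have "(\<Sum>p\<in>{p\<in>P. a p = c}. D p (a p)) = (\<Sum>p\<in>Q c. D p c)" for c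
        by (rule sum.cong) (auto simp: Q_def)
      ultimately show ?thesis by simp
    qed
    ultimately show ?thesis by (intro bexI[of _ E]) (simp_all add: med_cost_def a(2))
  qed
  obtain p where "p \<in> X" using P by auto
  then have ne: "{p} \<in> medians X k" using k by (auto simp: medians_def)
  then have "CC \<noteq> {}" using improve by blast
  then obtain C where C: "C \<in> CC" "\<And>C'. C' \<in> CC \<Longrightarrow> med_cost D P C \<le> med_cost D P C'"
    using ex_min_if_finite[of "med_cost D P ` CC"] fin by (force simp: not_less)
  have "med_cost D P C \<le> opt_cost D X k P"
    unfolding opt_cost_def using ne improve C(2) by (intro cINF_greatest) (auto intro: order_trans)
  moreover have "C \<in> medians X k" using C by (simp add: CC_def)
  ultimately show ?thesis using opt_cost_le[OF P(3)] by (auto intro!: antisym)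
qed

end

locale sampling_instance = dissim_space_params +
  fixes k M :: nat and \<gamma> :: real and ps :: "point list"
  assumes k_pos: "1 \<le> k"
    and distinct: "distinct ps" and nonempty: "ps \<noteq> []" and ps_X: "set ps \<subseteq> X"
    and gamma: "0 \<le> \<gamma>" "\<gamma> \<le> \<epsilon> / 4"
    and sample_in: "\<And>F S. F \<subseteq> X \<Longrightarrow> finite F \<Longrightarrow> F \<noteq> {} \<Longrightarrow>
      S \<in> set_pmf (replicate_pmf M (pmf_of_set F)) \<Longrightarrow> centroid d (mset S) \<in> X"
    and sample_prob: "\<And>F. F \<subseteq> X \<Longrightarrow> finite F \<Longrightarrow> F \<noteq> {} \<Longrightarrow>
      8 / 10 \<le> measure_pmf.prob (replicate_pmf M (pmf_of_set F))
        {S. (\<Sum>p\<in>F. D p (centroid d (mset S))) \<le> (1 + \<gamma>) * opt_cost D X 1 F}"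
begin

abbreviation "P \<equiv> set ps"

text \<open>The share \<epsilon>/(4k) of the target cluster in the total weight, times the share
  \<open>far_frac * near_frac\<close> from \<open>far_part_of_cluster\<close>.\<close>

definition stage_prob :: real where
  "stage_prob = far_frac * near_frac * \<epsilon> / (4 * real k)"

lemma stage_prob_pos: "0 < stage_prob"
  using far_frac_pos near_frac_pos eps_pos k_pos by (simp add: stage_prob_def)

lemma stage_prob_le: "stage_prob \<le> 1 / real k"
proof -
  have "far_frac * near_frac \<le> 1 * 1"
    using far_frac_le near_frac_le far_frac_pos near_frac_pos by (intro mult_mono) auto
  then have "far_frac * near_frac * \<epsilon> \<le> 1 * 4"
    using eps_le eps_pos by (intro mult_mono) auto
  then show ?thesis using k_pos by (simp add: stage_prob_def divide_simps)
qed

lemma set_draw: "set_pmf (draw D ps cs) \<subseteq> {..<length ps}"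
  unfolding draw_def using nonempty by (intro set_reservoir) auto

text \<open>The sampling hypothesis speaks of uniform samples; a weighted sample from P is a
  possible outcome of a uniform one, so its centroid lies in X as well.\<close>

lemma extend_in:
  assumes "set cs \<subseteq> X" "is \<in> set_pmf (replicate_pmf M (draw D ps cs))"
  shows "set (extend d ps cs is) \<subseteq> X"
proof -
  have "map ((!) ps) is \<in> set_pmf (replicate_pmf M (pmf_of_set P))"
    using assms(2) nonempty
    by (auto simp: set_replicate_pmf intro!: nth_mem dest!: subsetD[OF set_draw])
  then have "centroid d (mset (map ((!) ps) is)) \<in> X"
    using sample_in[of P] ps_X nonempty by (auto simp del: mset_map)
  then show ?thesis using assms(1) by (auto simp: extend_def simp del: mset_map)
qed

lemma weight_nonneg: "set cs \<subseteq> X \<Longrightarrow> p \<in> X \<Longrightarrow> 0 \<le> weight D cs p"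
  by (auto simp: weight_def intro!: D_nonneg)

lemma sum_ps: "(\<Sum>i<length ps. f (ps ! i)) = (\<Sum>p\<in>P. f p)"
  using distinct by (simp add: sum.distinct_set_conv_list sum_list_sum_nth atLeast0LessThan)

lemma draw_ge:
  assumes "set cs \<subseteq> X" "p \<in> P" "0 < (\<Sum>p\<in>P. weight D cs p)"
  shows "weight D cs p / (\<Sum>p\<in>P. weight D cs p) \<le> pmf (map_pmf ((!) ps) (draw D ps cs)) p"
proof -
  obtain i where i: "i < length ps" "p = ps ! i" using assms(2) by (metis in_set_conv_nth)
  have "weight D cs p / (\<Sum>p\<in>P. weight D cs p) = pmf (draw D ps cs) i"
    unfolding draw_def
    by (subst pmf_reservoir) (use assms i ps_X sum_ps[of "weight D cs"] in \<open>auto intro!: weight_nonneg\<close>)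
  also have "\<dots> = measure_pmf.prob (draw D ps cs) {i}" by (simp add: measure_pmf_single)
  also have "\<dots> \<le> pmf (map_pmf ((!) ps) (draw D ps cs)) p"
    unfolding pmf_map by (intro measure_pmf.finite_measure_mono) (auto simp: i)
  finally show ?thesis .
qed

text \<open>A single weighted draw hits each point of F with at least \<open>stage_prob\<close>
  times its uniform probability on F, so \<open>replicate_pmf_dominated\<close> applies to the
  success event of the sampling property.\<close>

lemma sample_prob_draw:
  assumes cs: "set cs \<subseteq> X" and F: "F \<subseteq> P" "F \<noteq> {}" and W: "0 < (\<Sum>p\<in>P. weight D cs p)"
    and far: "\<And>p. p \<in> F \<Longrightarrow> stage_prob * (\<Sum>p\<in>P. weight D cs p) \<le> real (card F) * weight D cs p"
  shows "stage_prob ^ M * (8 / 10) \<le> measure_pmf.prob (replicate_pmf M (draw D ps cs))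
    {is. (\<Sum>p\<in>F. D p (centroid d (mset (map ((!) ps) is)))) \<le> (1 + \<gamma>) * opt_cost D X 1 F}"
proof -
  let ?E = "{S. (\<Sum>p\<in>F. D p (centroid d (mset S))) \<le> (1 + \<gamma>) * opt_cost D X 1 F}"
  let ?W = "\<Sum>p\<in>P. weight D cs p"
  have fin: "finite F" using F by (auto intro: finite_subset)
  have cF: "0 < card F" using F fin by (simp add: card_gt_0_iff)
  have "stage_prob * pmf (pmf_of_set F) p \<le> pmf (map_pmf ((!) ps) (draw D ps cs)) p" for p
  proof (cases "p \<in> F")
    case True
    have "stage_prob * pmf (pmf_of_set F) p = stage_prob / real (card F)"
      using F fin True by simp
    also have "\<dots> \<le> weight D cs p / ?W" using far[OF True] W cF by (simp add: field_simps)
    also have "\<dots> \<le> pmf (map_pmf ((!) ps) (draw D ps cs)) p" using draw_ge cs True F W by auto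
    finally show ?thesis .
  qed (use F fin in auto)
  from replicate_pmf_dominated[OF less_imp_le[OF stage_prob_pos] this]
  have "stage_prob ^ M * measure_pmf.prob (replicate_pmf M (pmf_of_set F)) ?E
    \<le> measure_pmf.prob (replicate_pmf M (map_pmf ((!) ps) (draw D ps cs))) ?E" .
  moreover have "stage_prob ^ M * (8 / 10)
      \<le> stage_prob ^ M * measure_pmf.prob (replicate_pmf M (pmf_of_set F)) ?E"
    using sample_prob[of F] F fin ps_X stage_prob_pos by (intro mult_left_mono) auto
  ultimately show ?thesis by (simp add: replicate_map_pmf vimage_def)
qed

end

section \<open>Progress of a trial against a reference solution\<close>

locale reference_solution = sampling_instance +
  fixes C :: "point set" and a :: "point \<Rightarrow> point"
  assumes C: "C \<in> medians X k"
    and a_in: "\<And>p. p \<in> set ps \<Longrightarrow> a p \<in> C"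
    and a_min: "\<And>p. p \<in> set ps \<Longrightarrow> D p (a p) = Min ((\<lambda>c. D p c) ` C)"
begin

definition "opt = med_cost D P C"
definition "cluster c = {p\<in>P. a p = c}"
definition "cluster_opt c = (\<Sum>p\<in>cluster c. D p c)"
definition "cluster_cost cs c = (\<Sum>p\<in>cluster c. weight D cs p)"

text \<open>The additive slack makes every uncovered cluster expensive in proportion to the optimum.
  Without centres \<open>weight\<close> is not a cost, hence the nonemptiness condition.\<close>

definition covered :: "point list \<Rightarrow> point \<Rightarrow> bool" where
  "covered cs c \<longleftrightarrow> cs \<noteq> [] \<and>
     cluster_cost cs c \<le> (1 + \<epsilon> / 2) * cluster_opt c + \<epsilon> / (2 * real k) * opt"

definition uncovered :: "point list \<Rightarrow> point set" where
  "uncovered cs = {c\<in>C. \<not> covered cs c}"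

lemma C_facts: "finite C" "C \<noteq> {}" "C \<subseteq> X" "card C \<le> k"
  using C by (auto simp: medians_def)

lemma finite_uncovered: "finite (uncovered cs)"
  using C_facts by (simp add: uncovered_def)

lemma cluster_sub: "cluster c \<subseteq> P" "cluster c \<subseteq> X" "finite (cluster c)"
  using ps_X by (auto simp: cluster_def)

lemma cluster_X: "p \<in> cluster c \<Longrightarrow> p \<in> X"
  using ps_X by (auto simp: cluster_def)

lemma cluster_sum: "(\<Sum>c\<in>C. \<Sum>p\<in>cluster c. f p) = (\<Sum>p\<in>P. f p)"
  unfolding cluster_def using C_facts a_in by (intro sum.group) auto

lemma cluster_opt_sum: "(\<Sum>c\<in>C. cluster_opt c) = opt"
proof -
  have "(\<Sum>c\<in>C. cluster_opt c) = (\<Sum>c\<in>C. \<Sum>p\<in>cluster c. D p (a p))"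
    unfolding cluster_opt_def by (intro sum.cong) (auto simp: cluster_def)
  also have "\<dots> = opt" unfolding cluster_sum opt_def med_cost_def using a_min by (intro sum.cong) auto
  finally show ?thesis .
qed

lemma cluster_opt_nonneg: "c \<in> C \<Longrightarrow> 0 \<le> cluster_opt c"
  unfolding cluster_opt_def using C_facts by (auto intro!: sum_nonneg D_nonneg dest: cluster_X)

lemma opt_nonneg: "0 \<le> opt"
  using cluster_opt_nonneg unfolding cluster_opt_sum[symmetric] by (auto intro: sum_nonneg)

text \<open>The slacks \<epsilon>/2 and k * \<epsilon>/(2k) add up to \<epsilon>. Subsets are
  allowed because the bound also serves to estimate the covered part while other clusters are still
  uncovered.\<close>

lemma covered_cost:
  assumes "S \<subseteq> C" "\<And>c. c \<in> S \<Longrightarrow> covered cs c"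
  shows "(\<Sum>c\<in>S. cluster_cost cs c) \<le> (1 + \<epsilon>) * opt"
proof -
  have fS: "finite S" using assms C_facts by (auto intro: finite_subset)
  have "(\<Sum>c\<in>S. cluster_cost cs c)
      \<le> (\<Sum>c\<in>S. (1 + \<epsilon> / 2) * cluster_opt c + \<epsilon> / (2 * real k) * opt)"
    using assms by (intro sum_mono) (auto simp: covered_def)
  also have "\<dots> = (1 + \<epsilon> / 2) * (\<Sum>c\<in>S. cluster_opt c) + real (card S) * (\<epsilon> / (2 * real k) * opt)"
    by (simp add: sum.distrib sum_distrib_left)
  also have "\<dots> \<le> (1 + \<epsilon> / 2) * opt + real k * (\<epsilon> / (2 * real k) * opt)"
  proof (intro add_mono mult_left_mono mult_right_mono)
    show "(\<Sum>c\<in>S. cluster_opt c) \<le> opt"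
      unfolding cluster_opt_sum[symmetric] using assms C_facts cluster_opt_nonneg
      by (intro sum_mono2) auto
    have "card S \<le> card C" using assms C_facts by (intro card_mono)
    then show "real (card S) \<le> real k" using C_facts by simp
  qed (use eps_pos opt_nonneg in auto)
  also have "\<dots> = (1 + \<epsilon>) * opt" using k_pos by (simp add: field_simps)
  finally show ?thesis .
qed

lemma cost_if_no_uncovered:
  assumes "uncovered cs = {}" shows "cs \<noteq> []" "med_cost D P (set cs) \<le> (1 + \<epsilon>) * opt"
proof -
  have all: "\<And>c. c \<in> C \<Longrightarrow> covered cs c" using assms by (auto simp: uncovered_def)
  then show ne: "cs \<noteq> []" using C_facts by (auto simp: covered_def)
  have "(\<Sum>c\<in>C. cluster_cost cs c) \<le> (1 + \<epsilon>) * opt" using all by (intro covered_cost) auto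
  also have "(\<Sum>c\<in>C. cluster_cost cs c) = (\<Sum>p\<in>P. weight D cs p)"
    unfolding cluster_cost_def cluster_sum ..
  finally show "med_cost D P (set cs) \<le> (1 + \<epsilon>) * opt" by (simp add: sum_weight[OF ne])
qed

lemma covered_append:
  assumes "covered cs c" shows "covered (cs @ [x]) c"
proof -
  have "cluster_cost (cs @ [x]) c \<le> cluster_cost cs c"
    unfolding cluster_cost_def using assms
    by (intro sum_mono) (auto simp: weight_append covered_def)
  then show ?thesis using assms by (auto simp: covered_def)
qed

text \<open>On F the new centre costs at most 1 + \<gamma> \<le> 1 + \<epsilon>/4 times what c costs
  there; the rest costs at most \<epsilon>/4 of \<open>cluster_opt c\<close> already, and more
  centres do not raise it.\<close>

lemma covered_new:
  assumes cs: "set cs \<subseteq> X" and c: "c \<in> C" and x: "x \<in> X" and F: "F \<subseteq> cluster c"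
    and near: "cs = [] \<and> F = cluster c \<or>
      cs \<noteq> [] \<and> (\<Sum>p\<in>cluster c - F. weight D cs p) \<le> \<epsilon> / 4 * cluster_opt c"
    and good: "(\<Sum>p\<in>F. D p x) \<le> (1 + \<gamma>) * opt_cost D X 1 F"
  shows "covered (cs @ [x]) c"
proof -
  have c_X: "c \<in> X" using c C_facts by auto
  have F_X: "F \<subseteq> X" using F cluster_sub(2)[of c] by blast
  have "cluster_cost (cs @ [x]) c
      = (\<Sum>p\<in>F. weight D (cs @ [x]) p) + (\<Sum>p\<in>cluster c - F. weight D (cs @ [x]) p)"
    unfolding cluster_cost_def using sum.subset_diff[OF F cluster_sub(3), of "weight D (cs @ [x])"]
    by (simp add: add.commute)
  also have "\<dots> \<le> (\<Sum>p\<in>F. D p x) + \<epsilon> / 4 * cluster_opt c"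
  proof (rule add_mono)
    show "(\<Sum>p\<in>F. weight D (cs @ [x]) p) \<le> (\<Sum>p\<in>F. D p x)"
      by (intro sum_mono weight_le) auto
    show "(\<Sum>p\<in>cluster c - F. weight D (cs @ [x]) p) \<le> \<epsilon> / 4 * cluster_opt c"
    proof (cases "cs = []")
      case True
      then show ?thesis using near cluster_opt_nonneg[OF c] eps_pos by simp
    next
      case False
      then have "(\<Sum>p\<in>cluster c - F. weight D (cs @ [x]) p) \<le> (\<Sum>p\<in>cluster c - F. weight D cs p)"
        by (intro sum_mono) (auto simp: weight_append)
      then show ?thesis using near False by linarith
    qed
  qed
  also have "(\<Sum>p\<in>F. D p x) \<le> (1 + \<epsilon> / 4) * cluster_opt c"
  proof -
    have "opt_cost D X 1 F \<le> (\<Sum>p\<in>F. D p c)" using F_X c_X by (rule opt_cost_1_le)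
    also have "\<dots> \<le> cluster_opt c"
      unfolding cluster_opt_def using F cluster_sub(3) c_X
      by (intro sum_mono2) (auto intro!: D_nonneg dest: cluster_X)
    finally have "(1 + \<gamma>) * opt_cost D X 1 F \<le> (1 + \<gamma>) * cluster_opt c"
      using gamma by (intro mult_left_mono) auto
    also have "\<dots> \<le> (1 + \<epsilon> / 4) * cluster_opt c"
      using gamma cluster_opt_nonneg[OF c] by (intro mult_right_mono) auto
    finally show ?thesis using good by linarith
  qed
  finally have "cluster_cost (cs @ [x]) c \<le> (1 + \<epsilon> / 2) * cluster_opt c"
    by (simp add: algebra_simps)
  moreover have "0 \<le> \<epsilon> / (2 * real k) * opt" using eps_pos opt_nonneg by simp
  ultimately show ?thesis by (auto simp: covered_def)
qed

text \<open>Pigeonhole: among at most k clusters one holds a 1/k share of the points, which exceeds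
  \<open>stage_prob\<close>.\<close>

lemma target_first: "\<exists>c\<in>C. cluster c \<noteq> {} \<and> stage_prob * real (length ps) \<le> real (card (cluster c))"
proof -
  have n: "(\<Sum>c\<in>C. real (card (cluster c))) = real (length ps)"
    using cluster_sum[of "\<lambda>_. 1 :: real"] distinct by (simp add: distinct_card)
  have n0: "0 < real (length ps)" using nonempty by simp
  have "\<exists>c\<in>C. real (length ps) / real k \<le> real (card (cluster c))"
  proof (rule ccontr)
    assume "\<not> ?thesis"
    then have "(\<Sum>c\<in>C. real (card (cluster c))) < (\<Sum>c\<in>C. real (length ps) / real k)"
      using C_facts by (intro sum_strict_mono) auto
    also have "\<dots> = real (card C) * (real (length ps) / real k)" by simp
    also have "\<dots> \<le> real k * (real (length ps) / real k)" using C_facts by (intro mult_right_mono) auto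
    finally show False using n k_pos by simp
  qed
  then obtain c where c: "c \<in> C" "real (length ps) / real k \<le> real (card (cluster c))" by blast
  have "stage_prob * real (length ps) \<le> 1 / real k * real (length ps)"
    using stage_prob_le by (intro mult_right_mono) auto
  moreover have "0 < real (length ps) / real k" using n0 k_pos by simp
  ultimately show ?thesis using c by (intro bexI[of _ c]) auto
qed

text \<open>Take the uncovered cluster of largest cost V. Being uncovered gives opt \<le>
  (2k/\<epsilon>) V, so the covered clusters cost at most (1 + \<epsilon>)(2k/\<epsilon>) V, and the
  at most k uncovered ones cost at most k V. So V is a polynomial share of the total weight, and
  \<open>far_part_of_cluster\<close> provides F.\<close>

lemma target_later:
  assumes cs: "set cs \<subseteq> X" "cs \<noteq> []" and un: "uncovered cs \<noteq> {}"
  shows "0 < (\<Sum>p\<in>P. weight D cs p) \<and> (\<exists>c\<in>uncovered cs. \<exists>F\<subseteq>cluster c. F \<noteq> {} \<and>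
    (\<Sum>p\<in>cluster c - F. weight D cs p) \<le> \<epsilon> / 4 * cluster_opt c \<and>
    (\<forall>p\<in>F. stage_prob * (\<Sum>p\<in>P. weight D cs p) \<le> real (card F) * weight D cs p))"
proof -
  have "Max (cluster_cost cs ` uncovered cs) \<in> cluster_cost cs ` uncovered cs"
    using un finite_uncovered by (intro Max_in) auto
  then obtain c where max: "Max (cluster_cost cs ` uncovered cs) = cluster_cost cs c"
    and c_un: "c \<in> uncovered cs" by (rule imageE)
  have c: "c \<in> uncovered cs" "\<And>c'. c' \<in> uncovered cs \<Longrightarrow> cluster_cost cs c' \<le> cluster_cost cs c"
    using c_un finite_uncovered unfolding max[symmetric] by auto
  define W where "W = (\<Sum>p\<in>P. weight D cs p)"
  define V where "V = cluster_cost cs c"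
  have cC: "c \<in> C" using c by (simp add: uncovered_def)
  have bad: "(1 + \<epsilon> / 2) * cluster_opt c + \<epsilon> / (2 * real k) * opt < V"
    using c cs by (auto simp: uncovered_def covered_def V_def)
  have A0: "0 \<le> (1 + \<epsilon> / 2) * cluster_opt c" using cluster_opt_nonneg[OF cC] eps_pos by simp
  have O0: "0 \<le> \<epsilon> / (2 * real k) * opt" using opt_nonneg eps_pos by simp
  have V0: "0 < V" using bad A0 O0 by linarith
  have opt_V: "opt \<le> 2 * real k / \<epsilon> * V"
  proof -
    have "\<epsilon> / (2 * real k) * opt \<le> V" using bad A0 by linarith
    then have "2 * real k / \<epsilon> * (\<epsilon> / (2 * real k) * opt) \<le> 2 * real k / \<epsilon> * V"
      using eps_pos by (intro mult_left_mono) auto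
    then show ?thesis using eps_pos k_pos by simp
  qed
  have "W = (\<Sum>c\<in>C. cluster_cost cs c)" by (simp add: W_def cluster_cost_def cluster_sum)
  also have "\<dots> = (\<Sum>c\<in>C - uncovered cs. cluster_cost cs c) + (\<Sum>c\<in>uncovered cs. cluster_cost cs c)"
    using C_facts by (intro sum.subset_diff) (auto simp: uncovered_def)
  also have "(\<Sum>c\<in>uncovered cs. cluster_cost cs c) \<le> real k * V"
  proof -
    have "(\<Sum>c\<in>uncovered cs. cluster_cost cs c) \<le> real (card (uncovered cs)) * V"
      using c(2) by (intro sum_bounded_above) (auto simp: V_def)
    also have "\<dots> \<le> real k * V"
    proof (intro mult_right_mono)
      have "card (uncovered cs) \<le> card C" using C_facts by (intro card_mono) (auto simp: uncovered_def)
      then show "real (card (uncovered cs)) \<le> real k" using C_facts by simp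
    qed (use V0 in simp)
    finally show ?thesis .
  qed
  also have "(\<Sum>c\<in>C - uncovered cs. cluster_cost cs c) \<le> (1 + \<epsilon>) * opt"
    by (intro covered_cost) (auto simp: uncovered_def)
  also have "(1 + \<epsilon>) * opt \<le> (1 + \<epsilon>) * (2 * real k / \<epsilon> * V)"
    using opt_V eps_pos by (intro mult_left_mono) auto
  also have "(1 + \<epsilon>) * (2 * real k / \<epsilon> * V) + real k * V = (2 + 3 * \<epsilon>) * (real k / \<epsilon> * V)"
    using eps_pos by (simp add: field_simps)
  \<comment> \<open>By \<epsilon> \<le> 1/2 the factor 2 + 3\<epsilon> is at most 4, the 4 in
    \<open>stage_prob\<close>.\<close>
  also have "\<dots> \<le> 4 * (real k / \<epsilon> * V)"
    using eps_le eps_pos V0 by (intro mult_right_mono) auto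
  finally have W_le: "W \<le> 4 * (real k / \<epsilon> * V)" by simp
  have "\<exists>F\<subseteq>cluster c. F \<noteq> {} \<and>
      (\<Sum>p\<in>cluster c - F. Min ((\<lambda>c. D p c) ` set cs)) \<le> \<epsilon> / 4 * (\<Sum>p\<in>cluster c. D p c) \<and>
      (\<forall>p\<in>F. far_frac * near_frac * (\<Sum>p\<in>cluster c. Min ((\<lambda>c. D p c) ` set cs))
        \<le> real (card F) * Min ((\<lambda>c. D p c) ` set cs))"
    using bad O0 cs cC C_facts cluster_sub
    by (intro far_part_of_cluster) (auto simp: V_def cluster_cost_def weight_def cluster_opt_def)
  then obtain F where F: "F \<subseteq> cluster c" "F \<noteq> {}"
      "(\<Sum>p\<in>cluster c - F. weight D cs p) \<le> \<epsilon> / 4 * cluster_opt c"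
      "\<And>p. p \<in> F \<Longrightarrow> far_frac * near_frac * V \<le> real (card F) * weight D cs p"
    using cs(2) by (auto simp: weight_def V_def cluster_cost_def cluster_opt_def)
  have "stage_prob * W \<le> far_frac * near_frac * V"
  proof -
    have "stage_prob * W \<le> stage_prob * (4 * (real k / \<epsilon> * V))"
      using W_le stage_prob_pos by (intro mult_left_mono) auto
    also have "\<dots> = far_frac * near_frac * V" using k_pos eps_pos by (simp add: stage_prob_def)
    finally show ?thesis .
  qed
  then have far: "\<And>p. p \<in> F \<Longrightarrow> stage_prob * W \<le> real (card F) * weight D cs p"
    using F(4) order_trans by blast
  have "V \<le> W"
    unfolding V_def W_def cluster_cost_def using cluster_sub cs ps_X
    by (intro sum_mono2) (auto intro!: weight_nonneg)
  then have "0 < W" using V0 by linarith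
  then show ?thesis using c(1) F far unfolding W_def by blast
qed

text \<open>Each successful round must cover at least one more cluster. The second alternative
  absorbs trials whose total cost is good before k rounds are over: there may be no target left, but
  further centres cannot raise the cost.\<close>

definition on_track :: "nat \<Rightarrow> point list set" where
  "on_track j = {cs. set cs \<subseteq> X \<and> length cs = j \<and>
     (card (uncovered cs) + j \<le> k \<or> cs \<noteq> [] \<and> med_cost D P (set cs) \<le> (1 + \<epsilon>) * opt)}"

lemma stage_success:
  assumes cs: "cs \<in> on_track j"
  shows "stage_prob ^ M * (8 / 10) \<le>
    measure_pmf.prob (map_pmf (extend d ps cs) (replicate_pmf M (draw D ps cs))) (on_track (Suc j))"
proof -
  have csX: "set cs \<subseteq> X" and len: "length cs = j" using cs by (auto simp: on_track_def)
  let ?S = "replicate_pmf M (draw D ps cs)"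
  show ?thesis
  proof (cases "cs \<noteq> [] \<and> med_cost D P (set cs) \<le> (1 + \<epsilon>) * opt")
    case True
    have "1 / real k \<le> 1" using k_pos by simp
    then have "stage_prob \<le> 1" using stage_prob_le by linarith
    then have "stage_prob ^ M * (8 / 10) \<le> 1"
      using power_le_one[of stage_prob M] stage_prob_pos by simp
    also have "1 = measure_pmf.prob ?S UNIV" by simp
    also have "\<dots> \<le> measure_pmf.prob ?S (extend d ps cs -` on_track (Suc j))"
    proof (rule prob_mono_on_support)
      fix "is" assume is_S: "is \<in> set_pmf ?S"
      have "(\<Sum>p\<in>P. weight D (extend d ps cs is) p) \<le> (\<Sum>p\<in>P. weight D cs p)"
        using True by (intro sum_mono) (auto simp: extend_def weight_append simp del: mset_map)
      then have "med_cost D P (set (extend d ps cs is)) \<le> (1 + \<epsilon>) * opt"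
        using True sum_weight[of cs D P] sum_weight[of "extend d ps cs is" D P]
        by (simp add: extend_def)
      then show "is \<in> extend d ps cs -` on_track (Suc j)"
        using extend_in[OF csX is_S] len by (simp add: on_track_def) (simp add: extend_def)
    qed
    finally show ?thesis by simp
  next
    case False
    then have un: "card (uncovered cs) + j \<le> k" using cs by (auto simp: on_track_def)
    have ne: "uncovered cs \<noteq> {}" using False cost_if_no_uncovered[of cs] by auto
    \<comment> \<open>First and later rounds provide a target of the same form; in the first round F
      is the whole cluster.\<close>
    obtain c F where cF: "c \<in> uncovered cs" "F \<subseteq> cluster c" "F \<noteq> {}"
      "cs = [] \<and> F = cluster c \<or>
        cs \<noteq> [] \<and> (\<Sum>p\<in>cluster c - F. weight D cs p) \<le> \<epsilon> / 4 * cluster_opt c"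
      "0 < (\<Sum>p\<in>P. weight D cs p)"
      "\<And>p. p \<in> F \<Longrightarrow> stage_prob * (\<Sum>p\<in>P. weight D cs p) \<le> real (card F) * weight D cs p"
    proof (cases "cs = []")
      case True
      obtain c where c: "c \<in> C" "cluster c \<noteq> {}"
        "stage_prob * real (length ps) \<le> real (card (cluster c))" using target_first by blast
      have "(\<Sum>p\<in>P. weight D cs p) = real (length ps)"
        using True distinct by (simp add: weight_def distinct_card)
      then show ?thesis
        using c True nonempty by (intro that[of c "cluster c"])
          (auto simp: uncovered_def covered_def weight_def)
    next
      case False
      then show ?thesis using target_later[OF csX False ne] that by blast
    qed
    have "stage_prob ^ M * (8 / 10) \<le> measure_pmf.prob ?S
      {is. (\<Sum>p\<in>F. D p (centroid d (mset (map ((!) ps) is)))) \<le> (1 + \<gamma>) * opt_cost D X 1 F}"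
      using cF cluster_sub by (intro sample_prob_draw csX) auto
    also have "\<dots> \<le> measure_pmf.prob ?S (extend d ps cs -` on_track (Suc j))"
    proof (rule prob_mono_on_support)
      fix "is" assume is_S: "is \<in> set_pmf ?S" and
        good: "is \<in> {is. (\<Sum>p\<in>F. D p (centroid d (mset (map ((!) ps) is)))) \<le> (1 + \<gamma>) * opt_cost D X 1 F}"
      define x where "x = centroid d (mset (map ((!) ps) is))"
      have ex: "extend d ps cs is = cs @ [x]" by (simp add: extend_def x_def)
      have X': "set (cs @ [x]) \<subseteq> X" using extend_in[OF csX is_S] unfolding ex .
      have "covered (cs @ [x]) c"
        using good cF X' csX unfolding x_def[symmetric]
        by (intro covered_new[of cs c x F]) (auto simp: uncovered_def x_def)
      \<comment> \<open>Covered clusters stay covered and c joins them, so the drop in the count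
        pays for the round.\<close>
      then have "uncovered (cs @ [x]) \<subseteq> uncovered cs - {c}"
        using covered_append by (auto simp: uncovered_def)
      then have "card (uncovered (cs @ [x])) \<le> card (uncovered cs - {c})"
        using finite_uncovered by (intro card_mono) auto
      also have "\<dots> < card (uncovered cs)" using cF(1) finite_uncovered by (intro card_Diff1_less)
      finally show "is \<in> extend d ps cs -` on_track (Suc j)"
        using un X' len by (simp add: on_track_def ex)
    qed
    finally show ?thesis by simp
  qed
qed

lemma trial_success:
  "(stage_prob ^ M * (8 / 10)) ^ j \<le> measure_pmf.prob (trial d D ps M j) (on_track j)"
proof (induction j)
  case 0
  have "card (uncovered []) \<le> card C" using C_facts by (intro card_mono) (auto simp: uncovered_def)
  then show ?case using C_facts by (simp add: on_track_def)
next
  case (Suc j)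
  have "(stage_prob ^ M * (8 / 10)) ^ j * (stage_prob ^ M * (8 / 10))
    \<le> measure_pmf.prob (trial d D ps M (Suc j)) (on_track (Suc j))"
    unfolding trial.simps using stage_prob_pos by (intro prob_bind_ge[OF Suc] stage_success) auto
  then show ?case by (simp add: mult.commute)
qed

end

context sampling_instance
begin

lemma trial_in: "cs \<in> set_pmf (trial d D ps M j) \<Longrightarrow> set cs \<subseteq> X \<and> length cs = j"
proof (induction j arbitrary: cs)
  case (Suc j)
  then obtain cs' "is" where "cs' \<in> set_pmf (trial d D ps M j)"
      "is \<in> set_pmf (replicate_pmf M (draw D ps cs'))" "cs = extend d ps cs' is" by auto
  moreover from this have "set cs \<subseteq> X" using Suc.IH extend_in by blast
  ultimately show ?case using Suc.IH by (auto simp: extend_def simp del: mset_map)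
qed simp

lemma trial_prob:
  "(stage_prob ^ M * (8 / 10)) ^ k \<le> measure_pmf.prob (trial d D ps M k)
     {cs. med_cost D P (set cs) \<le> (1 + \<epsilon>) * opt_cost D X k P}"
proof -
  obtain C where sol: "C \<in> medians X k" "med_cost D P C = opt_cost D X k P"
    using opt_cost_attained[of P k] nonempty ps_X k_pos by auto
  then have "finite C" "C \<noteq> {}" by (auto simp: medians_def)
  then obtain a where a: "\<And>p. a p \<in> C" "\<And>p. D p (a p) = Min ((\<lambda>c. D p c) ` C)"
    using Min_attained[of C] by metis
  interpret reference_solution d X D \<alpha> \<beta> b \<epsilon> k M \<gamma> ps C a
    by unfold_locales (use sol a in auto)
  have "on_track k \<subseteq> {cs. med_cost D P (set cs) \<le> (1 + \<epsilon>) * opt_cost D X k P}"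
  proof
    fix cs assume cs: "cs \<in> on_track k"
    \<comment> \<open>At j = k the first alternative of \<open>on_track\<close> leaves no uncovered
      cluster.\<close>
    have "med_cost D P (set cs) \<le> (1 + \<epsilon>) * opt"
      using cs cost_if_no_uncovered[of cs] finite_uncovered by (auto simp: on_track_def)
    then show "cs \<in> {cs. med_cost D P (set cs) \<le> (1 + \<epsilon>) * opt_cost D X k P}"
      by (simp add: opt_def sol)
  qed
  then have "measure_pmf.prob (trial d D ps M k) (on_track k) \<le> measure_pmf.prob (trial d D ps M k)
     {cs. med_cost D P (set cs) \<le> (1 + \<epsilon>) * opt_cost D X k P}"
    by (intro measure_pmf.finite_measure_mono) auto
  then show ?thesis using trial_success[of k] by linarith
qed

text \<open>The parameter p stands for a lower bound that is uniform in the input, since N is built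
  into the program.\<close>

lemma best_of_success:
  assumes "p \<le> (stage_prob ^ M * (8 / 10)) ^ k" "(1 - p) ^ N \<le> \<rho>" "p \<le> 1"
  shows "1 - \<rho> \<le> measure_pmf.prob (best_of (\<lambda>cs. med_cost D P (set cs)) (trial d D ps M k) N)
    {b. \<exists>cs. b = Some cs \<and> set cs \<subseteq> X \<and> length cs = k \<and>
       med_cost D P (set cs) \<le> (1 + \<epsilon>) * opt_cost D X k P}"
proof -
  let ?t = "(1 + \<epsilon>) * opt_cost D X k P" and ?cost = "\<lambda>cs. med_cost D P (set cs)"
  let ?B = "{b. \<forall>cs. b = Some cs \<longrightarrow> \<not> ?cost cs \<le> ?t}"
  let ?best = "best_of ?cost (trial d D ps M k) N"
  have "measure_pmf.prob (trial d D ps M k) {cs. \<not> ?cost cs \<le> ?t}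
      = 1 - measure_pmf.prob (trial d D ps M k) {cs. ?cost cs \<le> ?t}"
    by (subst measure_pmf.prob_compl[symmetric]) (auto intro!: arg_cong2[of _ _ _ _ measure])
  then have "measure_pmf.prob (trial d D ps M k) {cs. \<not> ?cost cs \<le> ?t} \<le> 1 - p"
    using trial_prob assms(1) by linarith
  then have "measure_pmf.prob ?best ?B \<le> (1 - p) ^ N" by (rule prob_best_of_fails)
  then have "1 - \<rho> \<le> 1 - measure_pmf.prob ?best ?B" using assms(2) by linarith
  also have "\<dots> = measure_pmf.prob ?best (UNIV - ?B)"
    by (subst measure_pmf.prob_compl[symmetric]) auto
  also have "\<dots> \<le> measure_pmf.prob ?best {b. \<exists>cs. b = Some cs \<and> set cs \<subseteq> X \<and> length cs = k \<and>
       med_cost D P (set cs) \<le> (1 + \<epsilon>) * opt_cost D X k P}"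
  proof (rule prob_mono_on_support)
    fix b assume "b \<in> set_pmf ?best" "b \<in> UNIV - ?B"
    then show "b \<in> {b. \<exists>cs. b = Some cs \<and> set cs \<subseteq> X \<and> length cs = k \<and>
       med_cost D P (set cs) \<le> (1 + \<epsilon>) * opt_cost D X k P}"
      using set_best_of[of b] trial_in by fastforce
  qed
  finally show ?thesis .
qed

end

section \<open>Refinement of abstract distributions by machine programs\<close>

text \<open>A coupling of an abstract distribution with final states and running times:
  probabilities of abstract events carry over to the machine, while the time bound holds on every
  outcome.\<close>

definition implements ::
  "nat \<Rightarrow> dissim \<Rightarrow> com \<Rightarrow> state \<Rightarrow> nat \<Rightarrow> 'a pmf \<Rightarrow> ('a \<Rightarrow> state \<Rightarrow> bool) \<Rightarrow> bool" where
  "implements d D c s T \<mu> R \<longleftrightarrow>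
     (\<exists>\<nu>. exec d D c s \<nu> \<and> rel_pmf (\<lambda>a (s', t). t \<le> T \<and> R a s') \<mu> \<nu>)"

lemma implements_mono:
  assumes "implements d D c s T \<mu> R" "T \<le> T'" "\<And>a s'. a \<in> set_pmf \<mu> \<Longrightarrow> R a s' \<Longrightarrow> R' a s'"
  shows "implements d D c s T' \<mu> R'"
  using assms unfolding implements_def
  by (fastforce elim!: pmf.rel_mono_strong)

lemma implements_return:
  "exec d D c s (return_pmf (s', t)) \<Longrightarrow> t \<le> T \<Longrightarrow> R a s' \<Longrightarrow> implements d D c s T (return_pmf a) R"
  unfolding implements_def by (auto simp: rel_pmf_return_pmf1 intro!: exI[of _ "return_pmf (s', t)"])

lemma implements_map:
  "implements d D c s T \<mu> (\<lambda>a. R (f a)) \<Longrightarrow> implements d D c s T (map_pmf f \<mu>) R"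
  unfolding implements_def by (simp add: pmf.rel_map)

lemma implements_Skip: "R a s \<Longrightarrow> 1 \<le> T \<Longrightarrow> implements d D Skip s T (return_pmf a) R"
  by (rule implements_return[OF exec.Skip])

lemma implements_SetIdx:
  "R a (set_idx i (nval e s) s) \<Longrightarrow> 1 + ncost e \<le> T \<Longrightarrow>
    implements d D (SetIdx i e) s T (return_pmf a) R"
  by (rule implements_return[OF exec.SetIdx])

lemma implements_Store:
  "R a (set_mem (nval e s) (rval x s) s) \<Longrightarrow> 1 + ncost e + rcost x \<le> T \<Longrightarrow>
    implements d D (Store e x) s T (return_pmf a) R"
  by (rule implements_return[OF exec.Store])

lemma implements_Dissim:
  "R a (set_mem (nval r s) (D (point_at d s (nval e s)) (point_at d s (nval f s))) s) \<Longrightarrow>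
    1 + d + ncost r + ncost e + ncost f \<le> T \<Longrightarrow>
    implements d D (Dissim r e f) s T (return_pmf a) R"
  by (rule implements_return[OF exec.Dissim])

lemma implements_Flip:
  assumes "\<And>h. R h (set_idx i (of_bool h) s)" "1 + rcost x \<le> T"
  shows "implements d D (Flip i x) s T (bernoulli_pmf (rval x s)) R"
  unfolding implements_def
proof (intro exI conjI)
  show "exec d D (Flip i x) s
    (map_pmf (\<lambda>h. (set_idx i (of_bool h) s, 1 + rcost x)) (bernoulli_pmf (rval x s)))"
    by (rule exec.Flip)
  show "rel_pmf (\<lambda>a (s', t). t \<le> T \<and> R a s') (bernoulli_pmf (rval x s))
    (map_pmf (\<lambda>h. (set_idx i (of_bool h) s, 1 + rcost x)) (bernoulli_pmf (rval x s)))"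
    unfolding pmf.rel_map using assms by (intro rel_pmf_reflI) auto
qed

lemma implements_charge:
  assumes "rel_pmf (\<lambda>a (s', t). t \<le> T \<and> R a s') \<mu> \<nu>" "c + T \<le> T'"
  shows "rel_pmf (\<lambda>a (s', t). t \<le> T' \<and> R a s') \<mu> (charge c \<nu>)"
  unfolding charge_def pmf.rel_map using assms
  by (auto elim!: pmf.rel_mono_strong)

lemma implements_Cond:
  assumes "cval b s \<Longrightarrow> implements d D c s T \<mu> R" "\<not> cval b s \<Longrightarrow> implements d D c' s T \<mu> R"
    and "ccost b + T \<le> T'"
  shows "implements d D (Cond b c c') s T' \<mu> R"
proof (cases "cval b s")
  case True
  then show ?thesis
    using assms(1,3) unfolding implements_def
    by (blast intro: exec.CondTrue implements_charge)
next
  case False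
  then show ?thesis
    using assms(2,3) unfolding implements_def
    by (blast intro: exec.CondFalse implements_charge)
qed

text \<open>The continuations for different abstract values reaching the same state agree because
  execution is deterministic as a function to distributions.\<close>

lemma implements_Seq:
  assumes 1: "implements d D c s T1 \<mu> R"
    and 2: "\<And>a s'. a \<in> set_pmf \<mu> \<Longrightarrow> R a s' \<Longrightarrow> implements d D c' s' T2 (f a) R'"
    and T: "T1 + T2 \<le> T"
  shows "implements d D (Seq c c') s T (bind_pmf \<mu> f) R'"
proof -
  obtain \<nu> where \<nu>: "exec d D c s \<nu>" "rel_pmf (\<lambda>a (s', t). t \<le> T1 \<and> R a s') \<mu> \<nu>"
    using 1 by (auto simp: implements_def)
  define g where "g s' = (SOME \<kappa>. exec d D c' s' \<kappa>)" for s'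
  have g: "exec d D c' s' (g s')" if "exec d D c' s' \<kappa>" for s' \<kappa>
    unfolding g_def using that by (rule someI)
  have rel: "rel_pmf (\<lambda>a (s', t). a \<in> set_pmf \<mu> \<and> t \<le> T1 \<and> R a s') \<mu> \<nu>"
    using \<nu>(2) by (auto elim!: pmf.rel_mono_strong)
  have ex: "exec d D c' s' (g s')" if mem: "(s', t) \<in> set_pmf \<nu>" for s' t
  proof -
    obtain a where "a \<in> set_pmf \<mu>" "R a s'"
      using rel_pmf_imp_rel_set[OF \<nu>(2)] mem by (fastforce simp: rel_set_def)
    from 2[OF this] show ?thesis unfolding implements_def using g by blast
  qed
  have "exec d D (Seq c c') s (bind_pmf \<nu> (\<lambda>(s', t). charge t (g s')))"
    by (rule exec.Seq[OF \<nu>(1)]) (rule ex)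
  moreover have "rel_pmf (\<lambda>a (s', t). t \<le> T \<and> R' a s') (bind_pmf \<mu> f)
      (bind_pmf \<nu> (\<lambda>(s', t). charge t (g s')))"
  proof (rule rel_pmf_bindI[OF rel], clarify)
    fix a s' t assume a: "a \<in> set_pmf \<mu>" "t \<le> T1" "R a s'"
    obtain \<kappa> where \<kappa>: "exec d D c' s' \<kappa>" "rel_pmf (\<lambda>a (s', t). t \<le> T2 \<and> R' a s') (f a) \<kappa>"
      using 2[OF a(1,3)] by (auto simp: implements_def)
    have "g s' = \<kappa>" using exec_deterministic[OF \<kappa>(1) g[OF \<kappa>(1)]] .
    then show "rel_pmf (\<lambda>a (s', t). t \<le> T \<and> R' a s') (f a) (charge t (g s'))"
      using \<kappa>(2) a(2) T by (intro implements_charge) auto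
  qed
  ultimately show ?thesis unfolding implements_def by blast
qed

lemma implements_Seq_return:
  assumes "implements d D c s T1 (return_pmf a) R" "\<And>s'. R a s' \<Longrightarrow> implements d D c' s' T2 \<mu> R'"
    and "T1 + T2 \<le> T"
  shows "implements d D (Seq c c') s T \<mu> R'"
  using implements_Seq[OF assms(1), of c' T2 "\<lambda>_. \<mu>" R' T] assms(2,3) by (simp add: bind_return_pmf)

lemma implements_SetIdx_Seq:
  "implements d D c (set_idx i (nval e s) s) T2 \<mu> R \<Longrightarrow> 1 + ncost e + T2 \<le> T \<Longrightarrow>
    implements d D (Seq (SetIdx i e) c) s T \<mu> R"
  by (rule implements_Seq_return[OF implements_SetIdx[where R = "\<lambda>_ s'. s' = set_idx i (nval e s) s" and a = "()"]])
    auto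

lemma implements_Store_Seq:
  "implements d D c (set_mem (nval e s) (rval x s) s) T2 \<mu> R \<Longrightarrow> 1 + ncost e + rcost x + T2 \<le> T \<Longrightarrow>
    implements d D (Seq (Store e x) c) s T \<mu> R"
  by (rule implements_Seq_return[OF implements_Store[where R = "\<lambda>_ s'. s' = set_mem (nval e s) (rval x s) s" and a = "()"]])
    auto

lemma implements_Dissim_Seq:
  "implements d D c (set_mem (nval r s) (D (point_at d s (nval e s)) (point_at d s (nval f s))) s) T2 \<mu> R \<Longrightarrow>
    1 + d + ncost r + ncost e + ncost f + T2 \<le> T \<Longrightarrow>
    implements d D (Seq (Dissim r e f) c) s T \<mu> R"
  by (rule implements_Seq_return[OF implements_Dissim[where R = "\<lambda>_ s'. s' = set_mem (nval r s)
      (D (point_at d s (nval e s)) (point_at d s (nval f s))) s" and a = "()"]])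
    auto

section \<open>Iteration and loops\<close>

primrec steps :: "(nat \<Rightarrow> 'a \<Rightarrow> 'a pmf) \<Rightarrow> nat \<Rightarrow> 'a \<Rightarrow> 'a pmf" where
  "steps f 0 a = return_pmf a"
| "steps f (Suc n) a = bind_pmf (steps f n a) (f n)"

text \<open>\<open>While\<close> unfolds at its first iteration, whereas \<open>reservoir\<close>,
  \<open>trial\<close> and \<open>best_of\<close> recurse on the last one;
  \<open>steps_from_0\<close> mediates.\<close>

primrec steps_from :: "(nat \<Rightarrow> 'a \<Rightarrow> 'a pmf) \<Rightarrow> nat \<Rightarrow> nat \<Rightarrow> 'a \<Rightarrow> 'a pmf" where
  "steps_from f 0 i a = return_pmf a"
| "steps_from f (Suc m) i a = bind_pmf (f i a) (steps_from f m (Suc i))"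

lemma steps_from_0: "steps_from f n 0 a = steps f n a"
proof -
  have "bind_pmf (steps f i a) (steps_from f m i) = steps f (i + m) a" for i m
  proof (induction m arbitrary: i)
    case 0
    have "steps_from f 0 i = return_pmf" by (rule ext) simp
    then show ?case by (simp add: bind_return_pmf')
  next
    case (Suc m)
    from Suc[of "Suc i"] show ?case by (simp add: bind_assoc_pmf)
  qed
  from this[of 0] show ?thesis by (simp add: bind_return_pmf)
qed

lemma steps_return: "steps (\<lambda>_. return_pmf) n a = return_pmf a"
  by (induction n) (simp_all add: bind_return_pmf)

text \<open>Loops whose number of iterations is known before the input (d, k, M and N) are unrolled.
  Offsets such as j * d then become constants, which matters because index arithmetic cannot
  multiply.\<close>

primrec seqs :: "(nat \<Rightarrow> com) \<Rightarrow> nat \<Rightarrow> com" where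
  "seqs c 0 = Skip"
| "seqs c (Suc n) = Seq (seqs c n) (c n)"

lemma implements_seqs:
  assumes "\<And>i a s'. i < n \<Longrightarrow> J i a s' \<Longrightarrow> implements d D (c i) s' T (f i a) (J (Suc i))"
    and "J 0 a s"
  shows "implements d D (seqs c n) s (1 + n * T) (steps f n a) (J n)"
  using assms(1)
proof (induction n)
  case 0
  then show ?case using assms(2) by (auto intro: implements_Skip)
next
  case (Suc n)
  then show ?case by (auto intro!: implements_Seq[where ?T1.0 = "1 + n * T" and ?T2.0 = T])
qed

lemma implements_seqs_return:
  assumes "\<And>i s'. i < n \<Longrightarrow> J i s' \<Longrightarrow> implements d D (c i) s' T (return_pmf ()) (\<lambda>_. J (Suc i))"
    and "J 0 s" "1 + n * T \<le> T'"
  shows "implements d D (seqs c n) s T' (return_pmf ()) (\<lambda>_. J n)"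
  using implements_seqs[of n "\<lambda>i _. J i" d D c T "\<lambda>_. return_pmf" "()" s] assms
  by (auto simp: steps_return intro: implements_mono)

definition same_except :: "nat set \<Rightarrow> nat set \<Rightarrow> state \<Rightarrow> state \<Rightarrow> bool" where
  "same_except A I s s' \<longleftrightarrow> (\<forall>a. a \<notin> A \<longrightarrow> mem s' a = mem s a) \<and> (\<forall>i. i \<notin> I \<longrightarrow> idx s' i = idx s i)"

lemma same_except_refl [simp]: "same_except A I s s"
  by (simp add: same_except_def)

lemma same_except_trans:
  "same_except A I s s' \<Longrightarrow> same_except B J s' s'' \<Longrightarrow> A \<subseteq> E \<Longrightarrow> B \<subseteq> E \<Longrightarrow> I \<subseteq> K \<Longrightarrow> J \<subseteq> K \<Longrightarrow>
    same_except E K s s''"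
  unfolding same_except_def by (metis subsetD)

lemma same_except_set_mem [simp]:
  "a \<in> A \<Longrightarrow> same_except A I s (set_mem a v s') \<longleftrightarrow> same_except A I s s'"
  by (auto simp: same_except_def set_mem_def)

lemma same_except_set_idx [simp]:
  "i \<in> I \<Longrightarrow> same_except A I s (set_idx i v s') \<longleftrightarrow> same_except A I s s'"
  by (auto simp: same_except_def set_idx_def)

lemma same_except_mem: "same_except A I s s' \<Longrightarrow> a \<notin> A \<Longrightarrow> mem s' a = mem s a"
  by (simp add: same_except_def)

lemma state_simps [simp]:
  "mem (set_mem a v s) b = (if b = a then v else mem s b)"
  "idx (set_mem a v s) = idx s"
  "mem (set_idx i m s) = mem s"
  "idx (set_idx i m s) j = (if j = i then m else idx s j)"
  by (simp_all add: set_mem_def set_idx_def)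

text \<open>Register 5 follows i * d by repeated addition, in place of the missing index
  multiplication.\<close>

definition for_points :: "nat \<Rightarrow> com \<Rightarrow> com" where
  "for_points d c = Seq (SetIdx 4 (NConst 0)) (Seq (SetIdx 5 (NConst 0))
     (While (NLess (NReg 4) (NReg 0))
       (Seq c (Seq (SetIdx 4 (NAdd (NReg 4) (NConst 1))) (SetIdx 5 (NAdd (NReg 5) (NConst d)))))))"

text \<open>An iteration costs T plus 3 for the test and 4 for each of the two increments; outside
  remain two initialisations at 2 and the final test at 3. The frame conditions keep the loop
  registers out of the invariant.\<close>

lemma implements_for_points:
  assumes n: "idx s 0 = n"
    and body: "\<And>i a s'. i < n \<Longrightarrow> J i a s' \<Longrightarrow> idx s' 4 = i \<Longrightarrow> idx s' 5 = i * d \<Longrightarrow> idx s' 0 = n \<Longrightarrow>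
      implements d D c s' T (f i a)
        (\<lambda>a' s'. J (Suc i) a' s' \<and> idx s' 4 = i \<and> idx s' 5 = i * d \<and> idx s' 0 = n)"
    and frame: "\<And>i a s' m. J i a s' \<Longrightarrow> J i a (set_idx 4 m s')"
      "\<And>i a s' m. J i a s' \<Longrightarrow> J i a (set_idx 5 m s')"
    and start: "J 0 a s"
  shows "implements d D (for_points d c) s (n * (T + 11) + 7) (steps f n a) (J n)"
proof -
  let ?next = "Seq (SetIdx 4 (NAdd (NReg 4) (NConst 1))) (SetIdx 5 (NAdd (NReg 5) (NConst d)))"
  let ?W = "While (NLess (NReg 4) (NReg 0)) (Seq c ?next)"
  define K where "K = (\<lambda>i a s'. J i a s' \<and> idx s' 4 = i \<and> idx s' 5 = i * d \<and> idx s' 0 = n)"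
  have loop: "implements d D ?W s' (m * (T + 11) + 3) (steps_from f m i a) (J n)"
    if "i + m = n" "K i a s'" for m i a s'
    using that
  proof (induction m arbitrary: i a s')
    case 0
    then have "\<not> cval (NLess (NReg 4) (NReg 0)) s'" by (simp add: K_def)
    from exec.WhileFalse[OF this, of d D "Seq c ?next"] show ?case
      using 0 by (auto intro!: implements_return[where s' = s'] simp: K_def)
  next
    case (Suc m)
    have step: "implements d D ?next s'' 8 (return_pmf a') (K (Suc i))"
      if "J (Suc i) a' s'' \<and> idx s'' 4 = i \<and> idx s'' 5 = i * d \<and> idx s'' 0 = n" for a' s''
      using that
      by (intro implements_SetIdx_Seq[where ?T2.0 = 4] implements_SetIdx) (auto simp: K_def intro!: frame)
    have "implements d D c s' T (f i a)
        (\<lambda>a' s'. J (Suc i) a' s' \<and> idx s' 4 = i \<and> idx s' 5 = i * d \<and> idx s' 0 = n)"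
      using Suc.prems by (intro body) (auto simp: K_def)
    then have "implements d D (Seq c ?next) s' (T + 8) (bind_pmf (f i a) return_pmf) (K (Suc i))"
      by (rule implements_Seq[where ?T2.0 = 8]) (rule step, assumption, simp)
    then have "implements d D (Seq (Seq c ?next) ?W) s' ((T + 8) + (m * (T + 11) + 3))
        (bind_pmf (f i a) (steps_from f m (Suc i))) (J n)"
      unfolding bind_return_pmf'
      by (rule implements_Seq[where ?T2.0 = "m * (T + 11) + 3"])
        (rule Suc.IH, use Suc.prems in simp, assumption, simp)
    then obtain \<nu> where \<nu>: "exec d D (Seq (Seq c ?next) ?W) s' \<nu>"
      "rel_pmf (\<lambda>a (s', t). t \<le> (T + 8) + (m * (T + 11) + 3) \<and> J n a s')
        (bind_pmf (f i a) (steps_from f m (Suc i))) \<nu>"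
      by (auto simp: implements_def)
    have "cval (NLess (NReg 4) (NReg 0)) s'" using Suc.prems by (simp add: K_def)
    from exec.WhileTrue[OF this \<nu>(1)] have "exec d D ?W s' (charge 3 \<nu>)" by (simp add: numeral_3_eq_3)
    moreover have "rel_pmf (\<lambda>a (s', t). t \<le> Suc m * (T + 11) + 3 \<and> J n a s')
        (steps_from f (Suc m) i a) (charge 3 \<nu>)"
      unfolding steps_from.simps by (rule implements_charge[OF \<nu>(2)]) simp
    ultimately show ?case unfolding implements_def by blast
  qed
  have "implements d D ?W (set_idx 5 0 (set_idx 4 0 s)) (n * (T + 11) + 3) (steps_from f n 0 a) (J n)"
    using n start by (intro loop) (auto simp: K_def intro!: frame)
  then show ?thesis
    unfolding for_points_def steps_from_0
    by (intro implements_SetIdx_Seq[where ?T2.0 = "n * (T + 11) + 5"]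
        implements_SetIdx_Seq[where ?T2.0 = "n * (T + 11) + 3"]) auto
qed

section \<open>The program\<close>

text \<open>Memory behind the \<open>n * d\<close> input cells: the \<open>n\<close> sampling weights (address in register \<open>2\<close>), then
  the scratch area (address in register \<open>3\<close>) with a running sum, the last dissimilarity, the best
  score, the current centres and the best centres. Registers \<open>4\<close> and \<open>5\<close> hold the index and
  address of the point visited by a loop, \<open>6\<close> a coin toss and \<open>7\<close> the address of the sampled point.\<close>

definition scratch :: "nat \<Rightarrow> nexp" where "scratch q = NAdd (NReg 3) (NConst q)"
definition weight_cell :: nexp where "weight_cell = NAdd (NReg 2) (NReg 4)"

definition store_block :: "nat \<Rightarrow> nat \<Rightarrow> (nat \<Rightarrow> rexp) \<Rightarrow> com" where
  "store_block q m e = seqs (\<lambda>l. Store (scratch (q + l)) (e l)) m"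

text \<open>\<open>reservoir\<close> with its prefix sum in scratch cell 0. Register 7 keeps the
  address of the selected point instead of its index, since an address could not be recomputed by
  multiplication.\<close>

definition draw_com :: "nat \<Rightarrow> com" where
  "draw_com d = Seq (Store (scratch 0) (OfIdx (NConst 0))) (Seq (SetIdx 7 (NConst 0))
     (for_points d
       (Seq (Store (scratch 0) (RAdd (Load (scratch 0)) (Load weight_cell)))
       (Seq (Flip 6 (RDiv (Load weight_cell) (Load (scratch 0))))
            (Cond (NLess (NConst 0) (NReg 6)) (SetIdx 7 (NReg 5)) Skip)))))"

definition center_com :: "nat \<Rightarrow> nat \<Rightarrow> nat \<Rightarrow> com" where
  "center_com d M j =
     Seq (store_block (3 + j * d) d (\<lambda>_. OfIdx (NConst 0)))
    (Seq (seqs (\<lambda>_. Seq (draw_com d) (store_block (3 + j * d) d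
            (\<lambda>l. RAdd (Load (scratch (3 + j * d + l))) (Load (NAdd (NReg 7) (NConst l)))))) M)
         (store_block (3 + j * d) d
            (\<lambda>l. RDiv (Load (scratch (3 + j * d + l))) (OfIdx (NConst M)))))"

text \<open>The initial weights 1 are no dissimilarities, so round 0 overwrites them instead of
  taking minima. After the last round the running sum is the cost of the trial.\<close>

definition update_com :: "nat \<Rightarrow> nat \<Rightarrow> com" where
  "update_com d j = Seq (Store (scratch 0) (OfIdx (NConst 0)))
     (for_points d
       (Seq (Dissim (scratch 1) (NReg 5) (scratch (3 + j * d)))
       (Seq (if j = 0 then Store weight_cell (Load (scratch 1))
             else Cond (RLess (Load (scratch 1)) (Load weight_cell))
                    (Store weight_cell (Load (scratch 1))) Skip)
            (Store (scratch 0) (RAdd (Load (scratch 0)) (Load weight_cell))))))"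

definition trial_com :: "nat \<Rightarrow> nat \<Rightarrow> nat \<Rightarrow> com" where
  "trial_com d k M = Seq (for_points d (Store weight_cell (OfIdx (NConst 1))))
     (seqs (\<lambda>j. Seq (center_com d M j) (update_com d j)) k)"

text \<open>The score \<open>1 / (1 + cost)\<close> lets the initial memory content \<open>0\<close> stand for the absence of a
  solution.\<close>

definition score :: rexp where
  "score = RDiv (OfIdx (NConst 1)) (RAdd (OfIdx (NConst 1)) (Load (scratch 0)))"

definition finish_com :: "nat \<Rightarrow> nat \<Rightarrow> com" where
  "finish_com d k = Cond (RLess (Load (scratch 2)) score)
     (Seq (Store (scratch 2) score)
          (store_block (3 + k * d) (k * d) (\<lambda>q. Load (scratch (3 + q))))) Skip"

text \<open>Register 2 reaches n * d by d additions of n.\<close>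

definition k_median_com :: "nat \<Rightarrow> nat \<Rightarrow> nat \<Rightarrow> nat \<Rightarrow> com" where
  "k_median_com d k M N =
     Seq (seqs (\<lambda>_. SetIdx 2 (NAdd (NReg 2) (NReg 0))) d)
    (Seq (SetIdx 3 (NAdd (NReg 2) (NReg 0)))
    (Seq (seqs (\<lambda>_. Seq (trial_com d k M) (finish_com d k)) N)
    (Seq (SetIdx 1 (scratch (3 + k * d))) (SetIdx 0 (NConst k)))))"

lemma scratch_simps [simp]: "nval (scratch q) s = idx s 3 + q" "ncost (scratch q) = 3"
  by (simp_all add: scratch_def)

lemma weight_cell_simps [simp]: "nval weight_cell s = idx s 2 + idx s 4" "ncost weight_cell = 3"
  by (simp_all add: weight_cell_def)

text \<open>Each expression is evaluated when other cells of the block may have changed but its own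
  target cell still has the old content; this permits accumulation and division in place.\<close>

lemma implements_store_block:
  assumes v: "\<And>l s'. l < m \<Longrightarrow> same_except {idx s 3 + q..<idx s 3 + q + m} {} s s' \<Longrightarrow>
      mem s' (idx s 3 + q + l) = mem s (idx s 3 + q + l) \<Longrightarrow> rval (e l) s' = v l"
    and c: "\<And>l. rcost (e l) \<le> c" and T: "1 + m * (4 + c) \<le> T"
  shows "implements d D (store_block q m e) s T (return_pmf ())
    (\<lambda>_ s'. same_except {idx s 3 + q..<idx s 3 + q + m} {} s s' \<and>
       (\<forall>l<m. mem s' (idx s 3 + q + l) = v l))"
proof -
  let ?A = "{idx s 3 + q..<idx s 3 + q + m}"
  define J where "J = (\<lambda>i s'. same_except ?A {} s s' \<and> (\<forall>l<i. mem s' (idx s 3 + q + l) = v l) \<and>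
     (\<forall>l. i \<le> l \<and> l < m \<longrightarrow> mem s' (idx s 3 + q + l) = mem s (idx s 3 + q + l)))"
  have "implements d D (store_block q m e) s (1 + m * (4 + c)) (return_pmf ()) (\<lambda>_. J m)"
    unfolding store_block_def
  proof (rule implements_seqs_return)
    fix i s' assume i: "i < m" "J i s'"
    then have s3: "idx s' 3 = idx s 3" by (auto simp: J_def same_except_def)
    have val: "rval (e i) s' = v i" using i by (intro v) (auto simp: J_def)
    show "implements d D (Store (scratch (q + i)) (e i)) s' (4 + c) (return_pmf ()) (\<lambda>_. J (Suc i))"
      using i c[of i] by (intro implements_Store) (auto simp: J_def s3 val less_Suc_eq)
  qed (auto simp: J_def)
  then show ?thesis using T by (rule implements_mono) (auto simp: J_def)
qed

lemma set_mem_triv: "mem s a = v \<Longrightarrow> set_mem a v s = s"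
  by (auto simp: set_mem_def)

section \<open>Correctness and running time of the program\<close>

locale machine =
  fixes d k M :: nat and D :: dissim and ps :: "point list"
  assumes ps_carrier: "set ps \<subseteq> carrier_vec d" and ps_nonempty: "ps \<noteq> []"
begin

abbreviation "n \<equiv> length ps"
definition weights_at :: nat where "weights_at = n * d"
definition scratch_at :: nat where "scratch_at = weights_at + n"

definition base :: "state \<Rightarrow> bool" where
  "base s \<longleftrightarrow> idx s 0 = n \<and> idx s 2 = weights_at \<and> idx s 3 = scratch_at \<and>
     (\<forall>i<n. \<forall>l<d. mem s (i * d + l) = vec_index (ps ! i) l)"

lemma coord_less: "i < n \<Longrightarrow> l < d \<Longrightarrow> i * d + l < weights_at"
proof -
  assume "i < n" "l < d"
  then have "i * d + l < Suc i * d" by simp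
  also have "\<dots> \<le> n * d" using \<open>i < n\<close> by (intro mult_le_mono1) simp
  finally show ?thesis by (simp add: weights_at_def)
qed

lemma base_idx: "base s \<Longrightarrow> idx s 0 = n" "base s \<Longrightarrow> idx s 2 = weights_at"
    "base s \<Longrightarrow> idx s 3 = scratch_at"
  by (simp_all add: base_def)

lemma base_mem: "base s \<Longrightarrow> i < n \<Longrightarrow> l < d \<Longrightarrow> mem s (i * d + l) = vec_index (ps ! i) l"
  by (simp add: base_def)

lemma base_point:
  assumes "base s" "i < n" shows "point_at d s (i * d) = ps ! i"
proof -
  have "ps ! i \<in> carrier_vec d" using assms(2) ps_carrier nth_mem by blast
  then show ?thesis using assms by (intro eq_vecI) (auto simp: point_at_def base_mem)
qed

lemma base_same:
  assumes "base s" "same_except A I s s'" "\<And>a. a \<in> A \<Longrightarrow> weights_at \<le> a" "I \<subseteq> {4..7}"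
  shows "base s'"
proof -
  have "mem s' (i * d + l) = mem s (i * d + l)" if "i < n" "l < d" for i l
    using coord_less[OF that] assms(3)[of "i * d + l"]
    by (intro same_except_mem[OF assms(2)]) auto
  moreover have "idx s' i = idx s i" if "i \<in> {0, 2, 3}" for i
    using that assms(2,4) by (auto simp: same_except_def)
  ultimately show ?thesis using assms(1) by (auto simp: base_def)
qed

lemma implements_draw:
  assumes s: "base s" and w: "\<And>i. i < n \<Longrightarrow> mem s (weights_at + i) = w i"
  shows "implements d D (draw_com d) s (39 * n + 15) (reservoir w n)
    (\<lambda>x s'. same_except {scratch_at} {4..7} s s' \<and> idx s' 7 = x * d)"
proof -
  define J where "J = (\<lambda>i x s'. same_except {scratch_at} {4..7} s s' \<and>
     mem s' scratch_at = (\<Sum>j<i. w j) \<and> idx s' 7 = x * d)"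
  define f where "f = (\<lambda>i x. map_pmf (\<lambda>h. if h then i else x) (bernoulli_pmf (w i / (\<Sum>j<Suc i. w j))))"
  let ?s = "set_idx 7 0 (set_mem scratch_at 0 s)"
  let ?body = "Seq (Store (scratch 0) (RAdd (Load (scratch 0)) (Load weight_cell)))
       (Seq (Flip 6 (RDiv (Load weight_cell) (Load (scratch 0))))
            (Cond (NLess (NConst 0) (NReg 6)) (SetIdx 7 (NReg 5)) Skip))"
  have loop: "implements d D (for_points d ?body) ?s (n * (28 + 11) + 7) (steps f n 0) (J n)"
  proof (rule implements_for_points)
    fix i x s' assume i: "i < n" and J: "J i x s'" and r: "idx s' 4 = i" "idx s' 5 = i * d" "idx s' 0 = n"
    have b: "base s'" using s J
      by (elim base_same[where A = "{scratch_at}" and I = "{4..7}"])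
        (auto simp: J_def scratch_at_def)
    have wi: "mem s' (weights_at + i) = w i"
      using J i w by (auto simp: J_def same_except_def scratch_at_def)
    define s1 where "s1 = set_mem scratch_at (\<Sum>j<Suc i. w j) s'"
    have J1: "same_except {scratch_at} {4..7} s s1" "mem s1 scratch_at = (\<Sum>j<Suc i. w j)"
        "idx s1 7 = x * d"
      using J by (auto simp: J_def s1_def)
    have q: "rval (RDiv (Load weight_cell) (Load (scratch 0))) s1 = w i / (\<Sum>j<Suc i. w j)"
      using i wi r base_idx[OF b] by (simp add: s1_def scratch_at_def)
    have 1: "implements d D (Flip 6 (RDiv (Load weight_cell) (Load (scratch 0)))) s1 10
        (bernoulli_pmf (w i / (\<Sum>j<Suc i. w j))) (\<lambda>h s2. s2 = set_idx 6 (of_bool h) s1)"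
      unfolding q[symmetric] by (rule implements_Flip) simp_all
    have 2: "implements d D (Seq (Flip 6 (RDiv (Load weight_cell) (Load (scratch 0))))
            (Cond (NLess (NConst 0) (NReg 6)) (SetIdx 7 (NReg 5)) Skip)) s1 15 (f i x)
        (\<lambda>a' s'. J (Suc i) a' s' \<and> idx s' 4 = i \<and> idx s' 5 = i * d \<and> idx s' 0 = n)"
      unfolding f_def map_pmf_def
    proof (rule implements_Seq[OF 1, where ?T2.0 = 5])
      fix h s2 assume "s2 = set_idx 6 (of_bool h) s1"
      then show "implements d D (Cond (NLess (NConst 0) (NReg 6)) (SetIdx 7 (NReg 5)) Skip) s2 5
          (return_pmf (if h then i else x))
          (\<lambda>a' s'. J (Suc i) a' s' \<and> idx s' 4 = i \<and> idx s' 5 = i * d \<and> idx s' 0 = n)"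
        using J1 r by (intro implements_Cond[where T = 2] implements_SetIdx implements_Skip)
          (auto simp: J_def s1_def)
    qed simp
    show "implements d D ?body s' 28 (f i x)
        (\<lambda>a' s'. J (Suc i) a' s' \<and> idx s' 4 = i \<and> idx s' 5 = i * d \<and> idx s' 0 = n)"
    proof (rule implements_Store_Seq[where ?T2.0 = 15])
      have "set_mem (nval (scratch 0) s') (rval (RAdd (Load (scratch 0)) (Load weight_cell)) s') s' = s1"
        using J wi r base_idx[OF b] by (simp add: s1_def J_def)
      with 2 show "implements d D (Seq (Flip 6 (RDiv (Load weight_cell) (Load (scratch 0))))
            (Cond (NLess (NConst 0) (NReg 6)) (SetIdx 7 (NReg 5)) Skip))
          (set_mem (nval (scratch 0) s') (rval (RAdd (Load (scratch 0)) (Load weight_cell)) s') s')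
          15 (f i x) (\<lambda>a' s'. J (Suc i) a' s' \<and> idx s' 4 = i \<and> idx s' 5 = i * d \<and> idx s' 0 = n)"
        by simp
    qed simp
  qed (use s in \<open>auto simp: J_def base_idx\<close>)
  have "steps f i 0 = reservoir w i" for i by (induction i) (simp_all add: f_def)
  with loop have loop': "implements d D (for_points d ?body) ?s (39 * n + 7) (reservoir w n) (J n)"
    by (simp add: mult.commute)
  show ?thesis
    unfolding draw_com_def
  proof (rule implements_Store_Seq[where ?T2.0 = "39 * n + 9"], rule implements_SetIdx_Seq[where ?T2.0 = "39 * n + 7"])
    show "implements d D (for_points d ?body)
        (set_idx 7 (nval (NConst 0) (set_mem (nval (scratch 0) s) (rval (OfIdx (NConst 0)) s) s))
          (set_mem (nval (scratch 0) s) (rval (OfIdx (NConst 0)) s) s)) (39 * n + 7) (reservoir w n)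
        (\<lambda>x s'. same_except {scratch_at} {4..7} s s' \<and> idx s' 7 = x * d)"
      using loop' base_idx[OF s] by (auto simp: J_def elim!: implements_mono)
  qed simp_all
qed

abbreviation "center_block j \<equiv> {scratch_at + (3 + j * d)..<scratch_at + (3 + j * d) + d}"

lemma implements_center:
  assumes s: "base s" and w: "\<And>i. i < n \<Longrightarrow> mem s (weights_at + i) = w i"
  shows "implements d D (center_com d M j) s (M * (39 * n + 13 * d + 16) + 17 * d + 3)
    (replicate_pmf M (reservoir w n))
    (\<lambda>xs s'. same_except (insert scratch_at (center_block j)) {4..7} s s' \<and>
       (\<forall>l<d. mem s' (scratch_at + (3 + j * d) + l) =
          vec_index (centroid d (mset (map ((!) ps) xs))) l))"
proof -
  let ?q = "3 + j * d" and ?A = "insert scratch_at (center_block j)"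
  have A: "weights_at \<le> a" if "a \<in> ?A" for a using that by (auto simp: scratch_at_def)
  have A': "weights_at + i \<notin> ?A" if "i < n" for i using that by (auto simp: scratch_at_def)
  let ?add = "store_block ?q d
            (\<lambda>l. RAdd (Load (scratch (?q + l))) (Load (NAdd (NReg 7) (NConst l))))"
  define Z where "Z = (\<lambda>s'. same_except (center_block j) {} s s' \<and>
     (\<forall>l<d. mem s' (scratch_at + ?q + l) = 0))"
  define J where "J = (\<lambda>i xs s'. same_except ?A {4..7} s s' \<and> length xs = i \<and>
     (\<forall>l<d. mem s' (scratch_at + ?q + l) = (\<Sum>x\<leftarrow>xs. vec_index (ps ! x) l)))"
  \<comment> \<open>The draws are listed latest first, which is harmless because a centroid depends
    on the multiset only.\<close>
  define f where "f = (\<lambda>(i::nat) xs. map_pmf (\<lambda>x. x # xs) (reservoir w n))"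
  have zero: "implements d D (store_block ?q d (\<lambda>_. OfIdx (NConst 0))) s (1 + d * 6)
      (return_pmf ()) (\<lambda>_. Z)"
    by (rule implements_mono[OF implements_store_block[where v = "\<lambda>_. 0" and c = 2 and T = "1 + d * 6"]])
      (auto simp: Z_def base_idx[OF s])
  have draws: "implements d D (seqs (\<lambda>_. Seq (draw_com d) ?add) M) s1
      (1 + M * (39 * n + 13 * d + 16)) (replicate_pmf M (reservoir w n)) (J M)" if "Z s1" for s1
  proof -
    have "implements d D (seqs (\<lambda>_. Seq (draw_com d) ?add) M) s1
      (1 + M * (39 * n + 13 * d + 16)) (steps f M []) (J M)"
    proof (rule implements_seqs)
      fix i xs s2 assume J: "J i xs s2"
      have b2: "base s2" using J A by (intro base_same[OF s, of ?A "{4..7}"]) (auto simp: J_def)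
      have w2: "mem s2 (weights_at + i) = w i" if "i < n" for i
        using J w[OF that] A'[OF that] by (auto simp: J_def same_except_def)
      show "implements d D (Seq (draw_com d) ?add) s2 (39 * n + 13 * d + 16) (f i xs) (J (Suc i))"
        unfolding f_def map_pmf_def
      proof (rule implements_Seq[OF implements_draw[OF b2 w2], where ?T2.0 = "1 + d * 13"])
        fix x s3
        assume x: "x \<in> set_pmf (reservoir w n)"
          and s3: "same_except {scratch_at} {4..7} s2 s3 \<and> idx s3 7 = x * d"
        have xn: "x < n" using set_reservoir[of n w] x ps_nonempty by auto
        have b3: "base s3" using s3
          by (intro base_same[OF b2, of "{scratch_at}" "{4..7}"]) (auto simp: scratch_at_def)
        have same3: "same_except ?A {4..7} s s3"
          by (rule same_except_trans[of ?A "{4..7}" s s2 "{scratch_at}" "{4..7}"])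
            (use J s3 in \<open>auto simp: J_def\<close>)
        have mem3: "mem s3 (scratch_at + ?q + l) = (\<Sum>x\<leftarrow>xs. vec_index (ps ! x) l)" if "l < d" for l
          using J s3 that by (auto simp: J_def same_except_def)
        have "implements d D ?add s3 (1 + d * 13) (return_pmf ())
          (\<lambda>_ s'. same_except {idx s3 3 + ?q..<idx s3 3 + ?q + d} {} s3 s' \<and>
            (\<forall>l<d. mem s' (idx s3 3 + ?q + l) = (\<Sum>x\<leftarrow>x # xs. vec_index (ps ! x) l)))"
        proof (rule implements_store_block[where c = 9])
          fix l s4 assume l: "l < d" and same: "same_except {idx s3 3 + ?q..<idx s3 3 + ?q + d} {} s3 s4"
            and old: "mem s4 (idx s3 3 + ?q + l) = mem s3 (idx s3 3 + ?q + l)"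
          have i3: "idx s4 3 = scratch_at" "idx s4 7 = x * d" "idx s3 3 = scratch_at"
            using same s3 base_idx(3)[OF b3] by (auto simp: same_except_def)
          have "base s4" using same by (intro base_same[OF b3, of "center_block j" "{}"])
            (auto simp: i3 scratch_at_def)
          then show "rval (RAdd (Load (scratch (?q + l))) (Load (NAdd (NReg 7) (NConst l)))) s4
            = (\<Sum>x\<leftarrow>x # xs. vec_index (ps ! x) l)"
            using i3 old mem3[OF l] base_mem[of s4 x l] xn l by (simp add: add.assoc)
        qed auto
        then have "implements d D ?add s3 (1 + d * 13) (return_pmf ()) (\<lambda>_. J (Suc i) (x # xs))"
        proof (rule implements_mono)
          fix s4 assume s4: "same_except {idx s3 3 + ?q..<idx s3 3 + ?q + d} {} s3 s4 \<and>
            (\<forall>l<d. mem s4 (idx s3 3 + ?q + l) = (\<Sum>x\<leftarrow>x # xs. vec_index (ps ! x) l))"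
          have "same_except ?A {4..7} s s4"
            by (rule same_except_trans[OF same3, of "center_block j" "{}" s4])
              (use s4 base_idx(3)[OF b3] in auto)
          then show "J (Suc i) (x # xs) s4"
            using s4 J base_idx(3)[OF b3] by (auto simp: J_def)
        qed simp
        then show "implements d D ?add s3 (1 + d * 13) (return_pmf (x # xs)) (J (Suc i))"
          using implements_map[where f = "\<lambda>_. x # xs" and \<mu> = "return_pmf ()"] by simp
      qed auto
    next
      show "J 0 [] s1"
        using that same_except_trans[of "center_block j" "{}" s s1 "{}" "{}" s1 ?A "{4..7}"]
        by (auto simp: J_def Z_def)
    qed
    moreover have "steps f m [] = replicate_pmf m (reservoir w n)" for m
      by (induction m) (simp_all add: f_def replicate_pmf_Suc_snoc del: replicate_pmf.simps(2))
    ultimately show ?thesis by simp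
  qed
  have avg: "implements d D (store_block ?q d (\<lambda>l. RDiv (Load (scratch (?q + l))) (OfIdx (NConst M)))) s2
      (1 + d * 11) (return_pmf xs)
      (\<lambda>xs s'. same_except ?A {4..7} s s' \<and> (\<forall>l<d. mem s' (scratch_at + ?q + l) =
          vec_index (centroid d (mset (map ((!) ps) xs))) l))" if J: "J M xs s2" for xs s2
  proof -
    have b2: "base s2" using J A by (intro base_same[OF s, of ?A "{4..7}"]) (auto simp: J_def)
    note i2 = base_idx(3)[OF b2]
    have "implements d D (store_block ?q d (\<lambda>l. RDiv (Load (scratch (?q + l))) (OfIdx (NConst M)))) s2
      (1 + d * 11) (return_pmf ()) (\<lambda>_ s'. same_except {idx s2 3 + ?q..<idx s2 3 + ?q + d} {} s2 s' \<and>
            (\<forall>l<d. mem s' (idx s2 3 + ?q + l) = vec_index (centroid d (mset (map ((!) ps) xs))) l))"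
    proof (rule implements_store_block[where c = 7])
      fix l s3 assume l: "l < d" and same: "same_except {idx s2 3 + ?q..<idx s2 3 + ?q + d} {} s2 s3"
        and old: "mem s3 (idx s2 3 + ?q + l) = mem s2 (idx s2 3 + ?q + l)"
      have i3: "idx s3 3 = scratch_at" using same i2 by (auto simp: same_except_def)
      have "mem s3 (scratch_at + ?q + l) = (\<Sum>x\<leftarrow>xs. vec_index (ps ! x) l)"
        using J old l i2 by (simp add: J_def)
      moreover have "(\<Sum>p\<in>#mset (map ((!) ps) xs). vec_index p l) = (\<Sum>x\<leftarrow>xs. vec_index (ps ! x) l)"
        by (simp add: sum_mset_sum_list[symmetric] image_mset.compositionality comp_def flip: mset_map)
      moreover have "length xs = M" using J by (simp add: J_def)
      ultimately show "rval (RDiv (Load (scratch (?q + l))) (OfIdx (NConst M))) s3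
          = vec_index (centroid d (mset (map ((!) ps) xs))) l"
        using i3 l by (simp add: centroid_def add.assoc del: mset_map)
    qed auto
    then have "implements d D (store_block ?q d (\<lambda>l. RDiv (Load (scratch (?q + l))) (OfIdx (NConst M)))) s2
      (1 + d * 11) (return_pmf ()) (\<lambda>_ s'. same_except ?A {4..7} s s' \<and> (\<forall>l<d. mem s' (scratch_at + ?q + l) =
          vec_index (centroid d (mset (map ((!) ps) xs))) l))"
    proof (rule implements_mono)
      fix s3 assume s3: "same_except {idx s2 3 + ?q..<idx s2 3 + ?q + d} {} s2 s3 \<and>
            (\<forall>l<d. mem s3 (idx s2 3 + ?q + l) = vec_index (centroid d (mset (map ((!) ps) xs))) l)"
      have "same_except ?A {4..7} s s3"
        by (rule same_except_trans[of ?A "{4..7}" s s2 "center_block j" "{}" s3])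
          (use s3 J i2 in \<open>auto simp: J_def\<close>)
      then show "same_except ?A {4..7} s s3 \<and> (\<forall>l<d. mem s3 (scratch_at + ?q + l) =
          vec_index (centroid d (mset (map ((!) ps) xs))) l)" using s3 i2 by simp
    qed simp
    then show ?thesis
      using implements_map[where f = "\<lambda>_. xs" and \<mu> = "return_pmf ()"] by simp
  qed
  show ?thesis
    unfolding center_com_def
  proof (rule implements_Seq_return[OF zero, where ?T2.0 = "(1 + M * (39 * n + 13 * d + 16)) + (1 + d * 11)"])
    fix s1 assume "Z s1"
    then have "implements d D (Seq (seqs (\<lambda>_. Seq (draw_com d) ?add) M)
        (store_block ?q d (\<lambda>l. RDiv (Load (scratch (?q + l))) (OfIdx (NConst M))))) s1
        ((1 + M * (39 * n + 13 * d + 16)) + (1 + d * 11))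
        (bind_pmf (replicate_pmf M (reservoir w n)) return_pmf)
        (\<lambda>xs s'. same_except ?A {4..7} s s' \<and> (\<forall>l<d. mem s' (scratch_at + ?q + l) =
          vec_index (centroid d (mset (map ((!) ps) xs))) l))"
      by (intro implements_Seq[OF draws avg]) auto
    then show "implements d D (Seq (seqs (\<lambda>_. Seq (draw_com d) ?add) M)
        (store_block ?q d (\<lambda>l. RDiv (Load (scratch (?q + l))) (OfIdx (NConst M))))) s1
        ((1 + M * (39 * n + 13 * d + 16)) + (1 + d * 11)) (replicate_pmf M (reservoir w n))
        (\<lambda>xs s'. same_except ?A {4..7} s s' \<and> (\<forall>l<d. mem s' (scratch_at + ?q + l) =
          vec_index (centroid d (mset (map ((!) ps) xs))) l))"
      by (simp add: bind_return_pmf')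
  qed simp
qed

abbreviation "weights_block \<equiv> {weights_at..<scratch_at}"

lemma implements_update:
  assumes s: "base s" and w: "\<And>i. i < n \<Longrightarrow> mem s (weights_at + i) = weight D cs (ps ! i)"
    and len: "length cs = j" and c: "point_at d s (scratch_at + (3 + j * d)) = c"
  shows "implements d D (update_com d j) s (n * (d + 49) + 13) (return_pmf ())
    (\<lambda>_ s'. same_except ({scratch_at, scratch_at + 1} \<union> weights_block) {4..7} s s' \<and>
       (\<forall>i<n. mem s' (weights_at + i) = weight D (cs @ [c]) (ps ! i)) \<and>
       mem s' scratch_at = (\<Sum>i<n. weight D (cs @ [c]) (ps ! i)))"
proof -
  let ?A = "{scratch_at, scratch_at + 1} \<union> weights_block"
  have A: "weights_at \<le> a" if "a \<in> ?A" for a using that by (auto simp: scratch_at_def)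
  define u where "u i = weight D (cs @ [c]) (ps ! i)" for i
  define v where "v i = weight D cs (ps ! i)" for i
  define J where "J = (\<lambda>i (_::unit) s'. same_except ?A {4..7} s s' \<and>
     (\<forall>m<i. mem s' (weights_at + m) = u m) \<and>
     (\<forall>m. i \<le> m \<and> m < n \<longrightarrow> mem s' (weights_at + m) = v m) \<and>
     mem s' scratch_at = (\<Sum>m<i. u m))"
  let ?upd = "if j = 0 then Store weight_cell (Load (scratch 1))
             else Cond (RLess (Load (scratch 1)) (Load weight_cell))
                    (Store weight_cell (Load (scratch 1))) Skip"
  let ?body = "Seq (Dissim (scratch 1) (NReg 5) (scratch (3 + j * d)))
       (Seq ?upd (Store (scratch 0) (RAdd (Load (scratch 0)) (Load weight_cell))))"
  have loop: "implements d D (for_points d ?body) (set_mem scratch_at 0 s)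
      (n * ((d + 38) + 11) + 7) (steps (\<lambda>_. return_pmf) n ()) (J n)"
  proof (rule implements_for_points)
    fix i a s' assume i: "i < n" and J: "J i a s'"
      and r: "idx s' 4 = i" "idx s' 5 = i * d" "idx s' 0 = n"
    let ?post = "\<lambda>a' s'. J (Suc i) a' s' \<and> idx s' 4 = i \<and> idx s' 5 = i * d \<and> idx s' 0 = n"
    have b: "base s'" using J A by (intro base_same[OF s, of ?A "{4..7}"]) (auto simp: J_def)
    have c': "point_at d s' (scratch_at + (3 + j * d)) = c"
      unfolding c[symmetric] point_at_def using J
      by (intro eq_vecI) (auto simp: J_def same_except_def)
    define s1 where "s1 = set_mem (scratch_at + 1) (D (ps ! i) c) s'"
    define s2 where "s2 = set_mem (weights_at + i) (u i) s1"
    have i1: "idx s1 3 = scratch_at" "idx s1 2 = weights_at" "idx s1 4 = i"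
      using base_idx[OF b] r by (auto simp: s1_def)
    have m1: "mem s1 (scratch_at + 1) = D (ps ! i) c" "mem s1 (weights_at + i) = v i"
      using J i by (auto simp: s1_def J_def scratch_at_def)
    have upd: "implements d D ?upd s1 17 (return_pmf ()) (\<lambda>_ s'. s' = s2)"
    proof (cases "j = 0")
      case True
      then have "u i = D (ps ! i) c" using len by (simp add: u_def weight_def)
      then show ?thesis using True i1 m1 by (auto intro!: implements_Store simp: s2_def)
    next
      case False
      then have u: "u i = min (v i) (D (ps ! i) c)" using len by (auto simp: u_def v_def weight_append)
      \<comment> \<open>If the comparison fails, the old weight is already the minimum, so skipping
        reaches the same state as storing it.\<close>
      have "s1 = s2" if "\<not> D (ps ! i) c < v i"
        using that u m1 by (simp add: s2_def set_mem_triv min_def)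
      then show ?thesis using False i1 m1 u
        by (auto intro!: implements_Cond[where T = 8] implements_Store implements_Skip simp: s2_def min_def)
    qed
    have fin: "implements d D (Store (scratch 0) (RAdd (Load (scratch 0)) (Load weight_cell))) s2 13
        (return_pmf a) ?post"
    proof (rule implements_Store)
      have ne: "weights_at + i \<noteq> scratch_at" "weights_at + i \<in> ?A" using i by (auto simp: scratch_at_def)
      have v2: "set_mem (nval (scratch 0) s2) (rval (RAdd (Load (scratch 0)) (Load weight_cell)) s2) s2
          = set_mem scratch_at (\<Sum>m<Suc i. u m) s2"
        using J i1 ne by (simp add: s2_def s1_def J_def)
      have other: "weights_at + m \<noteq> scratch_at" "weights_at + m \<noteq> scratch_at + 1" if "m < n" for m
        using that by (auto simp: scratch_at_def)
      show "?post a (set_mem (nval (scratch 0) s2)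
          (rval (RAdd (Load (scratch 0)) (Load weight_cell)) s2) s2)"
        unfolding v2 using J r i ne other
        by (auto simp: J_def s1_def s2_def less_Suc_eq)
    qed simp
    have "implements d D (Seq ?upd (Store (scratch 0) (RAdd (Load (scratch 0)) (Load weight_cell)))) s1 30
        (return_pmf a) ?post"
      by (rule implements_Seq_return[OF upd, where ?T2.0 = 13]) (use fin in auto)
    moreover have "set_mem (nval (scratch 1) s') (D (point_at d s' (nval (NReg 5) s'))
        (point_at d s' (nval (scratch (3 + j * d)) s'))) s' = s1"
      using base_idx[OF b] base_point[OF b i] c' r by (simp add: s1_def)
    ultimately show "implements d D ?body s' (d + 38) (return_pmf a) ?post"
      by (intro implements_Dissim_Seq[where ?T2.0 = 30]) simp_all
  next
    show "J 0 () (set_mem scratch_at 0 s)" using w by (auto simp: J_def v_def scratch_at_def)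
  qed (use s in \<open>auto simp: base_idx J_def\<close>)
  show ?thesis
    unfolding update_com_def
    by (rule implements_Store_Seq[where ?T2.0 = "n * ((d + 38) + 11) + 7"])
      (use loop base_idx[OF s] in \<open>auto simp: steps_return J_def u_def elim!: implements_mono\<close>)
qed

definition centers :: "nat \<Rightarrow> point list \<Rightarrow> state \<Rightarrow> bool" where
  "centers q cs s \<longleftrightarrow> (\<forall>j<length cs. \<forall>l<d. mem s (scratch_at + (q + j * d) + l) = vec_index (cs ! j) l)"

abbreviation "trial_block \<equiv>
  {scratch_at, scratch_at + 1} \<union> weights_block \<union> {scratch_at + 3..<scratch_at + 3 + k * d}"

definition stage_inv :: "state \<Rightarrow> nat \<Rightarrow> point list \<Rightarrow> state \<Rightarrow> bool" where
  "stage_inv s0 j cs s \<longleftrightarrow> same_except trial_block {4..7} s0 s \<and> length cs = j \<and> centers 3 cs s \<and>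
     (\<forall>i<n. mem s (weights_at + i) = weight D cs (ps ! i)) \<and>
     (cs \<noteq> [] \<longrightarrow> mem s scratch_at = (\<Sum>i<n. weight D cs (ps ! i)))"

definition stage_time :: nat where
  "stage_time = (M * (39 * n + 13 * d + 16) + 17 * d + 3) + (n * (d + 49) + 13)"

lemma block_sub: "j < k \<Longrightarrow> center_block j \<subseteq> {scratch_at + 3..<scratch_at + 3 + k * d}"
proof -
  assume "j < k"
  then have "Suc j * d \<le> k * d" by (intro mult_le_mono1) simp
  then show ?thesis by auto
qed

lemma earlier_block:
  assumes "j' < j" "l < d" shows "scratch_at + (3 + j' * d) + l \<notin> center_block j"
proof -
  have "Suc j' * d \<le> j * d" using assms by (intro mult_le_mono1) simp
  then show ?thesis using assms by auto
qed

lemma implements_stage: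
  assumes s0: "base s0" and j: "j < k" and inv: "stage_inv s0 j cs s"
  shows "implements d D (Seq (center_com d M j) (update_com d j)) s stage_time
    (map_pmf (extend d ps cs) (replicate_pmf M (draw D ps cs))) (stage_inv s0 (Suc j))"
proof -
  have tb: "weights_at \<le> a" if "a \<in> trial_block" for a using that by (auto simp: scratch_at_def)
  have s: "base s" using inv tb by (intro base_same[OF s0, of trial_block "{4..7}"]) (auto simp: stage_inv_def)
  have w: "\<And>i. i < n \<Longrightarrow> mem s (weights_at + i) = weight D cs (ps ! i)"
    and len: "length cs = j" using inv by (auto simp: stage_inv_def)
  let ?c = "\<lambda>xs. centroid d (mset (map ((!) ps) xs))"
  show ?thesis
    unfolding draw_def stage_time_def map_pmf_def
  proof (rule implements_Seq[OF implements_center[OF s w]])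
    fix xs s1
    assume s1: "same_except (insert scratch_at (center_block j)) {4..7} s s1 \<and>
       (\<forall>l<d. mem s1 (scratch_at + (3 + j * d) + l) = vec_index (?c xs) l)"
    have b1: "base s1" using s1
      by (intro base_same[OF s, of "insert scratch_at (center_block j)" "{4..7}"]) (auto simp: scratch_at_def)
    have w1: "mem s1 (weights_at + i) = weight D cs (ps ! i)" if "i < n" for i
      using s1 w[OF that] that by (auto simp: same_except_def scratch_at_def)
    have c1: "point_at d s1 (scratch_at + (3 + j * d)) = ?c xs"
      using s1 by (intro eq_vecI) (auto simp: point_at_def centroid_def)
    have "implements d D (update_com d j) s1 (n * (d + 49) + 13) (return_pmf ())
       (\<lambda>_. stage_inv s0 (Suc j) (extend d ps cs xs))"
    proof (rule implements_mono[OF implements_update[OF b1 w1 len c1]])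
      fix s2
      assume s2: "same_except ({scratch_at, scratch_at + 1} \<union> weights_block) {4..7} s1 s2 \<and>
       (\<forall>i<n. mem s2 (weights_at + i) = weight D (cs @ [?c xs]) (ps ! i)) \<and>
       mem s2 scratch_at = (\<Sum>i<n. weight D (cs @ [?c xs]) (ps ! i))"
      have "same_except trial_block {4..7} s0 s1"
        by (rule same_except_trans[of trial_block "{4..7}" s0 s "insert scratch_at (center_block j)" "{4..7}"])
          (use inv s1 block_sub[OF j] in \<open>auto simp: stage_inv_def\<close>)
      then have same: "same_except trial_block {4..7} s0 s2"
        by (rule same_except_trans[where J = "{4..7}"]) (use s2 in auto)
      have untouched: "mem s2 (scratch_at + (3 + j' * d) + l) = mem s1 (scratch_at + (3 + j' * d) + l)" for j' l
        using s2 by (auto simp: same_except_def)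
      have "mem s2 (scratch_at + (3 + j' * d) + l) = vec_index ((cs @ [?c xs]) ! j') l"
        if "j' < Suc j" "l < d" for j' l
      proof (cases "j' = j")
        case True
        then show ?thesis unfolding untouched using s1 that len by (simp add: nth_append)
      next
        case False
        then have j': "j' < j" using that by simp
        have "mem s1 (scratch_at + (3 + j' * d) + l) = mem s (scratch_at + (3 + j' * d) + l)"
          using s1 earlier_block[OF j' that(2)] by (intro same_except_mem) auto
        also have "\<dots> = vec_index (cs ! j') l"
          using inv j' that(2) by (simp add: stage_inv_def centers_def)
        finally show ?thesis unfolding untouched using j' len by (simp add: nth_append)
      qed
      then show "stage_inv s0 (Suc j) (extend d ps cs xs) s2"
        using same s2 len by (auto simp: stage_inv_def centers_def extend_def simp del: mset_map)
    qed simp_all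
    then show "implements d D (update_com d j) s1 (n * (d + 49) + 13)
        (return_pmf (extend d ps cs xs)) (stage_inv s0 (Suc j))"
      using implements_map[where f = "\<lambda>_. extend d ps cs xs" and \<mu> = "return_pmf ()"] by simp
  qed simp_all
qed

definition trial_time :: nat where
  "trial_time = (n * 17 + 7) + (1 + k * stage_time)"

lemma implements_trial:
  assumes s: "base s"
  shows "implements d D (trial_com d k M) s trial_time (trial d D ps M k) (stage_inv s k)"
proof -
  define J where "J = (\<lambda>i (_::unit) s'. same_except weights_block {4..7} s s' \<and>
     (\<forall>m<i. mem s' (weights_at + m) = 1))"
  have "implements d D (for_points d (Store weight_cell (OfIdx (NConst 1)))) s
      (n * (6 + 11) + 7) (steps (\<lambda>_. return_pmf) n ()) (J n)"
  proof (rule implements_for_points)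
    fix i a s' assume i: "i < n" and J: "J i a s'"
      and r: "idx s' 4 = i" "idx s' 5 = i * d" "idx s' 0 = n"
    have "idx s' 2 = weights_at" using J base_idx(2)[OF s] by (auto simp: J_def same_except_def)
    then show "implements d D (Store weight_cell (OfIdx (NConst 1))) s' 6 (return_pmf a)
        (\<lambda>a' s'. J (Suc i) a' s' \<and> idx s' 4 = i \<and> idx s' 5 = i * d \<and> idx s' 0 = n)"
      using i J r by (intro implements_Store) (auto simp: J_def scratch_at_def less_Suc_eq)
  qed (use s in \<open>auto simp: base_idx J_def\<close>)
  then have init: "implements d D (for_points d (Store weight_cell (OfIdx (NConst 1)))) s
      (n * 17 + 7) (return_pmf ()) (\<lambda>_. stage_inv s 0 [])"
  proof (unfold steps_return, elim implements_mono)
    fix a :: unit and s' assume J: "J n a s'"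
    have "same_except trial_block {4..7} s s'"
      by (rule same_except_trans[of weights_block "{4..7}" s s' "{}" "{}" s'])
        (use J in \<open>auto simp: J_def\<close>)
    then show "stage_inv s 0 [] s'" using J by (auto simp: stage_inv_def J_def centers_def weight_def)
  qed simp
  define f where "f = (\<lambda>(j::nat) cs. map_pmf (extend d ps cs) (replicate_pmf M (draw D ps cs)))"
  have "steps f j [] = trial d D ps M j" for j by (induction j) (simp_all add: f_def)
  then have stages: "implements d D (seqs (\<lambda>j. Seq (center_com d M j) (update_com d j)) k) s'
      (1 + k * stage_time) (trial d D ps M k) (stage_inv s k)" if "stage_inv s 0 [] s'" for s'
    using implements_seqs[of k "stage_inv s" d D "\<lambda>j. Seq (center_com d M j) (update_com d j)" stage_time f "[]" s']
      that implements_stage[OF s] unfolding f_def by metis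
  show ?thesis
    unfolding trial_com_def trial_time_def
    by (rule implements_Seq_return[OF init stages]) auto
qed

definition cost :: "point list \<Rightarrow> real" where
  "cost cs = (\<Sum>i<n. weight D cs (ps ! i))"

text \<open>Nonnegativity of the cost is recorded because only there 1 / (1 + cost) is positive and
  strictly decreasing; so score 0 is free to encode \<open>None\<close>, and comparing scores
  compares costs.\<close>

definition best_inv :: "point list option \<Rightarrow> state \<Rightarrow> bool" where
  "best_inv b s \<longleftrightarrow> base s \<and> (case b of None \<Rightarrow> mem s (scratch_at + 2) = 0
     | Some cs \<Rightarrow> length cs = k \<and> 0 \<le> cost cs \<and> mem s (scratch_at + 2) = 1 / (1 + cost cs) \<and>
         centers (3 + k * d) cs s)"

definition search_time :: nat where
  "search_time = trial_time + (15 + (14 + (1 + k * d * 8)))"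

lemma implements_finish:
  assumes k: "1 \<le> k" and b: "best_inv b s" and inv: "stage_inv s k cs s1" and cost: "0 \<le> cost cs"
  shows "implements d D (finish_com d k) s1 (15 + (14 + (1 + k * d * 8)))
    (return_pmf (improve cost b cs)) best_inv"
proof -
  have s: "base s" using b by (simp add: best_inv_def)
  have tb: "weights_at \<le> a" if "a \<in> trial_block" for a using that by (auto simp: scratch_at_def)
  have s1: "base s1" using inv tb by (intro base_same[OF s, of trial_block "{4..7}"]) (auto simp: stage_inv_def)
  note i1 = base_idx[OF s1]
  have len: "length cs = k" using inv by (simp add: stage_inv_def)
  then have "cs \<noteq> []" using k by auto
  then have acc: "mem s1 scratch_at = cost cs" using inv by (simp add: stage_inv_def cost_def)
  have best: "mem s1 (scratch_at + 2) = mem s (scratch_at + 2)"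
    using inv by (auto simp: stage_inv_def same_except_def scratch_at_def)
  let ?b = "case b of None \<Rightarrow> 0 | Some cs \<Rightarrow> 1 / (1 + cost cs)"
  have cond: "cval (RLess (Load (scratch 2)) score) s1 \<longleftrightarrow> ?b < 1 / (1 + cost cs)"
    using b best acc i1 by (auto simp: score_def best_inv_def split: option.splits)
  show ?thesis
    unfolding finish_com_def
  proof (rule implements_Cond[where T = "14 + (1 + k * d * 8)"])
    assume "cval (RLess (Load (scratch 2)) score) s1"
    then have less: "?b < 1 / (1 + cost cs)" using cond by simp
    have imp: "improve cost b cs = Some cs"
    proof (cases b)
      case (Some y)
      then have "0 \<le> cost y" using b by (simp add: best_inv_def)
      then have "cost cs < cost y" using less Some cost by (simp add: field_simps)
      then show ?thesis using Some by (simp add: improve_def)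
    qed (simp add: improve_def)
    let ?q = "3 + k * d"
    let ?s2 = "set_mem (scratch_at + 2) (1 / (1 + cost cs)) s1"
    let ?copy = "store_block ?q (k * d) (\<lambda>q. Load (scratch (3 + q)))"
    have "implements d D ?copy ?s2 (1 + k * d * 8) (return_pmf ())
      (\<lambda>_ s'. same_except {idx ?s2 3 + ?q..<idx ?s2 3 + ?q + k * d} {} ?s2 s' \<and>
         (\<forall>l<k * d. mem s' (idx ?s2 3 + ?q + l) = mem s1 (scratch_at + 3 + l)))"
    proof (rule implements_store_block[where c = 4])
      fix l s' assume "l < k * d" "same_except {idx ?s2 3 + ?q..<idx ?s2 3 + ?q + k * d} {} ?s2 s'"
      then show "rval (Load (scratch (3 + l))) s' = mem s1 (scratch_at + 3 + l)"
        using i1 by (auto simp: same_except_def add.assoc)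
    qed auto
    then have "implements d D ?copy ?s2 (1 + k * d * 8) (return_pmf ()) (\<lambda>_. best_inv (Some cs))"
    proof (rule implements_mono)
      fix s3 assume "same_except {idx ?s2 3 + ?q..<idx ?s2 3 + ?q + k * d} {} ?s2 s3 \<and>
         (\<forall>l<k * d. mem s3 (idx ?s2 3 + ?q + l) = mem s1 (scratch_at + 3 + l))"
      then have same: "same_except {scratch_at + ?q..<scratch_at + ?q + k * d} {} ?s2 s3"
        and copy: "\<And>l. l < k * d \<Longrightarrow> mem s3 (scratch_at + ?q + l) = mem s1 (scratch_at + 3 + l)"
        using i1 by auto
      have "base ?s2" by (rule base_same[OF s1, of "{scratch_at + 2}" "{}"]) (auto simp: scratch_at_def)
      then have "base s3"
        by (rule base_same[OF _ same]) (auto simp: scratch_at_def)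
      moreover have "mem s3 (scratch_at + 2) = 1 / (1 + cost cs)"
        using same by (auto simp: same_except_def)
      moreover have "mem s3 (scratch_at + (?q + j * d) + l) = vec_index (cs ! j) l"
        if "j < k" "l < d" for j l
      proof -
        have "j * d + l < Suc j * d" using that by simp
        also have "\<dots> \<le> k * d" using that by (intro mult_le_mono1) simp
        finally have "mem s3 (scratch_at + ?q + (j * d + l)) = mem s1 (scratch_at + 3 + (j * d + l))"
          by (rule copy)
        moreover have "mem s1 (scratch_at + (3 + j * d) + l) = vec_index (cs ! j) l"
          using inv that by (simp add: stage_inv_def centers_def)
        ultimately show ?thesis by (simp add: add.assoc)
      qed
      ultimately show "best_inv (Some cs) s3"
        using len cost by (simp add: best_inv_def centers_def)
    qed simp
    then have copy: "implements d D ?copy ?s2 (1 + k * d * 8) (return_pmf (Some cs)) best_inv"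
      using implements_map[where f = "\<lambda>_. Some cs" and \<mu> = "return_pmf ()"] by simp
    have st: "set_mem (nval (scratch 2) s1) (rval score s1) s1 = ?s2"
      using i1 acc by (simp add: score_def)
    show "implements d D (Seq (Store (scratch 2) score) ?copy) s1 (14 + (1 + k * d * 8))
        (return_pmf (improve cost b cs)) best_inv"
      unfolding imp
      by (rule implements_Store_Seq[where ?T2.0 = "1 + k * d * 8"]) (unfold st, rule copy, simp add: score_def)
  next
    assume "\<not> cval (RLess (Load (scratch 2)) score) s1"
    then have nless: "\<not> ?b < 1 / (1 + cost cs)" using cond by simp
    then obtain y where y: "b = Some y" using cost by (cases b) auto
    then have "0 \<le> cost y" using b by (simp add: best_inv_def)
    then have "\<not> cost cs < cost y" using nless y cost by (simp add: field_simps)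
    then have imp: "improve cost b cs = b" using y by (simp add: improve_def)
    \<comment> \<open>The best centres are stored behind everything a trial may write.\<close>
    have "mem s1 (scratch_at + (3 + k * d + j * d) + l) = mem s (scratch_at + (3 + k * d + j * d) + l)" for j l
      using inv by (auto simp: stage_inv_def same_except_def scratch_at_def)
    then have "best_inv b s1" using b s1 best y by (auto simp: best_inv_def centers_def)
    then show "implements d D Skip s1 (14 + (1 + k * d * 8)) (return_pmf (improve cost b cs)) best_inv"
      unfolding imp by (intro implements_Skip) auto
  qed (simp add: score_def)
qed

lemma implements_search:
  assumes k: "1 \<le> k" and b: "best_inv None s"
    and cost: "\<And>cs. cs \<in> set_pmf (trial d D ps M k) \<Longrightarrow> 0 \<le> cost cs"
  shows "implements d D (seqs (\<lambda>_. Seq (trial_com d k M) (finish_com d k)) N) s (1 + N * search_time)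
    (best_of cost (trial d D ps M k) N) best_inv"
proof -
  define f where "f = (\<lambda>(_::nat) b. map_pmf (improve cost b) (trial d D ps M k))"
  have "implements d D (seqs (\<lambda>_. Seq (trial_com d k M) (finish_com d k)) N) s (1 + N * search_time)
    (steps f N None) best_inv"
  proof (rule implements_seqs[where J = "\<lambda>_. best_inv"])
    fix b s' assume inv: "best_inv b s'"
    then have "base s'" by (simp add: best_inv_def)
    from implements_trial[OF this]
    show "implements d D (Seq (trial_com d k M) (finish_com d k)) s' search_time (f i b) best_inv" for i
      unfolding f_def map_pmf_def search_time_def
      by (rule implements_Seq) (use implements_finish[OF k inv] cost in auto)
  qed (rule b)
  moreover have "steps f m None = best_of cost (trial d D ps M k) m" for m
    by (induction m) (simp_all add: f_def)
  ultimately show ?thesis by simp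
qed

text \<open>Memory holds just d coordinates per centre, so a centre is recovered from it only if its
  dimension is d; hence the carrier condition.\<close>

lemma implements_k_median:
  assumes k: "1 \<le> k"
    and cost: "\<And>cs. cs \<in> set_pmf (trial d D ps M k) \<Longrightarrow> 0 \<le> cost cs"
  shows "implements d D (k_median_com d k M N) (input_state d ps) (16 + d * 4 + N * search_time)
    (best_of cost (trial d D ps M k) N)
    (\<lambda>b s. \<forall>cs. b = Some cs \<and> set cs \<subseteq> carrier_vec d \<longrightarrow> output_set d s = set cs)"
proof -
  let ?s = "input_state d ps"
  define J where "J = (\<lambda>i s. s = set_idx 2 (i * n) ?s)"
  have i0: "idx ?s 0 = n" "idx ?s 2 = 0" by (simp_all add: input_state_def)
  have 1: "implements d D (seqs (\<lambda>_. SetIdx 2 (NAdd (NReg 2) (NReg 0))) d) ?s (1 + d * 4)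
      (return_pmf ()) (\<lambda>_. J d)"
  proof (rule implements_seqs_return[where T = 4])
    fix i s' assume "J i s'"
    then show "implements d D (SetIdx 2 (NAdd (NReg 2) (NReg 0))) s' 4 (return_pmf ()) (\<lambda>_. J (Suc i))"
      by (intro implements_SetIdx) (auto simp: J_def i0 set_idx_def add.commute)
  qed (auto simp: J_def i0 set_idx_def input_state_def)
  define s2 where "s2 = set_idx 3 scratch_at (set_idx 2 weights_at ?s)"
  have mem_in: "mem s2 a = (if a < n * d then vec_index (ps ! (a div d)) (a mod d) else 0)" for a
    by (simp add: s2_def input_state_def)
  have "base s2"
  proof -
    have "mem s2 (i * d + l) = vec_index (ps ! i) l" if "i < n" "l < d" for i l
      using coord_less[OF that] that unfolding mem_in by (auto simp: weights_at_def)
    moreover have "idx s2 0 = n \<and> idx s2 2 = weights_at \<and> idx s2 3 = scratch_at"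
      by (simp add: s2_def i0)
    ultimately show ?thesis by (simp add: base_def)
  qed
  \<comment> \<open>The score cell lies behind the input, so its initial content 0 represents
    \<open>None\<close>.\<close>
  moreover have "mem s2 (scratch_at + 2) = 0" unfolding mem_in by (simp add: scratch_at_def weights_at_def)
  ultimately have start: "best_inv None s2" by (simp add: best_inv_def)
  let ?post = "\<lambda>b s. \<forall>cs. b = Some cs \<and> set cs \<subseteq> carrier_vec d \<longrightarrow> output_set d s = set cs"
  let ?out = "Seq (SetIdx 1 (scratch (3 + k * d))) (SetIdx 0 (NConst k))"
  have out: "implements d D ?out s 6 (return_pmf b) ?post" if inv: "best_inv b s" for b s
  proof (rule implements_SetIdx_Seq[where ?T2.0 = 2])
    let ?s1 = "set_idx 1 (nval (scratch (3 + k * d)) s) s"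
    have b: "base s" using inv by (simp add: best_inv_def)
    have "output_set d (set_idx 0 k ?s1) = set cs" if "b = Some cs" "set cs \<subseteq> carrier_vec d" for cs
    proof -
      have cs: "length cs = k" "centers (3 + k * d) cs s" using inv that by (auto simp: best_inv_def)
      have "point_at d (set_idx 0 k ?s1) (scratch_at + (3 + k * d) + j * d) = cs ! j" if "j < k" for j
      proof (rule eq_vecI)
        have "cs ! j \<in> carrier_vec d" using \<open>set cs \<subseteq> carrier_vec d\<close> cs that nth_mem by blast
        then show "dim_vec (point_at d (set_idx 0 k ?s1) (scratch_at + (3 + k * d) + j * d)) = dim_vec (cs ! j)"
          by (simp add: point_at_def)
        fix l assume "l < dim_vec (cs ! j)"
        then have "l < d" using \<open>cs ! j \<in> carrier_vec d\<close> by simp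
        then show "vec_index (point_at d (set_idx 0 k ?s1) (scratch_at + (3 + k * d) + j * d)) l
            = vec_index (cs ! j) l"
          using cs that by (simp add: point_at_def centers_def add.assoc)
      qed
      then have "output_set d (set_idx 0 k ?s1) = (\<lambda>j. cs ! j) ` {..<k}"
        unfolding output_set_def using base_idx(3)[OF b] by (intro image_cong) (simp_all add: add.assoc)
      also have "\<dots> = set cs" using cs(1) by (auto simp: set_conv_nth)
      finally show ?thesis .
    qed
    then show "implements d D (SetIdx 0 (NConst k)) ?s1 2 (return_pmf b) ?post"
      by (intro implements_SetIdx) auto
  qed simp
  have search: "implements d D (Seq (seqs (\<lambda>_. Seq (trial_com d k M) (finish_com d k)) N) ?out) s2
      ((1 + N * search_time) + 6) (best_of cost (trial d D ps M k) N) ?post"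
  proof -
    have "implements d D (Seq (seqs (\<lambda>_. Seq (trial_com d k M) (finish_com d k)) N) ?out) s2
      ((1 + N * search_time) + 6) (bind_pmf (best_of cost (trial d D ps M k) N) return_pmf) ?post"
      by (rule implements_Seq[OF implements_search[OF k start cost] out]) simp_all
    then show ?thesis by (simp only: bind_return_pmf')
  qed
  show ?thesis
    unfolding k_median_com_def
  proof (rule implements_Seq_return[OF 1, where ?T2.0 = "4 + ((1 + N * search_time) + 6)"])
    fix s' assume "J d s'"
    then have "set_idx 3 (nval (NAdd (NReg 2) (NReg 0)) s') s' = s2"
      by (simp add: J_def s2_def weights_at_def scratch_at_def i0 mult.commute)
    with search show "implements d D (Seq (SetIdx 3 (NAdd (NReg 2) (NReg 0)))
        (Seq (seqs (\<lambda>_. Seq (trial_com d k M) (finish_com d k)) N) ?out)) s'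
        (4 + ((1 + N * search_time) + 6)) (best_of cost (trial d D ps M k) N) ?post"
      by (intro implements_SetIdx_Seq[where ?T2.0 = "(1 + N * search_time) + 6"]) simp_all
  qed simp
qed

end

section \<open>Running time and conclusion\<close>

lemma best_of_cong:
  assumes "\<And>x. x \<in> set_pmf p \<Longrightarrow> cost x = cost' x"
  shows "best_of cost p n = best_of cost' p n"
proof (induction n)
  case (Suc n)
  have "map_pmf (improve cost b) p = map_pmf (improve cost' b) p" if "b \<in> set_pmf (best_of cost' p n)" for b
    using set_best_of[OF that] assms
    by (intro map_pmf_cong) (auto simp: improve_def split: option.splits)
  then show ?case unfolding best_of.simps Suc by (intro bind_pmf_cong refl) simp
qed simp

section \<open>Degenerate dissimilarities\<close>

context dissim_space
begin

lemma opt_cost_nonneg: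
  assumes "P \<subseteq> X" "X \<noteq> {}" "1 \<le> k" shows "0 \<le> opt_cost D X k P"
proof -
  obtain x where "x \<in> X" using assms(2) by auto
  then have "{x} \<in> medians X k" using assms(3) by (auto simp: medians_def)
  then show ?thesis
    unfolding opt_cost_def using assms(1) by (intro cINF_greatest) (auto intro: med_cost_nonneg)
qed

text \<open>Any input point has cost 0, so it suffices to point the output registers at the first
  one, in place.\<close>

lemma k_median_if_D_zero:
  assumes zero: "\<And>p q. p \<in> X \<Longrightarrow> q \<in> X \<Longrightarrow> D p q = 0"
    and k: "1 \<le> k" and \<epsilon>: "0 \<le> \<epsilon>" and \<rho>: "0 \<le> \<rho>" and T: "\<And>n. 1 \<le> n \<Longrightarrow> 4 \<le> T n"
  shows "\<exists>prog. approximates_k_median d X D k \<epsilon> \<rho> T prog"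
proof (intro exI)
  let ?prog = "Seq (SetIdx 0 (NConst 1)) (SetIdx 1 (NConst 0))"
  show "approximates_k_median d X D k \<epsilon> \<rho> T ?prog"
    unfolding approximates_k_median_def
  proof (intro allI impI)
    fix ps assume ps: "distinct ps \<and> ps \<noteq> [] \<and> set ps \<subseteq> X"
    let ?s = "set_idx 1 0 (set_idx 0 1 (input_state d ps))"
    have "implements d D ?prog (input_state d ps) 4 (return_pmf ()) (\<lambda>_ s. s = ?s)"
      by (rule implements_SetIdx_Seq[where ?T2.0 = 2], rule implements_SetIdx) simp_all
    then obtain \<mu> where \<mu>: "exec d D ?prog (input_state d ps) \<mu>"
        "\<And>s t. (s, t) \<in> set_pmf \<mu> \<Longrightarrow> t \<le> 4 \<and> s = ?s"
      by (fastforce simp: implements_def rel_pmf_return_pmf1)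
    have p0: "ps ! 0 \<in> set ps" "0 < length ps" using ps by auto
    then have "ps ! 0 \<in> X" using ps by blast
    then have dim: "ps ! 0 \<in> carrier_vec d" using X_carrier by blast
    have "l < length ps * d" if "l < d" for l
    proof -
      have "1 * d \<le> length ps * d" using p0(2) by (intro mult_le_mono1) (simp add: Suc_le_eq)
      with that show ?thesis by linarith
    qed
    then have "point_at d ?s 0 = ps ! 0"
      using dim by (intro eq_vecI) (auto simp: point_at_def input_state_def)
    then have out: "output_set d ?s = {ps ! 0}" by (auto simp: output_set_def)
    have "{ps ! 0} \<in> medians X k" using \<open>ps ! 0 \<in> X\<close> k by (auto simp: medians_def)
    moreover have "med_cost D (set ps) {ps ! 0} = 0"
      using ps \<open>ps ! 0 \<in> X\<close> by (auto simp: med_cost_def zero intro!: sum.neutral)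
    moreover have "0 \<le> (1 + \<epsilon>) * opt_cost D X k (set ps)"
      using ps k \<epsilon> \<open>ps ! 0 \<in> X\<close> by (intro mult_nonneg_nonneg opt_cost_nonneg) auto
    ultimately have "measure_pmf.prob \<mu> UNIV \<le> measure_pmf.prob \<mu> {(s, t). output_set d s \<in> medians X k \<and>
                        med_cost D (set ps) (output_set d s) \<le> (1 + \<epsilon>) * opt_cost D X k (set ps)}"
      using \<mu>(2) out by (intro prob_mono_on_support) auto
    then have "1 - \<rho> \<le> measure_pmf.prob \<mu> {(s, t). output_set d s \<in> medians X k \<and>
                        med_cost D (set ps) (output_set d s) \<le> (1 + \<epsilon>) * opt_cost D X k (set ps)}"
      using \<rho> by simp
    moreover have "\<forall>(s, t)\<in>set_pmf \<mu>. real t \<le> T (length ps)"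
    proof clarify
      fix s t assume "(s, t) \<in> set_pmf \<mu>"
      then have "real t \<le> 4" using \<mu>(2) by fastforce
      then show "real t \<le> T (length ps)" using T[of "length ps"] p0(2) by linarith
    qed
    ultimately show "\<exists>\<mu>. exec d D ?prog (input_state d ps) \<mu> \<and>
             (\<forall>(s, t)\<in>set_pmf \<mu>. real t \<le> T (length ps)) \<and>
             1 - \<rho> \<le> measure_pmf.prob \<mu>
               {(s, t). output_set d s \<in> medians X k \<and>
                        med_cost D (set ps) (output_set d s)
                          \<le> (1 + \<epsilon>) * opt_cost D X k (set ps)}"
      using \<mu>(1) by blast
  qed
qed

text \<open>If a single random point were good for every two-point set, then both points would be, which
  contradicts the midpoint being much better.\<close>

lemma D_zero_if_one_sample:
  assumes sample: "\<And>F. F \<subseteq> X \<Longrightarrow> finite F \<Longrightarrow> F \<noteq> {} \<Longrightarrow>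
      8 / 10 \<le> measure_pmf.prob (replicate_pmf 1 (pmf_of_set F))
        {S. (\<Sum>p\<in>F. D p (centroid d (mset S))) \<le> (1 + \<gamma>) * opt_cost D X 1 F}"
    and \<gamma>: "0 \<le> \<gamma>" "\<gamma> < \<beta>" and p: "p \<in> X" and q: "q \<in> X"
  shows "D p q = 0"
proof (cases "p = q")
  case True then show ?thesis using D_self p by simp
next
  case False
  have F: "{p, q} \<subseteq> X" "finite {p, q}" "{p, q} \<noteq> {}" using p q by auto
  let ?o = "opt_cost D X 1 {p, q}" and ?m = "centroid d (mset_set {p, q})"
  have m: "?m \<in> X" using centroid_in[OF F] .
  have single: "centroid d {#x#} = x" if "x \<in> X" for x
    using centroid_singleton[OF that] by simp
  have good: "D p x + D q x \<le> (1 + \<gamma>) * ?o" if x: "x \<in> {p, q}" for x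
  proof (rule ccontr)
    assume bad: "\<not> ?thesis"
    have xX: "x \<in> X" using x p q by auto
    have "8 / 10 \<le> measure_pmf.prob (pmf_of_set {p, q})
        {y. D p (centroid d {#y#}) + D q (centroid d {#y#}) \<le> (1 + \<gamma>) * ?o}"
      using sample[OF F] False unfolding replicate_pmf_1 by (simp add: vimage_def)
    \<comment> \<open>If x failed, only the other point could succeed, with probability 1/2 <
      8/10.\<close>
    also have "\<dots> \<le> measure_pmf.prob (pmf_of_set {p, q}) ({p, q} - {x})"
      using bad single[OF xX] F by (intro prob_mono_on_support) auto
    also have "\<dots> = real (card ({p, q} \<inter> ({p, q} - {x}))) / real (card {p, q})"
      using F by (intro measure_pmf_of_set) auto
    also have "{p, q} \<inter> ({p, q} - {x}) = {p, q} - {x}" by auto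
    also have "real (card ({p, q} - {x})) / real (card {p, q}) = 1 / 2" using False x by auto
    finally show False by simp
  qed
  have mp: "2 * D ?m p \<le> \<gamma> * ?o" and mq: "2 * D ?m q \<le> \<gamma> * ?o"
    using good[of p] good[of q] centroid_identity[OF F p] centroid_identity[OF F q] False
    by (auto simp: algebra_simps)
  \<comment> \<open>Symmetry turns the bounds on distances from the midpoint into one on distances
    to it, whose sum is the optimum. This gives optimum \<le> \<gamma>/\<beta> * optimum, hence 0 by
    \<gamma> < \<beta>.\<close>
  have "?o = D p ?m + D q ?m" using opt_cost_1_centroid[OF F] False by simp
  also have "\<dots> \<le> D ?m p / \<beta> + D ?m q / \<beta>" by (intro add_mono D_sym2 p q m)
  also have "\<dots> \<le> \<gamma> * ?o / \<beta>"
  proof -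
    have "D ?m p + D ?m q \<le> \<gamma> * ?o" using mp mq by linarith
    from divide_right_mono[OF this, of \<beta>] show ?thesis
      using beta_pos by (simp add: add_divide_distrib)
  qed
  finally have le: "?o \<le> \<gamma> / \<beta> * ?o" by simp
  have o0: "0 \<le> ?o" using opt_cost_nonneg[OF F(1), of 1] p by auto
  have "?o = 0"
  proof (rule ccontr)
    assume "?o \<noteq> 0"
    then have "\<gamma> / \<beta> * ?o < 1 * ?o" using \<gamma> beta_pos o0 by (intro mult_strict_right_mono) auto
    then show False using le by simp
  qed
  then have z: "D ?m p = 0" "D ?m q = 0" using mp mq D_nonneg[OF m p] D_nonneg[OF m q] by auto
  have "D p q \<le> \<alpha> * (D p ?m + D ?m q)" by (rule D_tri[OF p q m])
  also have "\<dots> \<le> \<alpha> * (D ?m p / \<beta> + D ?m q)"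
    using D_sym2[OF p m] alpha_nonneg by (intro mult_left_mono) auto
  finally show ?thesis using z D_nonneg[OF p q] by simp
qed

end

section \<open>Explicit bounds on probability and time\<close>

context sampling_instance
begin

text \<open>The degree b + 4 collects b + 1 from \<open>close_frac\<close> and one each from the
  factors \<epsilon> of \<open>far_frac\<close> and \<open>near_frac\<close> and from \<epsilon>/k
  in \<open>stage_prob\<close>; 1/\<epsilon> is at most k/\<epsilon>.\<close>

lemma stage_prob_lower:
  "1 / stage_prob \<le> 2048 * \<alpha> ^ 3 * near_const * (32 * \<alpha>) ^ (b + 1) / \<beta> * (real k / \<epsilon>) ^ (b + 4)"
proof -
  define y where "y = real k / \<epsilon>"
  define x where "x = 32 * \<alpha> / \<epsilon>"
  have e: "1 / \<epsilon> \<le> y" using k_pos eps_pos by (simp add: y_def divide_right_mono)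
  have "\<epsilon> \<le> 32 * \<alpha>" using eps_le alpha_ge_1 by linarith
  then have x1: "1 \<le> x" using eps_pos by (simp add: x_def)
  have xy: "x \<le> 32 * \<alpha> * y" using mult_left_mono[OF e, of "32 * \<alpha>"] alpha_ge_1 by (simp add: x_def)
  have cl: "1 / close_frac = near_const * x ^ (b + 1)"
    using eps_pos alpha_ge_1 by (simp add: close_frac_def x_def power_divide field_simps)
  have "near_const \<le> near_const * x ^ (b + 1)"
    using near_const_ge_1 one_le_power[OF x1, of "b + 1"] by (simp add: mult_le_cancel_left1)
  then have far: "1 / far_frac \<le> 16 * \<alpha> * near_const * (x ^ (b + 1)) * (1 / \<epsilon>)"
  proof -
    assume "near_const \<le> near_const * x ^ (b + 1)"
    then have "1 / close_frac + near_const \<le> 2 * (near_const * x ^ (b + 1))"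
      unfolding cl by linarith
    then have "8 * \<alpha> * (1 / close_frac + near_const) \<le> 8 * \<alpha> * (2 * (near_const * x ^ (b + 1)))"
      using alpha_ge_1 by (intro mult_left_mono) auto
    then have "8 * \<alpha> * (1 / close_frac + near_const) * (1 / \<epsilon>)
        \<le> 8 * \<alpha> * (2 * (near_const * x ^ (b + 1))) * (1 / \<epsilon>)"
      using eps_pos by (intro mult_right_mono) auto
    then show ?thesis by (simp add: far_frac_def mult_ac)
  qed
  have "1 / stage_prob = (1 / far_frac) * (32 * \<alpha>\<^sup>2 / \<beta>) * (1 / \<epsilon>) * (4 * y)"
    using eps_pos beta_pos alpha_ge_1 k_pos far_frac_pos
    by (simp add: stage_prob_def near_frac_def y_def field_simps)
  also have "\<dots> \<le> (16 * \<alpha> * near_const * ((32 * \<alpha> * y) ^ (b + 1)) * y) * (32 * \<alpha>\<^sup>2 / \<beta>) * y * (4 * y)"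
  proof -
    have y0: "0 \<le> y" using k_pos eps_pos by (simp add: y_def)
    have "16 * \<alpha> * near_const * (x ^ (b + 1)) * (1 / \<epsilon>)
        \<le> 16 * \<alpha> * near_const * ((32 * \<alpha> * y) ^ (b + 1)) * y"
      using xy x1 e eps_pos alpha_ge_1 near_const_ge_1 y0
      by (intro mult_mono mult_left_mono power_mono mult_nonneg_nonneg) auto
    with far have "1 / far_frac \<le> 16 * \<alpha> * near_const * ((32 * \<alpha> * y) ^ (b + 1)) * y" by linarith
    moreover have "0 \<le> 1 / far_frac" using far_frac_pos by simp
    ultimately show ?thesis using e eps_pos alpha_ge_1 near_const_ge_1 y0 beta_pos
      by (intro mult_right_mono mult_mono) auto
  qed
  also have "\<dots> = 2048 * \<alpha> ^ 3 * near_const * (32 * \<alpha>) ^ (b + 1) / \<beta> * y ^ (b + 4)"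
    by (simp add: power_mult_distrib power_add power2_eq_square power3_eq_cube power4_eq_xxxx)
  finally show ?thesis by (simp add: y_def)
qed

end

context machine
begin

lemma total_time_le:
  assumes "1 \<le> d" "1 \<le> k" "1 \<le> M" "1 \<le> N"
  shows "16 + d * 4 + N * search_time \<le> 250 * (N * (k * M) * (n * d))"
proof -
  have n: "1 \<le> n" using ps_nonempty by (simp add: Suc_le_eq)
  define P where "P = M * (n * d)"
  define Q where "Q = k * P"
  have nd: "n \<le> n * d" "d \<le> n * d" "1 \<le> n * d" using assms n by auto
  then have "n * d \<le> P" using assms by (simp add: P_def)
  with nd have P: "n \<le> P" "d \<le> P" "1 \<le> P" "n * d \<le> P" by linarith+
  have "M * (39 * n + 13 * d + 16) \<le> M * (68 * (n * d))" using nd by (intro mult_le_mono2) linarith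
  then have "M * (39 * n + 13 * d + 16) \<le> 68 * P" by (simp add: P_def)
  moreover have "n * (d + 49) = n * d + 49 * n" by (simp add: algebra_simps)
  ultimately have st: "stage_time \<le> 151 * P"
    unfolding stage_time_def using P by linarith
  have "P \<le> Q" "k * d \<le> Q" using assms P by (auto simp: Q_def)
  with P have Q: "n \<le> Q" "d \<le> Q" "1 \<le> Q" "k * d \<le> Q" by linarith+
  have "k * stage_time \<le> 151 * Q" using mult_le_mono2[OF st, of k] by (simp add: Q_def)
  then have "trial_time \<le> 176 * Q" unfolding trial_time_def using Q by linarith
  then have "search_time \<le> 214 * Q" unfolding search_time_def using Q by linarith
  from mult_le_mono2[OF this, of N] have "N * search_time \<le> 214 * (N * Q)"
    by (simp only: mult.left_commute)
  moreover have "Q \<le> N * Q" using assms by simp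
  ultimately have "16 + d * 4 + N * search_time \<le> 250 * (N * Q)" using Q by linarith
  also have "N * Q = N * (k * M) * (n * d)" by (simp add: P_def Q_def mult_ac)
  finally show ?thesis .
qed

end

lemma ln_2_ge_half: "1 / 2 \<le> ln (2 :: real)"
  using ln_le_minus_one[of "1 / 2 :: real"] by (simp add: ln_div)

theorem theorem3:
  fixes \<alpha> \<beta> \<rho> \<eta> :: real
  assumes "0 \<le> \<alpha>" and "0 < \<beta>" and "\<beta> \<le> 1"
    and "0 < \<rho>" and "\<rho> < 1"
    and \<eta>: "\<eta> = 2 * \<alpha>^2 / \<beta>^2 * (1 + 1 / \<beta>)"
  shows "\<exists>K > 0. \<exists>e :: nat.
    \<forall>(f :: real \<Rightarrow> real \<Rightarrow> real) (\<epsilon> :: real) (d :: nat) (k :: nat) (X :: point set) (D :: dissim).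
      0 < \<epsilon> \<and> \<epsilon> \<le> 1 / 2 \<and> 1 \<le> d \<and> 1 \<le> k \<and>
      X \<subseteq> carrier_vec d \<and> dissimilarity_on X D \<and>
      approx_symmetric \<beta> X D \<and> approx_triangle \<alpha> X D \<and> centroid_property d X D \<and>
      (\<forall>\<gamma> \<delta>. 0 < \<gamma> \<and> \<gamma> \<le> 1 / 2 \<and> 0 < \<delta> \<and> \<delta> < 1 / 2 \<longrightarrow> sampling_property d X D f \<gamma> \<delta>) \<longrightarrow>
      (let g = \<bar>real k * f (\<epsilon> / (\<eta> * real k)) (2 / 10)\<bar> in
        \<exists>prog. approximates_k_median d X D k \<epsilon> \<rho>
          (\<lambda>n. K * (real n * real d * 2 powr (K * (g * ln (2 + g / \<epsilon>) ^ e)))) prog)"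
proof -
  \<comment> \<open>b depends on \<beta> only, so K below depends on \<alpha>, \<beta> and \<rho>,
    uniformly in f, \<epsilon>, d, k, X and D.\<close>
  obtain b where b: "(2 / (2 + \<beta>)) ^ b < (1 / 2 :: real)"
    using real_arch_pow_inv[of "1 / 2" "2 / (2 + \<beta>)"] assms(2) by auto
  define C where "C = 2048 * \<alpha> ^ 3 * (\<alpha> * (2 / \<beta> + 1)) * (32 * \<alpha>) ^ (b + 1) / \<beta>"
  \<comment> \<open>exp (A * L) is to dominate C * y^(b + 4); as L \<ge> 1/2, the constant ln C is
    absorbed as 2 * |ln C| * L.\<close>
  define A where "A = 2 * \<bar>ln C\<bar> + real b + 4"
  define R where "R = ln (1 / \<rho>) + 1"
  have R1: "1 \<le> R" using assms(4,5) by (simp add: R_def)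
  \<comment> \<open>250 * R pays for the constant factors. The exponent needs 2A + 2 for the number
    of trials and 4 for k * M; the sum is doubled because ln 2 \<ge> 1/2 is used to pass to base
    2.\<close>
  define K where "K = 250 * R + 4 * A + 12"
  have A0: "0 \<le> A" by (simp add: A_def)
  have K0: "0 < K" "4 \<le> K" using R1 A0 by (auto simp: K_def)
  show ?thesis
  proof (intro exI[of _ K] conjI exI[of _ "1 :: nat"] allI impI)
    fix f :: "real \<Rightarrow> real \<Rightarrow> real" and \<epsilon> :: real and d k :: nat and X :: "point set" and D :: dissim
    assume H: "0 < \<epsilon> \<and> \<epsilon> \<le> 1 / 2 \<and> 1 \<le> d \<and> 1 \<le> k \<and>
      X \<subseteq> carrier_vec d \<and> dissimilarity_on X D \<and>
      approx_symmetric \<beta> X D \<and> approx_triangle \<alpha> X D \<and> centroid_property d X D \<and>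
      (\<forall>\<gamma> \<delta>. 0 < \<gamma> \<and> \<gamma> \<le> 1 / 2 \<and> 0 < \<delta> \<and> \<delta> < 1 / 2 \<longrightarrow> sampling_property d X D f \<gamma> \<delta>)"
    define \<gamma> where "\<gamma> = \<epsilon> / (\<eta> * real k)"
    define g where "g = \<bar>real k * f \<gamma> (2 / 10)\<bar>"
    define L where "L = ln (2 + g / \<epsilon>)"
    let ?T = "\<lambda>n. K * (real n * real d * 2 powr (K * (g * L)))"
    interpret dissim_space d X D \<alpha> \<beta>
      using H assms by unfold_locales auto
    have g0: "0 \<le> g" by (simp add: g_def)
    have L_half: "1 / 2 \<le> L"
    proof -
      have "ln 2 \<le> L" unfolding L_def using g0 H by (intro ln_mono) auto
      then show ?thesis using ln_2_ge_half by linarith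
    qed
    have T4: "4 \<le> ?T n" if "1 \<le> n" for n
    proof -
      have "1 \<le> 2 powr (K * (g * L))" using K0 g0 L_half by (intro ge_one_powr_ge_zero) auto
      moreover have "1 * 1 \<le> real n * real d" using that H by (intro mult_mono) auto
      ultimately have "1 * 1 \<le> real n * real d * 2 powr (K * (g * L))" by (intro mult_mono) auto
      then have "4 * 1 \<le> K * (real n * real d * 2 powr (K * (g * L)))"
        using K0 by (intro mult_mono) auto
      then show ?thesis by simp
    qed
    have zero_case: "\<exists>prog. approximates_k_median d X D k \<epsilon> \<rho> ?T prog"
      if "\<And>p q. p \<in> X \<Longrightarrow> q \<in> X \<Longrightarrow> D p q = 0"
      using that H assms(4) T4 by (intro k_median_if_D_zero) auto
    have "\<exists>prog. approximates_k_median d X D k \<epsilon> \<rho> ?T prog"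
    proof (cases "\<alpha> < 1")
      case True
      then show ?thesis using D_zero_if_alpha_small by (intro zero_case)
    next
      case False
      then have \<alpha>1: "1 \<le> \<alpha>" by simp
      \<comment> \<open>This is all that is used of \<eta>: it yields \<gamma> \<le>
        \<epsilon>\<beta>/4, hence both \<gamma> \<le> \<epsilon>/4 for the sampling analysis and
        \<gamma> < \<beta> for the case of one sample point.\<close>
      have \<eta>_ge: "4 / \<beta> \<le> \<eta>"
      proof -
        have "1 \<le> \<alpha>\<^sup>2" using \<alpha>1 by simp
        moreover have "\<beta>\<^sup>2 \<le> \<beta>" using assms(2,3) by (simp add: power2_eq_square mult_left_le)
        ultimately have "2 * 1 / \<beta> \<le> 2 * \<alpha>\<^sup>2 / \<beta>\<^sup>2"
          using assms(2) by (intro frac_le) auto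
        moreover have "2 \<le> 1 + 1 / \<beta>" using assms(2,3) by simp
        ultimately have "2 * 1 / \<beta> * 2 \<le> 2 * \<alpha>\<^sup>2 / \<beta>\<^sup>2 * (1 + 1 / \<beta>)"
          using assms(2) by (intro mult_mono) auto
        then show ?thesis by (simp add: \<eta>)
      qed
      have "4 \<le> 4 / \<beta>" using assms(2,3) by (simp add: le_divide_eq)
      then have \<eta>4: "4 \<le> \<eta>" using \<eta>_ge by linarith
      have \<gamma>0: "0 < \<gamma>" using H \<eta>4 by (simp add: \<gamma>_def)
      have \<gamma>_le: "\<gamma> \<le> \<epsilon> / \<eta>"
      proof -
        have "\<eta> * 1 \<le> \<eta> * real k" using H \<eta>4 by (intro mult_left_mono) auto
        then show ?thesis unfolding \<gamma>_def using H \<eta>4 by (intro divide_left_mono) auto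
      qed
      also have "\<epsilon> / \<eta> \<le> \<epsilon> / (4 / \<beta>)"
        using \<eta>_ge H assms(2) \<eta>4 by (intro divide_left_mono) auto
      finally have \<gamma>\<beta>: "\<gamma> \<le> \<epsilon> * \<beta> / 4" by simp
      have "\<epsilon> * \<beta> < 4 * \<beta>" using H assms(2) by (intro mult_strict_right_mono) auto
      then have \<gamma>_less: "\<gamma> < \<beta>" using \<gamma>\<beta> by linarith
      have "\<epsilon> * \<beta> \<le> \<epsilon>" using H assms(2,3) by (simp add: mult_left_le)
      then have \<gamma>4: "\<gamma> \<le> \<epsilon> / 4" using \<gamma>\<beta> by linarith
      then have "\<gamma> \<le> 1 / 2" using H by linarith
      then have samp: "sampling_property d X D f \<gamma> (2 / 10)" using H \<gamma>0 by auto
      define M where "M = nat \<lceil>f \<gamma> (2 / 10)\<rceil>"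
      have f0: "0 < f \<gamma> (2 / 10)" using samp by (simp add: sampling_property_def)
      have s_in: "centroid d (mset S) \<in> X"
        if "F \<subseteq> X" "finite F" "F \<noteq> {}" "S \<in> set_pmf (replicate_pmf M (pmf_of_set F))" for F S
        using samp that unfolding sampling_property_def M_def Let_def by blast
      have s_prob: "8 / 10 \<le> measure_pmf.prob (replicate_pmf M (pmf_of_set F))
          {S. (\<Sum>p\<in>F. D p (centroid d (mset S))) \<le> (1 + \<gamma>) * opt_cost D X 1 F}"
        if "F \<subseteq> X" "finite F" "F \<noteq> {}" for F
      proof -
        have "1 - 2 / 10 \<le> measure_pmf.prob (replicate_pmf M (pmf_of_set F))
          {S. (\<Sum>p\<in>F. D p (centroid d (mset S))) \<le> (1 + \<gamma>) * opt_cost D X 1 F}"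
          using samp that unfolding sampling_property_def M_def Let_def by blast
        then show ?thesis by simp
      qed
      show ?thesis
      \<comment> \<open>For f > 1 rounding at most doubles f, so k * M \<le> 2g and k \<le> g. For f
        \<le> 1 the quantity g could be tiny compared with k, but then M = 1 and D vanishes.\<close>
      proof (cases "f \<gamma> (2 / 10) \<le> 1")
        case True
        then have "\<lceil>f \<gamma> (2 / 10)\<rceil> = 1" using f0 by (intro ceiling_unique) auto
        then have "M = 1" by (simp add: M_def)
        then show ?thesis
          using s_prob \<gamma>0 \<gamma>_less by (intro zero_case D_zero_if_one_sample[of \<gamma>]) auto
      next
        case False
        define \<phi> where "\<phi> = f \<gamma> (2 / 10)"
        have \<phi>: "1 < \<phi>" using False by (simp add: \<phi>_def)
        have g_eq: "g = real k * \<phi>" using \<phi> by (simp add: g_def \<phi>_def)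
        have M_le: "real M \<le> 2 * \<phi>"
        proof -
          have "real M = of_int \<lceil>\<phi>\<rceil>" using \<phi> by (simp add: M_def \<phi>_def)
          also have "\<dots> \<le> \<phi> + 1" by linarith
          finally show ?thesis using \<phi> by linarith
        qed
        have M1: "1 \<le> M" using \<phi> by (simp add: M_def \<phi>_def Suc_le_eq)
        have kM: "real (k * M) \<le> 2 * g"
          using mult_left_mono[OF M_le, of "real k"] by (simp add: g_eq)
        have k_g: "real k \<le> g"
          using mult_left_mono[of 1 \<phi> "real k"] \<phi> by (simp add: g_eq)
        have g1: "1 \<le> g" using k_g H by linarith
        define y where "y = real k / \<epsilon>"
        have y1: "1 \<le> y" using H by (simp add: y_def)
        have ln_y: "0 \<le> ln y" "ln y \<le> L"
        proof -
          show "0 \<le> ln y" using y1 by simp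
          have "y \<le> g / \<epsilon>" unfolding y_def using k_g H by (intro divide_right_mono) auto
          then show "ln y \<le> L" unfolding L_def using y1 by (intro ln_mono) auto
        qed
        have C0: "0 < C" unfolding C_def using \<alpha>1 assms(2)
          by (intro divide_pos_pos mult_pos_pos zero_less_power add_pos_pos) auto
        \<comment> \<open>A lower bound for \<open>stage_prob\<close> that does not mention the
          point set, as N must be chosen before it.\<close>
        define sp where "sp = exp (- (A * L))"
        define p where "p = (sp ^ M * (8 / 10)) ^ k"
        \<comment> \<open>By 1 - p \<le> exp (-p), this many trials all fail with probability at
          most \<rho>.\<close>
        define N where "N = nat \<lceil>ln (1 / \<rho>) / p\<rceil>"
        have sp0: "0 < sp" by (simp add: sp_def)
        have sp1: "sp \<le> 1" using A0 L_half by (simp add: sp_def)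
        have p0: "0 < p" using sp0 by (simp add: p_def)
        have p1: "p \<le> 1"
        proof -
          have "sp ^ M * (8 / 10) \<le> 1 * 1" using sp0 sp1 by (intro mult_mono power_le_one) auto
          then show ?thesis unfolding p_def using sp0 by (intro power_le_one) auto
        qed
        have ln\<rho>: "0 < ln (1 / \<rho>)" using assms(4,5) by simp
        have N_ge: "ln (1 / \<rho>) / p \<le> real N" unfolding N_def by linarith
        have "0 < ln (1 / \<rho>) / p" using ln\<rho> p0 by simp
        then have N1: "1 \<le> N" by (simp add: N_def Suc_le_eq)
        have fail: "(1 - p) ^ N \<le> \<rho>"
        proof -
          have "(1 - p) ^ N \<le> exp (- p) ^ N"
            using p1 exp_ge_add_one_self[of "- p"] by (intro power_mono) auto
          also have "\<dots> = exp (- (p * real N))" by (simp add: exp_of_nat_mult[symmetric] mult.commute)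
          also have "\<dots> \<le> exp (- ln (1 / \<rho>))"
            using N_ge p0 by (simp add: divide_le_eq mult.commute)
          also have "\<dots> = \<rho>" using assms(4) by (simp add: ln_div)
          finally show ?thesis .
        qed
        have time: "250 * (real N * real (k * M) * (real n * real d)) \<le> ?T n" for n
        proof -
          have inv_p: "1 / p \<le> exp ((2 * A + 2) * (g * L))"
          proof -
            have "(10 / 8 :: real) \<le> exp 1" using exp_ge_add_one_self[of 1] by linarith
            then have c: "(10 / 8) ^ k \<le> exp (real k)"
              using power_mono[of "10 / 8" "exp 1 :: real" k] by (simp add: exp_of_nat_mult[symmetric])
            have "1 / p = (1 / sp) ^ (M * k) * (10 / 8) ^ k"
              by (simp add: p_def power_mult power_mult_distrib power_divide field_simps)
            also have "1 / sp = exp (A * L)" by (simp add: sp_def exp_minus field_simps)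
            also have "exp (A * L) ^ (M * k) = exp (real (k * M) * (A * L))"
              by (simp add: exp_of_nat_mult[symmetric] mult_ac)
            also have "\<dots> \<le> exp (2 * g * (A * L))"
              using kM A0 L_half by (simp add: mult_right_mono)
            also note c
            also have "exp (real k) \<le> exp (2 * (g * L))"
            proof -
              have "g * 1 \<le> g * (2 * L)" using g0 L_half by (intro mult_left_mono) auto
              then show ?thesis using k_g by simp
            qed
            also have "exp (2 * g * (A * L)) * exp (2 * (g * L)) = exp ((2 * A + 2) * (g * L))"
              by (simp add: exp_add[symmetric] algebra_simps)
            finally show ?thesis by simp
          qed
          have "real N \<le> ln (1 / \<rho>) / p + 1" unfolding N_def using ln\<rho> p0
            by (simp add: of_nat_nat)
          also have "1 \<le> 1 / p" using p0 p1 by simp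
          then have "ln (1 / \<rho>) / p + 1 \<le> R * (1 / p)" by (simp add: R_def algebra_simps add_divide_distrib)
          also have "\<dots> \<le> R * exp ((2 * A + 2) * (g * L))" using inv_p R1 by (intro mult_left_mono) auto
          finally have N_le: "real N \<le> R * exp ((2 * A + 2) * (g * L))" .
          have "real (k * M) \<le> 2 * g" by (rule kM)
          also have "\<dots> \<le> exp (2 * g)" using exp_ge_add_one_self[of "2 * g"] by linarith
          also have "\<dots> \<le> exp (4 * (g * L))"
          proof -
            have "g * 2 \<le> g * (4 * L)" using g0 L_half by (intro mult_left_mono) auto
            then show ?thesis by (simp add: mult_ac)
          qed
          finally have kM_le: "real (k * M) \<le> exp (4 * (g * L))" .
          have "real N * real (k * M) \<le> (R * exp ((2 * A + 2) * (g * L))) * exp (4 * (g * L))"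
            using N_le kM_le R1 by (intro mult_mono) auto
          also have "\<dots> = R * exp ((2 * A + 6) * (g * L))"
            by (simp add: exp_add[symmetric] algebra_simps)
          also have "\<dots> \<le> R * 2 powr (K * (g * L))"
          proof -
            have "2 * A + 6 \<le> K * (1 / 2)" using R1 by (simp add: K_def)
            also have "\<dots> \<le> K * ln 2" using K0 ln_2_ge_half by (intro mult_left_mono) auto
            finally have "(2 * A + 6) * (g * L) \<le> K * ln 2 * (g * L)"
              using g0 L_half by (intro mult_right_mono) auto
            then have "exp ((2 * A + 6) * (g * L)) \<le> 2 powr (K * (g * L))"
              by (simp add: powr_def mult_ac)
            then show ?thesis using R1 by (intro mult_left_mono) auto
          qed
          finally have "250 * (real N * real (k * M)) \<le> 250 * R * 2 powr (K * (g * L))" by simp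
          also have "\<dots> \<le> K * 2 powr (K * (g * L))"
            using A0 by (intro mult_right_mono) (auto simp: K_def)
          finally have "250 * (real N * real (k * M)) * (real n * real d)
              \<le> K * 2 powr (K * (g * L)) * (real n * real d)"
            by (intro mult_right_mono) auto
          then show ?thesis by (simp add: mult_ac)
        qed
        have "approximates_k_median d X D k \<epsilon> \<rho> ?T (k_median_com d k M N)"
          unfolding approximates_k_median_def
        proof (intro allI impI)
          fix ps assume ps: "distinct ps \<and> ps \<noteq> [] \<and> set ps \<subseteq> X"
          interpret sampling_instance d X D \<alpha> \<beta> b \<epsilon> k M \<gamma> ps
            using H ps \<alpha>1 b \<gamma>0 \<gamma>4 s_in s_prob by unfold_locales auto
          interpret machine d k M D ps
            using ps X_carrier by unfold_locales auto
          have sp_le: "sp \<le> stage_prob"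
          proof -
            have "1 / stage_prob \<le> C * y ^ (b + 4)"
              using stage_prob_lower by (simp add: C_def y_def near_const_def)
            also have "\<dots> = exp (ln C + real (b + 4) * ln y)"
              unfolding exp_add exp_of_nat_mult using C0 y1 by simp
            also have "\<dots> \<le> exp (A * L)"
            proof -
              have "ln C \<le> 2 * \<bar>ln C\<bar> * L"
                using L_half mult_left_mono[of "1 / 2" L "2 * \<bar>ln C\<bar>"] by simp
              moreover have "real (b + 4) * ln y \<le> real (b + 4) * L"
                using ln_y by (intro mult_left_mono) auto
              ultimately show ?thesis by (simp add: A_def algebra_simps)
            qed
            finally have "1 / stage_prob \<le> 1 / sp" by (simp add: sp_def exp_minus field_simps)
            then show ?thesis using sp0 stage_prob_pos by (simp add: field_simps)
          qed
          have p_le: "p \<le> (stage_prob ^ M * (8 / 10)) ^ k"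
            unfolding p_def using sp_le sp0 by (intro power_mono mult_right_mono) auto
          let ?cost = "\<lambda>cs. med_cost D (set ps) (set cs)"
          let ?G = "{b. \<exists>cs. b = Some cs \<and> set cs \<subseteq> X \<and> length cs = k \<and>
             ?cost cs \<le> (1 + \<epsilon>) * opt_cost D X k (set ps)}"
          have cost_eq: "cost cs = ?cost cs" and cost_nonneg: "0 \<le> cost cs"
            if "cs \<in> set_pmf (trial d D ps M k)" for cs
          proof -
            have cs: "set cs \<subseteq> X" "cs \<noteq> []" using trial_in[OF that] k_pos by auto
            then show "cost cs = ?cost cs" by (simp add: cost_def sum_ps sum_weight)
            show "0 \<le> cost cs"
              unfolding cost_def sum_ps using cs ps_X by (auto intro!: sum_nonneg weight_nonneg)
          qed
          have "implements d D (k_median_com d k M N) (input_state d ps) (16 + d * 4 + N * search_time)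
              (best_of cost (trial d D ps M k) N)
              (\<lambda>b s. \<forall>cs. b = Some cs \<and> set cs \<subseteq> carrier_vec d \<longrightarrow> output_set d s = set cs)"
            using k_pos cost_nonneg by (rule implements_k_median)
          then obtain \<mu> where \<mu>: "exec d D (k_median_com d k M N) (input_state d ps) \<mu>"
            and rel: "rel_pmf (\<lambda>b (s, t). t \<le> 16 + d * 4 + N * search_time \<and>
                (\<forall>cs. b = Some cs \<and> set cs \<subseteq> carrier_vec d \<longrightarrow> output_set d s = set cs))
              (best_of cost (trial d D ps M k) N) \<mu>"
            by (auto simp: implements_def)
          have "real t \<le> ?T (length ps)" if "(s, t) \<in> set_pmf \<mu>" for s t
          proof -
            have "t \<le> 16 + d * 4 + N * search_time"
              using rel_pmf_imp_rel_set[OF rel] that by (fastforce simp: rel_set_def)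
            also have "\<dots> \<le> 250 * (N * (k * M) * (length ps * d))"
              using H M1 N1 by (intro total_time_le) auto
            finally have "real t \<le> real (250 * (N * (k * M) * (length ps * d)))" by (rule of_nat_mono)
            also have "\<dots> = 250 * (real N * real (k * M) * (real (length ps) * real d))" by simp
            finally show ?thesis using time[of "length ps"] by linarith
          qed
          moreover have "1 - \<rho> \<le> measure_pmf.prob \<mu> {(s, t). output_set d s \<in> medians X k \<and>
             med_cost D (set ps) (output_set d s) \<le> (1 + \<epsilon>) * opt_cost D X k (set ps)}"
          proof -
            have "1 - \<rho> \<le> measure_pmf.prob (best_of cost (trial d D ps M k) N) ?G"
            proof -
              have "best_of cost (trial d D ps M k) N = best_of ?cost (trial d D ps M k) N"
                by (rule best_of_cong) (rule cost_eq)
              then show ?thesis using best_of_success[OF p_le fail p1] by simp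
            qed
            also have "\<dots> \<le> measure_pmf.prob \<mu> {x. \<exists>b\<in>?G. case x of (s, t) \<Rightarrow>
                t \<le> 16 + d * 4 + N * search_time \<and>
                (\<forall>cs. b = Some cs \<and> set cs \<subseteq> carrier_vec d \<longrightarrow> output_set d s = set cs)}"
              by (rule rel_pmf_measureD[OF rel])
            also have "\<dots> \<le> measure_pmf.prob \<mu> {(s, t). output_set d s \<in> medians X k \<and>
               med_cost D (set ps) (output_set d s) \<le> (1 + \<epsilon>) * opt_cost D X k (set ps)}"
            proof (rule prob_mono_on_support, clarify, intro conjI)
              fix s :: state and t :: nat and cs
              assume cs: "set cs \<subseteq> X" "k = length cs" "?cost cs \<le> (1 + \<epsilon>) * opt_cost D X (length cs) (set ps)"
                and out: "\<forall>cs'. Some cs = Some cs' \<and> set cs' \<subseteq> carrier_vec d \<longrightarrow> output_set d s = set cs'"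
              have o: "output_set d s = set cs" using out cs X_carrier by blast
              show "output_set d s \<in> medians X (length cs)"
                unfolding o medians_def using cs k_pos by (auto intro: card_length)
              show "med_cost D (set ps) (output_set d s) \<le> (1 + \<epsilon>) * opt_cost D X (length cs) (set ps)"
                unfolding o using cs by simp
            qed
            finally show ?thesis .
          qed
          ultimately show "\<exists>\<mu>. exec d D (k_median_com d k M N) (input_state d ps) \<mu> \<and>
             (\<forall>(s, t)\<in>set_pmf \<mu>. real t \<le> ?T (length ps)) \<and>
             1 - \<rho> \<le> measure_pmf.prob \<mu>
               {(s, t). output_set d s \<in> medians X k \<and>
                        med_cost D (set ps) (output_set d s)
                          \<le> (1 + \<epsilon>) * opt_cost D X k (set ps)}"
            using \<mu> by blast
        qed
        then show ?thesis by blast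
      qed
    qed
    then show "let g = \<bar>real k * f (\<epsilon> / (\<eta> * real k)) (2 / 10)\<bar> in
        \<exists>prog. approximates_k_median d X D k \<epsilon> \<rho>
          (\<lambda>n. K * (real n * real d * 2 powr (K * (g * ln (2 + g / \<epsilon>) ^ 1)))) prog"
      by (simp only: Let_def g_def[symmetric] \<gamma>_def[symmetric] L_def power_one_right)
  qed (rule K0)
qed

end
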